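(* Let $\Sigma=(X,\sigma)$ be a topological dynamical system, with $X$ a non-empty compact Hausdorff space and $\sigma$ a homeomorphism of $X$, and let $I$ be an ideal of $\ell^1(\Sigma)$. Then the following are equivalent: (1) $\mathcal I(\mathcal Z(I))=I$; (2) there exist (possibly empty) sets $S_{\mathrm{ap}}\subset\mathrm{Aper}(\sigma)$, $S_{\mathrm p}\subset\mathrm{Per}(\sigma)$, and, for each $x\in S_{\mathrm p}$, a set $\mathbb T_x\subset\mathbb T$, such that $$I=\bigcap_{x\in S_{\mathrm{ap}}}P_x\,\cap\,\bigcap_{x\in S_{\mathrm p}}\bigcap_{\lambda\in\mathbb T_x}P_{x,\lambda};$$ (3) $I$ is the kernel of an involutive representation of $\ell^1(\Sigma)$; (4) if $I'$ is an ideal of $\ell^1(\Sigma)$, then $I'\subset I$ if and only if $\mathcal Z(I')\supset\mathcal Z(I)$. In that case, $I$ is a self-adjoint closed ideal of $\ell^1(\Sigma)$. If $S_{\mathrm{ap}}\subset\mathrm{Aper}(\sigma)$, $S_{\mathrm p}\subset\mathrm{Per}(\sigma)$, and, for each $x\in S_{\mathrm{ap}}\cup S_{\mathrm p}$, $\mathbb T_x\subset\mathbb T$, are such that $$\mathcal Z(I)=\bigcup_{x\in S_{\mathrm{ap}}}\bigcup_{\lambda\in\mathbb T_x}(\mathbb Z\cdot x)\times\{\lambda\}\ \cup\ \bigcup_{x\in S_{\mathrm p}}\bigcup_{\mu\in\mathbb T_x}(\mathbb Z\cdot x)\times\{\mu\},$$ then $$I=\bigcap_{x\in S_{\mathrm{ap}}}P_x\,\cap\,\bigcap_{x\in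 S_{\mathrm p}}\bigcap_{\mu\in\mathbb T_x}P_{x,\mu^{p(x)}},$$ where $p(x)$ denotes the period of $x\in S_{\mathrm p}$, is an explicit intersection as in part (2).
   Context: Algebra. $C(X)$ is the algebra of continuous complex functions on $X$ with supremum norm, and $\alpha(f)=f\circ\sigma^{-1}$ for $f\in C(X)$. $\ell^1(\Sigma)$ is the set of maps $a:\mathbb Z\to C(X)$ with $\|a\|=\sum_n\|a(n)\|<\infty$, with product $(aa')(n)=\sum_{k\in\mathbb Z}a(k)\,\alpha^k(a'(n-k))$ and involution $a^*(n)=\overline{\alpha^n(a(-n))}$; it is a unital Banach $*$-algebra with isometric involution. Let $\delta$ be the element with value $1$ at $1$ and $0$ elsewhere, and identify $C(X)$ with the elements supported at $0$. Each $a\in\ell^1(\Sigma)$ is uniquely a norm convergent sum $a=\sum_n a_n\delta^n$ with $a_n=a(n)\in C(X)$. Ideals are two-sided (not assumed closed unless stated). An intersection over an empty index set is $\ell^1(\Sigma)$. An involutive representation is a $*$-homomorphism into the bounded operators on a Hilbert space; the zero representation (with kernel $\ell^1(\Sigma)$) is allowed. Transform. For $a=\sum_n a_n\delta^n$ put $\mathfrak F(a)(x,\lambda)=\sum_n\lambda^na_n(x)$, $(x,\lambda)\in X\times\mathbb T$, where $\mathbb T$ is the unit circle in $\mathbb C$. For a linear subspace $L\subset\ell^1(\Sigma)$, $\mathcal Z(L)=\{(x,\lambda)\in X\times\mathbb T:\mathfrak F(a)(x,\lambda)=0\ \forall a\in L\}$. For $S\subset X\times\mathbb T$, $\mathcal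 I(S)=\{a\in\ell^1(\Sigma):\mathfrak F(a f)(x,\lambda)=0\text{ for all }f\in C(X)\text{ and all }(x,\lambda)\in S\}$. Points and representations. $\mathrm{Aper}(\sigma)$ and $\mathrm{Per}(\sigma)$ are the sets of aperiodic and periodic points of $\sigma$; $\mathbb Z\cdot x$ is the orbit of $x$. For $x\in\mathrm{Aper}(\sigma)$, $P_x=\ker\pi_x$, where $\pi_x$ is the involutive representation on a Hilbert space with orthonormal basis $(e_k)_{k\in\mathbb Z}$ given by $\pi_x(\delta)e_k=e_{k+1}$, $\pi_x(f)e_k=f(\sigma^kx)e_k$ $(f\in C(X))$. For $x$ of (minimal) period $p$ and $\lambda\in\mathbb T$, $P_{x,\lambda}=\ker\pi_{x,\lambda}$, where $\pi_{x,\lambda}$ is the involutive representation on a Hilbert space with orthonormal basis $e_0,\dots,e_{p-1}$ given by $\pi_{x,\lambda}(\delta)e_k=e_{k+1}$ for $0\le k<p-1$, $\pi_{x,\lambda}(\delta)e_{p-1}=\lambda e_0$, $\pi_{x,\lambda}(f)e_k=f(\sigma^kx)e_k$.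
   Formalization: In the last assertion the sets T_x for x in S_ap are additionally assumed non-empty; with an empty T_x it fails (I the whole algebra, Z(I) empty, S_ap={x}, T_x and S_p empty would give ℓ¹(Σ)=P_x). *)

theory Defs
  imports "HOL-Analysis.Analysis"
begin

section \<open>Integer iterates, orbits, periodic points\<close>

text \<open>Only meaningful for bijective \<open>f\<close>.\<close>

definition int_iter :: "('a \<Rightarrow> 'a) \<Rightarrow> int \<Rightarrow> 'a \<Rightarrow> 'a" where
  "int_iter f n = (if 0 \<le> n then f ^^ nat n else inv f ^^ nat (- n))"

definition orbit_of :: "('a \<Rightarrow> 'a) \<Rightarrow> 'a \<Rightarrow> 'a set" where
  "orbit_of \<sigma> x = range (\<lambda>n. int_iter \<sigma> n x)"

definition Per :: "('a \<Rightarrow> 'a) \<Rightarrow> 'a set" where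
  "Per \<sigma> = {x. \<exists>n>0. (\<sigma> ^^ n) x = x}"

definition Aper :: "('a \<Rightarrow> 'a) \<Rightarrow> 'a set" where
  "Aper \<sigma> = - Per \<sigma>"

definition period :: "('a \<Rightarrow> 'a) \<Rightarrow> 'a \<Rightarrow> nat" where
  "period \<sigma> x = (LEAST n. 0 < n \<and> (\<sigma> ^^ n) x = x)"

section \<open>The algebra of continuous functions\<close>

text \<open>For a compact space \<open>'a\<close>, the Banach space \<open>'a \<Rightarrow>\<^sub>C complex\<close> of bounded continuous functions
  with the supremum norm is the space of all continuous complex functions. The library does not
  provide its algebra structure and involution.\<close>

definition cf_mult ::
  "('a::topological_space \<Rightarrow>\<^sub>C complex) \<Rightarrow> ('a \<Rightarrow>\<^sub>C complex) \<Rightarrow> ('a \<Rightarrow>\<^sub>C complex)" where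
  "cf_mult f g = Bcontfun (\<lambda>x. apply_bcontfun f x * apply_bcontfun g x)"

definition cf_cnj :: "('a::topological_space \<Rightarrow>\<^sub>C complex) \<Rightarrow> ('a \<Rightarrow>\<^sub>C complex)" where
  "cf_cnj f = Bcontfun (\<lambda>x. cnj (apply_bcontfun f x))"

definition cf_scale :: "complex \<Rightarrow> ('a::topological_space \<Rightarrow>\<^sub>C complex) \<Rightarrow> ('a \<Rightarrow>\<^sub>C complex)" where
  "cf_scale c f = cf_mult (const_bcontfun c) f"

definition alpha ::
  "('a \<Rightarrow> 'a) \<Rightarrow> ('a::topological_space \<Rightarrow>\<^sub>C complex) \<Rightarrow> ('a \<Rightarrow>\<^sub>C complex)" where
  "alpha \<sigma> f = Bcontfun (apply_bcontfun f \<circ> inv \<sigma>)"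

lemma apply_cf_mult:
  "apply_bcontfun (cf_mult f g) x = apply_bcontfun f x * apply_bcontfun g x"
proof -
  have "(\<lambda>x. apply_bcontfun f x * apply_bcontfun g x) \<in> bcontfun"
  proof (rule bcontfun_normI)
    show "continuous_on UNIV (\<lambda>x. apply_bcontfun f x * apply_bcontfun g x)"
      by (intro continuous_intros) auto
    show "norm (apply_bcontfun f x * apply_bcontfun g x) \<le> norm f * norm g" for x
      by (auto simp: norm_mult intro!: mult_mono norm_bounded)
  qed
  then show ?thesis by (simp add: cf_mult_def Bcontfun_inverse)
qed

lemma apply_cf_cnj: "apply_bcontfun (cf_cnj f) x = cnj (apply_bcontfun f x)"
proof -
  have "(\<lambda>x. cnj (apply_bcontfun f x)) \<in> bcontfun"
    by (rule bcontfun_normI[where b = "norm f"])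
       (auto intro!: continuous_intros norm_bounded)
  then show ?thesis by (simp add: cf_cnj_def Bcontfun_inverse)
qed

lemma apply_alpha:
  assumes "homeomorphism UNIV UNIV \<sigma> (inv \<sigma>)"
  shows "apply_bcontfun (alpha \<sigma> f) x = apply_bcontfun f (inv \<sigma> x)"
proof -
  have "continuous_on UNIV (\<lambda>x. apply_bcontfun f (inv \<sigma> x))"
    using assms by (auto simp: homeomorphism_def intro: continuous_on_compose2[of UNIV])
  then have "apply_bcontfun f \<circ> inv \<sigma> \<in> bcontfun"
    by (intro bcontfun_normI[where b = "norm f"]) (auto simp: o_def norm_bounded)
  then show ?thesis by (simp add: alpha_def Bcontfun_inverse)
qed

lemma apply_int_iter_alpha:
  assumes "homeomorphism UNIV UNIV \<sigma> (inv \<sigma>)"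
  shows "apply_bcontfun (int_iter (alpha \<sigma>) k f) x = apply_bcontfun f (int_iter \<sigma> (- k) x)"
proof -
  have bij: "bij \<sigma>"
    using assms unfolding homeomorphism_def
    by (metis UNIV_I bij_betw_def inj_on_inverseI)
  have homeo': "homeomorphism UNIV UNIV (inv \<sigma>) (inv (inv \<sigma>))"
    using assms homeomorphism_symD[OF assms] by (simp add: inv_inv_eq[OF bij])
  have inv_alpha: "inv (alpha \<sigma>) = alpha (inv \<sigma>)"
  proof (rule inv_equality)
    show "alpha (inv \<sigma>) (alpha \<sigma> f) = f" for f
      by (rule bcontfun_eqI)
         (simp add: apply_alpha[OF assms] apply_alpha[OF homeo'] inv_inv_eq[OF bij]
            inv_f_f[OF bij_is_inj[OF bij]])
    show "alpha \<sigma> (alpha (inv \<sigma>) f) = f" for f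
      by (rule bcontfun_eqI)
         (simp add: apply_alpha[OF assms] apply_alpha[OF homeo'] inv_inv_eq[OF bij]
            surj_f_inv_f[OF bij_is_surj[OF bij]])
  qed
  have pos: "apply_bcontfun ((alpha \<sigma> ^^ n) f) x = apply_bcontfun f ((inv \<sigma> ^^ n) x)" for n x
    by (induction n arbitrary: x)
       (simp_all add: apply_alpha[OF assms] funpow_swap1[of "inv \<sigma>"])
  have neg: "apply_bcontfun ((alpha (inv \<sigma>) ^^ n) f) x = apply_bcontfun f ((\<sigma> ^^ n) x)" for n x
    by (induction n arbitrary: x)
       (simp_all add: apply_alpha[OF homeo'] inv_inv_eq[OF bij] funpow_swap1[of \<sigma>])
  show ?thesis
    by (auto simp: int_iter_def inv_alpha pos neg)
qed

section \<open>The Banach *-algebra of the dynamical system\<close>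

definition l1 :: "(int \<Rightarrow> ('a::topological_space \<Rightarrow>\<^sub>C complex)) set" where
  "l1 = {a. (\<lambda>n. norm (a n)) summable_on UNIV}"

definition l1_dist ::
  "(int \<Rightarrow> ('a::topological_space \<Rightarrow>\<^sub>C complex)) \<Rightarrow> (int \<Rightarrow> ('a \<Rightarrow>\<^sub>C complex)) \<Rightarrow> real" where
  "l1_dist a b = (\<Sum>\<^sub>\<infinity>n. norm (a n - b n))"

definition l1_zero :: "int \<Rightarrow> ('a::topological_space \<Rightarrow>\<^sub>C complex)" where
  "l1_zero = (\<lambda>n. 0)"

definition l1_add ::
  "(int \<Rightarrow> ('a::topological_space \<Rightarrow>\<^sub>C complex)) \<Rightarrow> (int \<Rightarrow> ('a \<Rightarrow>\<^sub>C complex)) \<Rightarrow> int \<Rightarrow> ('a \<Rightarrow>\<^sub>C complex)"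
  where "l1_add a b = (\<lambda>n. a n + b n)"

definition l1_scale ::
  "complex \<Rightarrow> (int \<Rightarrow> ('a::topological_space \<Rightarrow>\<^sub>C complex)) \<Rightarrow> int \<Rightarrow> ('a \<Rightarrow>\<^sub>C complex)" where
  "l1_scale c a = (\<lambda>n. cf_scale c (a n))"

definition l1_mult ::
  "('a \<Rightarrow> 'a) \<Rightarrow> (int \<Rightarrow> ('a::topological_space \<Rightarrow>\<^sub>C complex)) \<Rightarrow> (int \<Rightarrow> ('a \<Rightarrow>\<^sub>C complex)) \<Rightarrow>
    int \<Rightarrow> ('a \<Rightarrow>\<^sub>C complex)" where
  "l1_mult \<sigma> a b = (\<lambda>n. \<Sum>\<^sub>\<infinity>k. cf_mult (a k) (int_iter (alpha \<sigma>) k (b (n - k))))"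

definition l1_star ::
  "('a \<Rightarrow> 'a) \<Rightarrow> (int \<Rightarrow> ('a::topological_space \<Rightarrow>\<^sub>C complex)) \<Rightarrow> int \<Rightarrow> ('a \<Rightarrow>\<^sub>C complex)" where
  "l1_star \<sigma> a = (\<lambda>n. cf_cnj (int_iter (alpha \<sigma>) n (a (- n))))"

definition l1_delta :: "int \<Rightarrow> ('a::topological_space \<Rightarrow>\<^sub>C complex)" where
  "l1_delta = (\<lambda>n. if n = 1 then const_bcontfun 1 else 0)"

definition l1_embed :: "('a::topological_space \<Rightarrow>\<^sub>C complex) \<Rightarrow> int \<Rightarrow> ('a \<Rightarrow>\<^sub>C complex)" where
  "l1_embed f = (\<lambda>n. if n = 0 then f else 0)"

definition l1_ideal ::
  "('a \<Rightarrow> 'a) \<Rightarrow> (int \<Rightarrow> ('a::topological_space \<Rightarrow>\<^sub>C complex)) set \<Rightarrow> bool" where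
  "l1_ideal \<sigma> I \<longleftrightarrow> I \<subseteq> l1 \<and> l1_zero \<in> I \<and>
     (\<forall>a\<in>I. \<forall>b\<in>I. l1_add a b \<in> I) \<and>
     (\<forall>c. \<forall>a\<in>I. l1_scale c a \<in> I) \<and>
     (\<forall>a\<in>l1. \<forall>b\<in>I. l1_mult \<sigma> a b \<in> I \<and> l1_mult \<sigma> b a \<in> I)"

definition l1_closed :: "(int \<Rightarrow> ('a::topological_space \<Rightarrow>\<^sub>C complex)) set \<Rightarrow> bool" where
  "l1_closed I \<longleftrightarrow> closedin (Metric_space.mtopology l1 l1_dist) I"

definition l1_self_adjoint ::
  "('a \<Rightarrow> 'a) \<Rightarrow> (int \<Rightarrow> ('a::topological_space \<Rightarrow>\<^sub>C complex)) set \<Rightarrow> bool" where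
  "l1_self_adjoint \<sigma> I \<longleftrightarrow> (\<forall>a\<in>I. l1_star \<sigma> a \<in> I)"

section \<open>The transform, zero sets, and ideals of vanishing\<close>

definition transform ::
  "(int \<Rightarrow> ('a::topological_space \<Rightarrow>\<^sub>C complex)) \<Rightarrow> 'a \<times> complex \<Rightarrow> complex" where
  "transform a = (\<lambda>(x, \<mu>). \<Sum>\<^sub>\<infinity>n. \<mu> powi n * apply_bcontfun (a n) x)"

abbreviation unit_circle :: "complex set" where
  "unit_circle \<equiv> sphere 0 1"

definition zero_set ::
  "(int \<Rightarrow> ('a::topological_space \<Rightarrow>\<^sub>C complex)) set \<Rightarrow> ('a \<times> complex) set" where
  "zero_set L = {z \<in> UNIV \<times> unit_circle. \<forall>a\<in>L. transform a z = 0}"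

definition vanishing_ideal ::
  "('a \<Rightarrow> 'a) \<Rightarrow> ('a \<times> complex) set \<Rightarrow> (int \<Rightarrow> ('a::topological_space \<Rightarrow>\<^sub>C complex)) set" where
  "vanishing_ideal \<sigma> S = {a \<in> l1. \<forall>f. \<forall>z\<in>S. transform (l1_mult \<sigma> a (l1_embed f)) z = 0}"

section \<open>Complex Hilbert spaces and involutive representations\<close>

record 'h inner_space =
  vecs :: "'h set"
  vzero :: 'h
  vadd :: "'h \<Rightarrow> 'h \<Rightarrow> 'h"
  vscale :: "complex \<Rightarrow> 'h \<Rightarrow> 'h"
  vinner :: "'h \<Rightarrow> 'h \<Rightarrow> complex"

definition vnorm :: "'h inner_space \<Rightarrow> 'h \<Rightarrow> real" where
  "vnorm H u = sqrt (Re (vinner H u u))"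

definition vdist :: "'h inner_space \<Rightarrow> 'h \<Rightarrow> 'h \<Rightarrow> real" where
  "vdist H u v = vnorm H (vadd H u (vscale H (-1) v))"

locale complex_hilbert_space =
  fixes H :: "'h inner_space"
  assumes zero_closed: "vzero H \<in> vecs H"
    and add_closed: "\<lbrakk>u \<in> vecs H; v \<in> vecs H\<rbrakk> \<Longrightarrow> vadd H u v \<in> vecs H"
    and scale_closed: "u \<in> vecs H \<Longrightarrow> vscale H c u \<in> vecs H"
    and add_assoc: "\<lbrakk>u \<in> vecs H; v \<in> vecs H; w \<in> vecs H\<rbrakk> \<Longrightarrow>
      vadd H (vadd H u v) w = vadd H u (vadd H v w)"
    and add_commute: "\<lbrakk>u \<in> vecs H; v \<in> vecs H\<rbrakk> \<Longrightarrow> vadd H u v = vadd H v u"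
    and add_zero: "u \<in> vecs H \<Longrightarrow> vadd H u (vzero H) = u"
    and add_inverse: "u \<in> vecs H \<Longrightarrow> \<exists>v\<in>vecs H. vadd H u v = vzero H"
    and scale_add_right: "\<lbrakk>u \<in> vecs H; v \<in> vecs H\<rbrakk> \<Longrightarrow>
      vscale H c (vadd H u v) = vadd H (vscale H c u) (vscale H c v)"
    and scale_add_left: "u \<in> vecs H \<Longrightarrow>
      vscale H (c + d) u = vadd H (vscale H c u) (vscale H d u)"
    and scale_scale: "u \<in> vecs H \<Longrightarrow> vscale H c (vscale H d u) = vscale H (c * d) u"
    and scale_one: "u \<in> vecs H \<Longrightarrow> vscale H 1 u = u"
    and inner_commute: "\<lbrakk>u \<in> vecs H; v \<in> vecs H\<rbrakk> \<Longrightarrow> vinner H v u = cnj (vinner H u v)"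
    and inner_add_left: "\<lbrakk>u \<in> vecs H; v \<in> vecs H; w \<in> vecs H\<rbrakk> \<Longrightarrow>
      vinner H (vadd H u v) w = vinner H u w + vinner H v w"
    and inner_scale_left: "\<lbrakk>u \<in> vecs H; v \<in> vecs H\<rbrakk> \<Longrightarrow>
      vinner H (vscale H c u) v = c * vinner H u v"
    and inner_nonneg: "u \<in> vecs H \<Longrightarrow> 0 \<le> Re (vinner H u u)"
    and inner_definite: "\<lbrakk>u \<in> vecs H; vinner H u u = 0\<rbrakk> \<Longrightarrow> u = vzero H"
    and complete: "Metric_space.mcomplete (vecs H) (vdist H)"

definition bounded_operator :: "'h inner_space \<Rightarrow> ('h \<Rightarrow> 'h) \<Rightarrow> bool" where
  "bounded_operator H T \<longleftrightarrow>
     (\<forall>u\<in>vecs H. T u \<in> vecs H) \<and>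
     (\<forall>u\<in>vecs H. \<forall>v\<in>vecs H. T (vadd H u v) = vadd H (T u) (T v)) \<and>
     (\<forall>c. \<forall>u\<in>vecs H. T (vscale H c u) = vscale H c (T u)) \<and>
     (\<exists>K. \<forall>u\<in>vecs H. vnorm H (T u) \<le> K * vnorm H u)"

text \<open>Operators are determined by their values on the carrier; representations need not be unital.\<close>

definition involutive_representation ::
  "('a \<Rightarrow> 'a) \<Rightarrow> 'h inner_space \<Rightarrow> ((int \<Rightarrow> ('a::topological_space \<Rightarrow>\<^sub>C complex)) \<Rightarrow> 'h \<Rightarrow> 'h) \<Rightarrow> bool"
  where
  "involutive_representation \<sigma> H \<rho> \<longleftrightarrow>
     complex_hilbert_space H \<and>
     (\<forall>a\<in>l1. bounded_operator H (\<rho> a)) \<and>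
     (\<forall>a\<in>l1. \<forall>b\<in>l1. \<forall>u\<in>vecs H. \<rho> (l1_add a b) u = vadd H (\<rho> a u) (\<rho> b u)) \<and>
     (\<forall>c. \<forall>a\<in>l1. \<forall>u\<in>vecs H. \<rho> (l1_scale c a) u = vscale H c (\<rho> a u)) \<and>
     (\<forall>a\<in>l1. \<forall>b\<in>l1. \<forall>u\<in>vecs H. \<rho> (l1_mult \<sigma> a b) u = \<rho> a (\<rho> b u)) \<and>
     (\<forall>a\<in>l1. \<forall>u\<in>vecs H. \<forall>v\<in>vecs H. vinner H (\<rho> (l1_star \<sigma> a) u) v = vinner H u (\<rho> a v))"

definition rep_kernel ::
  "'h inner_space \<Rightarrow> ((int \<Rightarrow> ('a::topological_space \<Rightarrow>\<^sub>C complex)) \<Rightarrow> 'h \<Rightarrow> 'h) \<Rightarrow>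
    (int \<Rightarrow> ('a \<Rightarrow>\<^sub>C complex)) set" where
  "rep_kernel H \<rho> = {a \<in> l1. \<forall>u\<in>vecs H. \<rho> a u = vzero H}"

text \<open>HOL cannot quantify over all types, so ``there is a Hilbert space'' has to range over carriers
  inside one type. The following type contains a copy of every Hilbert space with carrier in \<open>'h\<close>,
  for an arbitrary type \<open>'h\<close>. The second summand makes sure, whatever \<open>'h\<close> is, that the
  square-summable families indexed by subsets of \<open>'a \<times> complex \<times> int\<close> are available as well.\<close>

type_synonym ('a, 'h) hilbert_universe = "'h + ('a \<times> complex \<times> int \<Rightarrow> complex)"

section \<open>The representations associated with points\<close>

definition ell2 :: "'i set \<Rightarrow> ('i \<Rightarrow> complex) inner_space" where
  "ell2 J = \<lparr>vecs = {\<xi>. (\<forall>i. i \<notin> J \<longrightarrow> \<xi> i = 0) \<and> (\<lambda>i. (cmod (\<xi> i))\<^sup>2) summable_on J},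
     vzero = (\<lambda>i. 0),
     vadd = (\<lambda>\<xi> \<eta> i. \<xi> i + \<eta> i),
     vscale = (\<lambda>c \<xi> i. c * \<xi> i),
     vinner = (\<lambda>\<xi> \<eta>. \<Sum>\<^sub>\<infinity>i\<in>J. \<xi> i * cnj (\<eta> i))\<rparr>"

definition basis_vec :: "'i \<Rightarrow> 'i \<Rightarrow> complex" where
  "basis_vec k = (\<lambda>i. if i = k then 1 else 0)"

text \<open>\<open>shift\<close> is the image of \<open>\<delta>\<close> under \<open>\<pi>\<^sub>x\<close>, and \<open>aper_rep\<close> extends this and the diagonal action of
  the continuous functions to all of \<open>\<ell>\<^sup>1\<close> through \<open>a = (\<Sum>n. a\<^sub>n \<delta>\<^sup>n)\<close>, written in coordinates.\<close>

definition shift :: "(int \<Rightarrow> complex) \<Rightarrow> int \<Rightarrow> complex" where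
  "shift \<xi> = (\<lambda>k. \<xi> (k - 1))"

definition aper_rep ::
  "('a \<Rightarrow> 'a) \<Rightarrow> 'a \<Rightarrow> (int \<Rightarrow> ('a::topological_space \<Rightarrow>\<^sub>C complex)) \<Rightarrow> (int \<Rightarrow> complex) \<Rightarrow> int \<Rightarrow> complex"
  where "aper_rep \<sigma> x a \<xi> =
    (\<lambda>k. \<Sum>\<^sub>\<infinity>n. apply_bcontfun (a n) (int_iter \<sigma> k x) * int_iter shift n \<xi> k)"

definition aper_ideal :: "('a \<Rightarrow> 'a) \<Rightarrow> 'a \<Rightarrow> (int \<Rightarrow> ('a::topological_space \<Rightarrow>\<^sub>C complex)) set" where
  "aper_ideal \<sigma> x = rep_kernel (ell2 UNIV) (aper_rep \<sigma> x)"

text \<open>The Hilbert space is \<open>ell2 {..<p}\<close> here. Coordinates from \<open>p\<close> on are left alone so that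
  \<open>cyclic_shift p \<mu>\<close> is bijective on all sequences and its inverse can be used in \<open>int_iter\<close>.\<close>

definition cyclic_shift :: "nat \<Rightarrow> complex \<Rightarrow> (nat \<Rightarrow> complex) \<Rightarrow> nat \<Rightarrow> complex" where
  "cyclic_shift p \<mu> \<xi> =
    (\<lambda>k. if p \<le> k then \<xi> k else if k = 0 then \<mu> * \<xi> (p - 1) else \<xi> (k - 1))"

definition per_rep ::
  "('a \<Rightarrow> 'a) \<Rightarrow> 'a \<Rightarrow> complex \<Rightarrow> (int \<Rightarrow> ('a::topological_space \<Rightarrow>\<^sub>C complex)) \<Rightarrow>
    (nat \<Rightarrow> complex) \<Rightarrow> nat \<Rightarrow> complex" where
  "per_rep \<sigma> x \<mu> a \<xi> =
    (\<lambda>k. \<Sum>\<^sub>\<infinity>n. apply_bcontfun (a n) ((\<sigma> ^^ k) x) * int_iter (cyclic_shift (period \<sigma> x) \<mu>) n \<xi> k)"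

definition per_ideal ::
  "('a \<Rightarrow> 'a) \<Rightarrow> 'a \<Rightarrow> complex \<Rightarrow> (int \<Rightarrow> ('a::topological_space \<Rightarrow>\<^sub>C complex)) set" where
  "per_ideal \<sigma> x \<mu> = rep_kernel (ell2 {..<period \<sigma> x}) (per_rep \<sigma> x \<mu>)"

text \<open>The defining relations of the two families of representations.\<close>

lemma infsum_single:
  fixes f :: "int \<Rightarrow> complex"
  assumes "\<And>n. n \<noteq> m \<Longrightarrow> f n = 0"
  shows "(\<Sum>\<^sub>\<infinity>n. f n) = f m"
proof -
  have "(\<Sum>\<^sub>\<infinity>n. f n) = (\<Sum>\<^sub>\<infinity>n\<in>{m}. f n)"
    by (rule infsum_cong_neutral) (use assms in auto)
  then show ?thesis by simp
qed

lemma aper_rep_delta: "aper_rep \<sigma> x l1_delta (basis_vec k) = basis_vec (k + 1)"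
proof
  fix j
  show "aper_rep \<sigma> x l1_delta (basis_vec k) j = basis_vec (k + 1) j"
    unfolding aper_rep_def
    by (subst infsum_single[of 1])
       (auto simp: l1_delta_def int_iter_def shift_def basis_vec_def const_bcontfun.rep_eq)
qed

lemma aper_rep_embed:
  "aper_rep \<sigma> x (l1_embed f) (basis_vec k) =
    vscale (ell2 UNIV) (apply_bcontfun f (int_iter \<sigma> k x)) (basis_vec k)"
proof
  fix j
  show "aper_rep \<sigma> x (l1_embed f) (basis_vec k) j =
    vscale (ell2 UNIV) (apply_bcontfun f (int_iter \<sigma> k x)) (basis_vec k) j"
    unfolding aper_rep_def
    by (subst infsum_single[of 0])
       (auto simp: l1_embed_def int_iter_def basis_vec_def ell2_def)
qed

lemma per_rep_delta:
  assumes "k < period \<sigma> x"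
  shows "per_rep \<sigma> x \<mu> l1_delta (basis_vec k) =
    (if k = period \<sigma> x - 1 then vscale (ell2 {..<period \<sigma> x}) \<mu> (basis_vec 0)
     else basis_vec (k + 1))"
proof
  fix j
  show "per_rep \<sigma> x \<mu> l1_delta (basis_vec k) j =
    (if k = period \<sigma> x - 1 then vscale (ell2 {..<period \<sigma> x}) \<mu> (basis_vec 0)
     else basis_vec (k + 1)) j"
    unfolding per_rep_def using assms
    by (subst infsum_single[of 1])
       (auto simp: l1_delta_def int_iter_def cyclic_shift_def basis_vec_def ell2_def
         const_bcontfun.rep_eq)
qed

lemma per_rep_embed:
  "per_rep \<sigma> x \<mu> (l1_embed f) (basis_vec k) =
    vscale (ell2 {..<period \<sigma> x}) (apply_bcontfun f ((\<sigma> ^^ k) x)) (basis_vec k)"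
proof
  fix j
  show "per_rep \<sigma> x \<mu> (l1_embed f) (basis_vec k) j =
    vscale (ell2 {..<period \<sigma> x}) (apply_bcontfun f ((\<sigma> ^^ k) x)) (basis_vec k) j"
    unfolding per_rep_def
    by (subst infsum_single[of 0])
       (auto simp: l1_embed_def int_iter_def basis_vec_def ell2_def)
qed

end

theory Submission
  imports Defs
begin

text \<open>
  For an aperiodic point the condition \<open>\<FF>(a f)(x, \<mu>) = 0\<close> for all \<open>f\<close> says that all coefficients of \<open>a\<close>
  vanish at \<open>x\<close>; for a point of period \<open>p\<close> it says that the sums of \<open>\<mu>\<^sup>n a\<^sub>n(x)\<close> over the residue
  classes modulo \<open>p\<close> vanish, which depends on \<open>\<mu>\<^sup>p\<close> only. This identifies the ideals of
  vanishing with intersections of kernels of the point representations, and realises them as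
  kernels of one representation on the square-summable families over the (invariant) zero set.

  Conversely let \<open>\<rho>\<close> be a representation with kernel \<open>I\<close>, let \<open>F\<close> be the common zero set of the
  continuous functions in \<open>I\<close>, and let \<open>a\<close> vanish on the zero set of \<open>I\<close>. Compressing elements of
  \<open>I\<close> by functions with small support shows that they vanish at the aperiodic points of \<open>F\<close>, and that
  near a point of \<open>F\<close> whose fibre in the zero set is not the whole circle all points of \<open>F\<close> have
  bounded period. Outside such points the coefficients of \<open>a\<close> vanish on \<open>F\<close>. Around such a point \<open>x\<close>
  there are functions that are invariant on \<open>F\<close>, hence central modulo \<open>I\<close>, and near \<open>x\<close> the
  element \<open>a\<close> acts like a trigonometric polynomial in the unitary \<open>\<rho>(\<delta>)\<close>. By compactness of the circle
  its square is dominated by a small constant plus squares coming from elements of \<open>I\<close>, and Fejer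
  averages turn this into an operator inequality. A partition of unity by invariant functions then
  gives \<open>\<rho>(a) = 0\<close>.
\<close>

section \<open>Integer iterates\<close>

text \<open>No spectral theorem is invoked. The functional calculus of the operator of \<delta> is
  replaced by the positive definite sequences n |-> <\<rho>(\<delta>^n) u, u>, to which inequalities
  between trigonometric polynomials are transferred by averages over roots of unity. Three features
  shape the argument. The definition of a representation bounds each operator, but not in terms of
  \<open>l1_norm\<close>; contractivity is derived from square roots in the algebra. Return times
  are controlled only at points of \<open>F\<close>, so invariance of a function can be asked for
  only on \<open>F\<close>; this is enough because the operator of a function depends only on its
  values there. Finally, the local estimates bound the action of \<open>a\<close> by
  \<open>e\<close> times the norm of \<open>\<rho> (fn f) w\<close>, not of \<open>w\<close>: the
  squares of the former add up to at most the squared norm of \<open>w\<close>, however many pieces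
  the partition of unity has, and that number depends on \<open>e\<close>.\<close>

lemma int_iter_0 [simp]: "int_iter f 0 x = x"
  by (simp add: int_iter_def)

lemma int_iter_succ:
  assumes "bij f"
  shows "int_iter f (n + 1) x = f (int_iter f n x)"
proof (cases "0 \<le> n")
  case True
  then show ?thesis by (simp add: int_iter_def nat_add_distrib)
next
  case False
  then obtain k where k: "n = - int (Suc k)"
    by (cases n rule: int_cases) auto
  have "n + 1 = - int k" using k by simp
  moreover have "int_iter f (- int k) x = (inv f ^^ k) x" by (simp add: int_iter_def)
  moreover have "int_iter f n x = inv f ((inv f ^^ k) x)"
    using k by (simp add: int_iter_def nat_add_distrib)
  ultimately show ?thesis
    by (simp add: surj_f_inv_f[OF bij_is_surj[OF assms]])
qed

lemma int_iter_add:
  assumes "bij f"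
  shows "int_iter f (m + n) x = int_iter f m (int_iter f n x)"
proof (induction m rule: int_induct[where k = 0])
  case base
  then show ?case by simp
next
  case (step1 i)
  then show ?case
    using int_iter_succ[OF assms, of "i + n" x] int_iter_succ[OF assms, of i]
    by (simp add: algebra_simps)
next
  case (step2 i)
  have "f (int_iter f (i - 1 + n) x) = f (int_iter f (i - 1) (int_iter f n x))"
    using int_iter_succ[OF assms, of "i - 1 + n" x] step2
      int_iter_succ[OF assms, of "i - 1" "int_iter f n x"]
    by (simp add: algebra_simps)
  then show ?case using bij_is_inj[OF assms] by (simp add: inj_eq)
qed

section \<open>Continuous functions\<close>

text \<open>The library has this instance for metric domains only.\<close>

instance bcontfun :: (topological_space, complete_space) complete_space
proof
  fix f :: "nat \<Rightarrow> ('a \<Rightarrow>\<^sub>C 'b)"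
  assume "Cauchy f"
  then have "\<forall>e>0. \<exists>N. \<forall>m n x. N \<le> m \<and> N \<le> n \<and> True \<longrightarrow> dist (f m x) (f n x) < e"
    unfolding Cauchy_def by (meson dist_fun_lt_imp_dist_val_lt)
  then obtain g where "\<forall>e>0. \<exists>N. \<forall>n x. N \<le> n \<and> True \<longrightarrow> dist (f n x) (g x) < e"
    using uniformly_convergent_eq_cauchy[of "\<lambda>_. True" "\<lambda>n. apply_bcontfun (f n)"] by blast
  then have "uniform_limit UNIV f g sequentially"
    unfolding uniform_limit_sequentially_iff by blast
  then show "convergent f"
    using uniform_limit_bcontfunE sequentially_bot convergentI by metis
qed

text \<open>In a Banach space absolutely summable families are summable; this is why the convolution
  sums of \<open>l1_mult\<close> converge.\<close>

instance bcontfun :: (topological_space, banach) banach ..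

lemma apply_Bcontfun:
  fixes F :: "'a::topological_space \<Rightarrow> complex"
  assumes "compact (UNIV :: 'a set)" "continuous_on UNIV F"
  shows "apply_bcontfun (Bcontfun F) = F"
proof -
  have "compact (range F)" by (rule compact_continuous_image) (use assms in auto)
  then have "F \<in> bcontfun" using assms by (simp add: bcontfun_def compact_imp_bounded)
  then show ?thesis by (simp add: Bcontfun_inverse)
qed

lemma apply_const [simp]: "apply_bcontfun (const_bcontfun c) x = c"
  by (simp add: const_bcontfun.rep_eq)

lemma apply_scale: "apply_bcontfun (cf_scale c f) x = c * apply_bcontfun f x"
  by (simp add: cf_scale_def apply_cf_mult)

lemma norm_cf_mult: "norm (cf_mult f g) \<le> norm f * norm g"
  by (rule norm_bound) (auto simp: apply_cf_mult norm_mult intro!: mult_mono norm_bounded)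

lemma norm_cf_cnj [simp]: "norm (cf_cnj f) = norm f"
proof -
  have le: "norm (cf_cnj g) \<le> norm g" for g :: "'a \<Rightarrow>\<^sub>C complex"
    by (rule norm_bound) (auto simp: apply_cf_cnj intro: norm_bounded)
  have "cf_cnj (cf_cnj f) = f" by (rule bcontfun_eqI) (simp add: apply_cf_cnj)
  with le[of f] le[of "cf_cnj f"] show ?thesis by simp
qed

lemma norm_const_le: "norm (const_bcontfun c :: 'a::topological_space \<Rightarrow>\<^sub>C complex) \<le> norm c"
  by (rule norm_bound) simp

lemma norm_cf_scale: "norm (cf_scale c f) \<le> norm c * norm f"
  unfolding cf_scale_def
  by (rule order_trans[OF norm_cf_mult]) (simp add: mult_right_mono norm_const_le)

lemma bounded_linear_apply: "bounded_linear (\<lambda>f. apply_bcontfun f x :: complex)"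
  by (rule bounded_linear_intro[where K = 1]) (auto simp: norm_bounded)

text \<open>Evaluation at a point is a bounded functional and so passes through infinite sums.
  Identities in the algebra can then be checked pointwise with complex numbers.\<close>

lemma apply_infsum:
  fixes h :: "'i \<Rightarrow> ('a::topological_space \<Rightarrow>\<^sub>C complex)"
  assumes "h summable_on A"
  shows "apply_bcontfun (infsum h A) x = (\<Sum>\<^sub>\<infinity>i\<in>A. apply_bcontfun (h i) x)"
  using has_sum_bounded_linear[OF bounded_linear_apply has_sum_infsum[OF assms], of x]
  by (simp add: infsumI)

lemma urysohn_closed:
  fixes A B :: "'a::t2_space set"
  assumes "compact (UNIV :: 'a set)" "closed A" "closed B" "A \<inter> B = {}"
  obtains F :: "'a \<Rightarrow> real" where "continuous_on UNIV F" "\<And>x. 0 \<le> F x" "\<And>x. F x \<le> 1"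
    "\<And>x. x \<in> A \<Longrightarrow> F x = 1" "\<And>x. x \<in> B \<Longrightarrow> F x = 0"
proof -
  have "Hausdorff_space (euclidean :: 'a topology)"
    unfolding Hausdorff_space_def disjnt_def using hausdorff by fastforce
  then have "normal_space (euclidean :: 'a topology)"
    using assms by (intro compact_Hausdorff_or_regular_imp_normal_space) (auto simp: compact_space_def)
  then obtain F :: "'a \<Rightarrow> real"
    where F: "continuous_map euclidean (top_of_set {0..1}) F" "F ` B \<subseteq> {0}" "F ` A \<subseteq> {1}"
    by (rule Urysohn_lemma[where S = B and T = A and a = 0 and b = 1]) 
       (use assms in \<open>auto simp: disjnt_def\<close>)
  then show ?thesis
    by (intro that[of F]) (auto simp: continuous_map_in_subtopology)
qed

text \<open>The real function is returned next to its complex version: order estimates concern the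
  former, elements of the algebra are built from the latter.\<close>

lemma urysohn_point:
  fixes x :: "'a::t2_space"
  assumes "compact (UNIV :: 'a set)" "open V" "x \<in> V"
  obtains f :: "'a \<Rightarrow>\<^sub>C complex" and F :: "'a \<Rightarrow> real"
  where "\<And>y. apply_bcontfun f y = of_real (F y)" "\<And>y. 0 \<le> F y" "\<And>y. F y \<le> 1"
    "F x = 1" "\<And>y. y \<notin> V \<Longrightarrow> F y = 0"
proof -
  obtain F :: "'a \<Rightarrow> real" where F: "continuous_on UNIV F" "\<And>x. 0 \<le> F x" "\<And>x. F x \<le> 1"
    "\<And>y. y \<in> {x} \<Longrightarrow> F y = 1" "\<And>x. x \<in> - V \<Longrightarrow> F x = 0"
    by (rule urysohn_closed[OF assms(1), of "{x}" "- V"]) (use assms in auto)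
  have "apply_bcontfun (Bcontfun (\<lambda>y. of_real (F y))) = (\<lambda>y. complex_of_real (F y))"
    by (rule apply_Bcontfun) (use assms F in \<open>auto intro!: continuous_intros\<close>)
  with F show ?thesis
    by (intro that[of "Bcontfun (\<lambda>y. of_real (F y))" F]) auto
qed

section \<open>The algebra\<close>

definition l1_norm :: "(int \<Rightarrow> ('a::topological_space \<Rightarrow>\<^sub>C complex)) \<Rightarrow> real" where
  "l1_norm a = (\<Sum>\<^sub>\<infinity>n. norm (a n))"

text \<open>This is the monomial f \<delta>^m of the expansion of an element into the sum of a_n
  \<delta>^n.\<close>

definition l1_mono :: "('a::topological_space \<Rightarrow>\<^sub>C complex) \<Rightarrow> int \<Rightarrow> int \<Rightarrow> ('a \<Rightarrow>\<^sub>C complex)" where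
  "l1_mono f m = (\<lambda>n. if n = m then f else 0)"

definition l1_sub ::
  "(int \<Rightarrow> ('a::topological_space \<Rightarrow>\<^sub>C complex)) \<Rightarrow> (int \<Rightarrow> ('a \<Rightarrow>\<^sub>C complex)) \<Rightarrow> int \<Rightarrow> ('a \<Rightarrow>\<^sub>C complex)"
  where "l1_sub a b = (\<lambda>n. a n - b n)"

definition l1_cut ::
  "int set \<Rightarrow> (int \<Rightarrow> ('a::topological_space \<Rightarrow>\<^sub>C complex)) \<Rightarrow> int \<Rightarrow> ('a \<Rightarrow>\<^sub>C complex)" where
  "l1_cut A a = (\<lambda>n. if n \<in> A then a n else 0)"

abbreviation l1_one :: "int \<Rightarrow> ('a::topological_space \<Rightarrow>\<^sub>C complex)" where
  "l1_one \<equiv> l1_mono (const_bcontfun 1) 0"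

lemma l1_embed_eq: "l1_embed f = l1_mono f 0"
  by (simp add: l1_embed_def l1_mono_def)

lemma l1_iff: "a \<in> l1 \<longleftrightarrow> (\<lambda>n. norm (a n)) summable_on UNIV"
  by (simp add: l1_def)

lemma l1_norm_nonneg [simp]: "0 \<le> l1_norm a"
  by (simp add: l1_norm_def infsum_nonneg)

lemma l1_dominated:
  assumes "g summable_on UNIV" "\<And>n. norm (a n) \<le> g n"
  shows "a \<in> l1" "l1_norm a \<le> infsum g UNIV"
proof -
  show "a \<in> l1" unfolding l1_iff
    by (rule summable_on_comparison_test[OF assms(1)]) (use assms in auto)
  then show "l1_norm a \<le> infsum g UNIV"
    unfolding l1_norm_def l1_iff by (intro infsum_mono assms)
qed

lemma l1_mono_in [simp]: "l1_mono f m \<in> l1"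
  unfolding l1_iff
  by (rule finite_nonzero_values_imp_summable_on)
     (rule finite_subset[of _ "{m}"], auto simp: l1_mono_def)

lemma infsum_single_gen:
  fixes f :: "'i \<Rightarrow> 'b::{topological_comm_monoid_add, t2_space}"
  assumes "\<And>n. n \<noteq> m \<Longrightarrow> f n = 0"
  shows "(\<Sum>\<^sub>\<infinity>n. f n) = f m"
proof -
  have "(\<Sum>\<^sub>\<infinity>n. f n) = (\<Sum>\<^sub>\<infinity>n\<in>{m}. f n)"
    by (rule infsum_cong_neutral) (use assms in auto)
  then show ?thesis by simp
qed

lemma l1_norm_mono [simp]: "l1_norm (l1_mono f m) = norm f"
  unfolding l1_norm_def by (subst infsum_single_gen[of m]) (auto simp: l1_mono_def)

lemma l1_zero_in [simp]: "l1_zero \<in> l1"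
  by (simp add: l1_iff l1_zero_def)

lemma l1_add_in [simp]: "\<lbrakk>a \<in> l1; b \<in> l1\<rbrakk> \<Longrightarrow> l1_add a b \<in> l1"
  unfolding l1_iff l1_add_def
  by (rule summable_on_comparison_test[OF summable_on_add, of "\<lambda>n. norm (a n)" _ "\<lambda>n. norm (b n)"])
     (auto intro: norm_triangle_ineq)

lemma l1_norm_add: "\<lbrakk>a \<in> l1; b \<in> l1\<rbrakk> \<Longrightarrow> l1_norm (l1_add a b) \<le> l1_norm a + l1_norm b"
  using l1_add_in[of a b] unfolding l1_iff l1_norm_def l1_add_def
  by (subst infsum_add[symmetric]) (auto intro!: infsum_mono summable_on_add norm_triangle_ineq)

lemma l1_scale_in [simp]: "a \<in> l1 \<Longrightarrow> l1_scale c a \<in> l1"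
  unfolding l1_iff l1_scale_def
  by (rule summable_on_comparison_test[OF summable_on_cmult_right[of "\<lambda>n. norm (a n)" _ "norm c"]])
     (auto intro: norm_cf_scale)

lemma l1_norm_scale: 
  assumes "a \<in> l1"
  shows "l1_norm (l1_scale c a) \<le> norm c * l1_norm a"
proof -
  have "l1_norm (l1_scale c a) \<le> infsum (\<lambda>n. norm c * norm (a n)) UNIV"
    using assms unfolding l1_iff
    by (intro l1_dominated(2) summable_on_cmult_right) (auto simp: l1_scale_def norm_cf_scale)
  then show ?thesis unfolding l1_norm_def by (simp add: infsum_cmult_right')
qed

lemma l1_sub_eq: "l1_sub a b = l1_add a (l1_scale (-1) b)"
  unfolding l1_sub_def l1_add_def l1_scale_def
  by (intro ext bcontfun_eqI) (simp add: apply_scale)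

lemma l1_sub_in [simp]: "\<lbrakk>a \<in> l1; b \<in> l1\<rbrakk> \<Longrightarrow> l1_sub a b \<in> l1"
  by (simp add: l1_sub_eq)

lemma l1_dist_eq: "l1_dist a b = l1_norm (l1_sub a b)"
  by (simp add: l1_dist_def l1_norm_def l1_sub_def)

lemma l1_cut_in [simp]: "a \<in> l1 \<Longrightarrow> l1_cut A a \<in> l1"
  unfolding l1_iff l1_cut_def
  by (rule summable_on_comparison_test) auto

lemma l1_norm_cut:
  assumes "a \<in> l1"
  shows "l1_norm (l1_cut A a) = (\<Sum>\<^sub>\<infinity>n\<in>A. norm (a n))"
  unfolding l1_norm_def l1_cut_def by (rule infsum_cong_neutral) auto

lemma l1_norm_ge: "a \<in> l1 \<Longrightarrow> norm (a n) \<le> l1_norm a"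
  unfolding l1_norm_def l1_iff
  using finite_sum_le_infsum[of "\<lambda>n. norm (a n)" UNIV "{n}"] by auto

lemma l1_tail_small:
  assumes "a \<in> l1" "0 < e"
  obtains N where "\<And>M. N \<le> M \<Longrightarrow> l1_norm (l1_cut (- {- int M..int M}) a) < e"
proof -
  obtain A where A: "finite A" "dist (\<Sum>n\<in>A. norm (a n)) (l1_norm a) < e"
    using infsum_finite_approximation[of "\<lambda>n. norm (a n)" UNIV "e/2"] assms
    unfolding l1_norm_def l1_iff by force
  \<comment> \<open>Enlarges the finite set \<open>A\<close> to a symmetric window; 0 is inserted in
    case \<open>A\<close> is empty.\<close>
  define N where "N = nat (Max (insert 0 (abs ` A)))"
  have N: "A \<subseteq> {- int M..int M}" if "N \<le> M" for M
  proof
    fix n assume "n \<in> A"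
    then have "\<bar>n\<bar> \<le> Max (insert 0 (abs ` A))" using A(1) by (intro Max_ge) auto
    then have "\<bar>n\<bar> \<le> int M" using that unfolding N_def by linarith
    then show "n \<in> {- int M..int M}" by auto
  qed
  have "l1_norm (l1_cut (- {- int M..int M}) a) < e" if "N \<le> M" for M
  proof -
    let ?B = "{- int M..int M}"
    have s: "(\<lambda>n. norm (a n)) summable_on B" for B
      using assms(1) unfolding l1_iff by (rule summable_on_subset_banach) auto
    have "l1_norm a = (\<Sum>\<^sub>\<infinity>n\<in>?B \<union> - ?B. norm (a n))" by (simp add: l1_norm_def)
    also have "\<dots> = (\<Sum>\<^sub>\<infinity>n\<in>?B. norm (a n)) + (\<Sum>\<^sub>\<infinity>n\<in>-?B. norm (a n))"
      by (rule infsum_Un_disjoint[OF s s]) auto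
    also have "(\<Sum>\<^sub>\<infinity>n\<in>?B. norm (a n)) = (\<Sum>n\<in>?B. norm (a n))" by simp
    finally have "l1_norm (l1_cut (- ?B) a) = l1_norm a - (\<Sum>n\<in>?B. norm (a n))"
      by (simp add: l1_norm_cut[OF assms(1)])
    moreover have "(\<Sum>n\<in>A. norm (a n)) \<le> (\<Sum>n\<in>?B. norm (a n))"
      by (rule sum_mono2) (use N[OF that] in auto)
    ultimately show ?thesis using A(2) by (simp add: dist_real_def)
  qed
  then show ?thesis by (rule that)
qed

section \<open>The system and its convolution product\<close>

locale dynamics =
  fixes \<sigma> :: "'a::t2_space \<Rightarrow> 'a"
  assumes compact_X: "compact (UNIV :: 'a set)"
    and homeo: "homeomorphism UNIV UNIV \<sigma> (inv \<sigma>)"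
begin

abbreviation it :: "int \<Rightarrow> 'a \<Rightarrow> 'a" where "it \<equiv> int_iter \<sigma>"
abbreviation al :: "int \<Rightarrow> ('a \<Rightarrow>\<^sub>C complex) \<Rightarrow> ('a \<Rightarrow>\<^sub>C complex)" where "al \<equiv> int_iter (alpha \<sigma>)"
abbreviation mul where "mul \<equiv> l1_mult \<sigma>"
abbreviation star where "star \<equiv> l1_star \<sigma>"

lemma bij_sigma: "bij \<sigma>"
  using homeo unfolding homeomorphism_def by (metis UNIV_I bij_betw_def inj_on_inverseI)

lemma it_it [simp]: "it m (it n x) = it (m + n) x"
  by (simp add: int_iter_add[OF bij_sigma])

lemma it_eq_iff: "it m x = it n x \<longleftrightarrow> it (m - n) x = x"
  by (metis add.commute diff_add_cancel int_iter_0 it_it right_minus_eq uminus_add_conv_diff)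

lemma it_inj: "it m x = it m y \<longleftrightarrow> x = y"
  by (metis add.left_inverse int_iter_0 it_it)

lemma continuous_it: "continuous_on A (it n)"
proof -
  have s: "continuous_on UNIV \<sigma>" "continuous_on UNIV (inv \<sigma>)"
    using homeo by (auto simp: homeomorphism_def)
  have "continuous_on UNIV (\<sigma> ^^ k)" for k
  proof (induction k)
    case (Suc k)
    then show ?case using continuous_on_compose2[OF s(1)] by (auto simp: o_def)
  qed (simp add: id_def)
  moreover have "continuous_on UNIV (inv \<sigma> ^^ k)" for k
  proof (induction k)
    case (Suc k)
    then show ?case using continuous_on_compose2[OF s(2)] by (auto simp: o_def)
  qed (simp add: id_def)
  ultimately have "continuous_on UNIV (it n)" by (simp add: int_iter_def)
  then show ?thesis by (rule continuous_on_subset) simp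
qed

lemma apply_al [simp]: "apply_bcontfun (al k f) x = apply_bcontfun f (it (- k) x)"
  by (rule apply_int_iter_alpha[OF homeo])

lemma norm_al [simp]: "norm (al k f) = norm f"
proof -
  have le: "norm (al k f) \<le> norm f" for f k
    by (rule norm_bound) (simp add: norm_bounded)
  have "al (- k) (al k f) = f" by (rule bcontfun_eqI) simp
  with le[of k f] le[of "- k" "al k f"] show ?thesis by simp
qed

lemma mult_summable:
  assumes "a \<in> l1" "b \<in> l1"
  shows "(\<lambda>k. norm (cf_mult (a k) (al k (b (n - k))))) summable_on UNIV"
    "(\<lambda>k. norm (a k) * norm (b (n - k))) summable_on UNIV"
proof -
  show s: "(\<lambda>k. norm (a k) * norm (b (n - k))) summable_on UNIV"
  proof (rule summable_on_comparison_test)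
    show "(\<lambda>k. norm (a k) * l1_norm b) summable_on UNIV"
      using assms(1) by (simp add: l1_iff summable_on_cmult_left)
  qed (auto intro: mult_left_mono l1_norm_ge[OF assms(2)])
  show "(\<lambda>k. norm (cf_mult (a k) (al k (b (n - k))))) summable_on UNIV"
    by (rule summable_on_comparison_test[OF s]) (auto intro: order_trans[OF norm_cf_mult])
qed

lemma mult_summable':
  assumes "a \<in> l1" "b \<in> l1"
  shows "(\<lambda>k. cf_mult (a k) (al k (b (n - k)))) summable_on UNIV"
  by (rule abs_summable_summable[OF mult_summable(1)[OF assms]])

lemma apply_mul:
  assumes "a \<in> l1" "b \<in> l1"
  shows "apply_bcontfun (mul a b n) x =
    (\<Sum>\<^sub>\<infinity>k. apply_bcontfun (a k) x * apply_bcontfun (b (n - k)) (it (- k) x))"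
  unfolding l1_mult_def
  by (subst apply_infsum)
     (auto simp: apply_cf_mult intro!: mult_summable' mult_summable(2) assms)

text \<open>The family \<open>norm (a k) * norm (b m)\<close> sums to the product of the norms; the
  shear (k, m) |-> (k + m, k) re-indexes it by total degree and first factor.\<close>

lemma convolution_summable:
  assumes "a \<in> l1" "b \<in> l1"
  shows "((\<lambda>(n, k). norm (a k) * norm (b (n - k))) has_sum (l1_norm a * l1_norm b)) UNIV"
proof -
  have "(\<lambda>(k, m). norm (a k) * norm (b m)) summable_on UNIV \<times> UNIV"
    using assms unfolding l1_iff
    by (intro summable_on_SigmaI[where g = "\<lambda>k. norm (a k) * l1_norm b"])
       (auto simp: l1_norm_def intro!: has_sum_cmult_right summable_on_cmult_left)
  then have "((\<lambda>(k, m). norm (a k) * norm (b m)) has_sum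
      (\<Sum>\<^sub>\<infinity>k. \<Sum>\<^sub>\<infinity>m. norm (a k) * norm (b m))) (UNIV \<times> UNIV)"
    by (subst infsum_Sigma'_banach) (auto simp: case_prod_unfold)
  also have "(\<Sum>\<^sub>\<infinity>k. \<Sum>\<^sub>\<infinity>m. norm (a k) * norm (b m)) = l1_norm a * l1_norm b"
    by (simp add: infsum_cmult_right' infsum_cmult_left' l1_norm_def)
  finally show ?thesis
    by (subst has_sum_reindex_bij_witness[of UNIV "\<lambda>(k, m). (k + m, k)" "\<lambda>(n, k). (k, n - k)"
          UNIV "\<lambda>(k, m). norm (a k) * norm (b m)"]) auto
qed

lemma mul_in_norm:
  assumes "a \<in> l1" "b \<in> l1"
  shows "mul a b \<in> l1 \<and> l1_norm (mul a b) \<le> l1_norm a * l1_norm b"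
proof -
  let ?g = "\<lambda>n. \<Sum>\<^sub>\<infinity>k. norm (a k) * norm (b (n - k))"
  have "(?g has_sum (l1_norm a * l1_norm b)) UNIV"
    using has_sum_infsum[OF mult_summable(2)[OF assms]]
      has_sum_SigmaD[where f = "\<lambda>(n, k). norm (a k) * norm (b (n - k))" and A = UNIV
        and B = "\<lambda>_. UNIV" and g = ?g]
      convolution_summable[OF assms] by auto
  then have g: "?g summable_on UNIV" "infsum ?g UNIV = l1_norm a * l1_norm b"
    by (auto simp: has_sum_iff)
  have "norm (mul a b n) \<le> ?g n" for n
    unfolding l1_mult_def
    by (rule norm_infsum_le[OF has_sum_infsum has_sum_infsum])
       (auto intro!: mult_summable' mult_summable(2) assms order_trans[OF norm_cf_mult])
  then show ?thesis using l1_dominated[OF g(1), of "mul a b"] g(2) by simp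
qed

lemma mul_in [simp]: "\<lbrakk>a \<in> l1; b \<in> l1\<rbrakk> \<Longrightarrow> mul a b \<in> l1"
  and l1_norm_mul: "\<lbrakk>a \<in> l1; b \<in> l1\<rbrakk> \<Longrightarrow> l1_norm (mul a b) \<le> l1_norm a * l1_norm b"
  using mul_in_norm by blast+

lemma mul_mono_left: "mul (l1_mono f m) c = (\<lambda>n. cf_mult f (al m (c (n - m))))"
proof
  fix n
  have z: "cf_mult 0 g = 0" for g :: "'a \<Rightarrow>\<^sub>C complex"
    by (rule bcontfun_eqI) (simp add: apply_cf_mult)
  show "mul (l1_mono f m) c n = cf_mult f (al m (c (n - m)))"
    unfolding l1_mult_def by (subst infsum_single_gen[of m]) (auto simp: l1_mono_def z)
qed

lemma mul_mono_right: "mul c (l1_mono f m) = (\<lambda>n. cf_mult (c (n - m)) (al (n - m) f))"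
proof
  fix n
  have z: "cf_mult g (al k 0) = 0" for g k
    by (rule bcontfun_eqI) (simp add: apply_cf_mult)
  show "mul c (l1_mono f m) n = cf_mult (c (n - m)) (al (n - m) f)"
    unfolding l1_mult_def by (subst infsum_single_gen[of "n - m"]) (auto simp: l1_mono_def z)
qed

lemma mul_mono_mono: "mul (l1_mono f m) (l1_mono g n) = l1_mono (cf_mult f (al m g)) (m + n)"
  unfolding mul_mono_left
  by (intro ext bcontfun_eqI) (auto simp: l1_mono_def apply_cf_mult)

lemma mul_one_left: "mul l1_one a = a"
  unfolding mul_mono_left by (intro ext bcontfun_eqI) (simp add: apply_cf_mult)

lemma mul_one_right: "mul a l1_one = a"
  unfolding mul_mono_right by (intro ext bcontfun_eqI) (simp add: apply_cf_mult)

lemma mul_add_left: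
  assumes "a \<in> l1" "b \<in> l1" "c \<in> l1"
  shows "mul (l1_add a b) c = l1_add (mul a c) (mul b c)"
proof -
  have "mul (l1_add a b) c n = l1_add (mul a c) (mul b c) n" for n
    unfolding l1_add_def[of "mul a c"] unfolding l1_mult_def
    using mult_summable' assms
    by (subst infsum_add[symmetric], simp_all)
       (rule infsum_cong, rule bcontfun_eqI, simp add: apply_cf_mult l1_add_def algebra_simps)
  then show ?thesis by blast
qed

lemma mul_add_right:
  assumes "a \<in> l1" "b \<in> l1" "c \<in> l1"
  shows "mul c (l1_add a b) = l1_add (mul c a) (mul c b)"
proof -
  have "mul c (l1_add a b) n = l1_add (mul c a) (mul c b) n" for n
    unfolding l1_add_def[of "mul c a"] unfolding l1_mult_def
    using mult_summable' assms
    by (subst infsum_add[symmetric], simp_all)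
       (rule infsum_cong, rule bcontfun_eqI, simp add: apply_cf_mult l1_add_def algebra_simps)
  then show ?thesis by blast
qed

lemma mul_scale:
  assumes "a \<in> l1" "b \<in> l1"
  shows "mul (l1_scale c a) b = l1_scale c (mul a b)" "mul a (l1_scale c b) = l1_scale c (mul a b)"
proof -
  have "mul (l1_scale c a) b n = l1_scale c (mul a b) n" for n
    by (rule bcontfun_eqI)
       (simp add: l1_scale_def apply_mul[unfolded l1_scale_def] assms
         apply_mul[OF l1_scale_in[unfolded l1_scale_def]] apply_scale infsum_cmult_right'[symmetric] mult.assoc)
  then show "mul (l1_scale c a) b = l1_scale c (mul a b)" by blast
  have "mul a (l1_scale c b) n = l1_scale c (mul a b) n" for n
    by (rule bcontfun_eqI)
       (simp add: l1_scale_def apply_mul[unfolded l1_scale_def] assms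
         apply_mul[OF _ l1_scale_in[unfolded l1_scale_def]] apply_scale infsum_cmult_right'[symmetric] mult.left_commute)
  then show "mul a (l1_scale c b) = l1_scale c (mul a b)" by blast
qed

section \<open>The involution\<close>

lemma apply_star: "apply_bcontfun (star a n) x = cnj (apply_bcontfun (a (- n)) (it (- n) x))"
  by (simp add: l1_star_def apply_cf_cnj)

lemma bij_uminus: "bij (uminus :: int \<Rightarrow> int)"
  by (rule bij_betw_byWitness[where f' = uminus]) auto

lemma star_in [simp]: "a \<in> l1 \<Longrightarrow> star a \<in> l1"
  and l1_norm_star: "l1_norm (star a) = l1_norm a"
  using summable_on_reindex_bij_betw[OF bij_uminus, of "\<lambda>n. norm (a n)"]
    infsum_reindex_bij_betw[OF bij_uminus, of "\<lambda>n. norm (a n)"]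
  by (simp_all add: l1_iff l1_norm_def l1_star_def)

lemma star_star: "star (star a) = a"
  by (intro ext bcontfun_eqI) (simp add: apply_star)

lemma star_add: "star (l1_add a b) = l1_add (star a) (star b)"
  by (intro ext bcontfun_eqI) (simp add: apply_star l1_add_def)

lemma star_scale: "star (l1_scale c a) = l1_scale (cnj c) (star a)"
  by (intro ext bcontfun_eqI) (simp add: apply_star l1_scale_def apply_scale)

lemma star_mono: "star (l1_mono f m) = l1_mono (cf_cnj (al (- m) f)) (- m)"
  by (intro ext bcontfun_eqI) (auto simp: apply_star l1_mono_def apply_cf_cnj)

lemma star_mul:
  assumes "a \<in> l1" "b \<in> l1"
  shows "star (mul a b) = mul (star b) (star a)"
proof -
  have "apply_bcontfun (star (mul a b) n) x = apply_bcontfun (mul (star b) (star a) n) x" for n x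
  proof -
    have "apply_bcontfun (star (mul a b) n) x =
      (\<Sum>\<^sub>\<infinity>k. cnj (apply_bcontfun (a k) (it (- n) x) * apply_bcontfun (b (- n - k)) (it (- k - n) x)))"
      using assms by (simp add: apply_star apply_mul del: complex_cnj_mult)
    \<comment> \<open>The index is shifted by \<open>n\<close> so that \<open>b\<close> is read at
      -k, as it is in \<open>star b k\<close>.\<close>
    also have "\<dots> = (\<Sum>\<^sub>\<infinity>k. cnj (apply_bcontfun (a (k - n)) (it (- n) x) * apply_bcontfun (b (- k)) (it (- k) x)))"
      by (rule infsum_reindex_bij_witness[of _ "\<lambda>k. k - n" "\<lambda>k. k + n"])
         (auto simp: algebra_simps diff_diff_eq[symmetric] minus_diff_commute)
    also have "\<dots> = apply_bcontfun (mul (star b) (star a) n) x"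
      using assms by (simp add: apply_mul apply_star mult.commute algebra_simps)
    finally show ?thesis .
  qed
  then show ?thesis by (intro ext bcontfun_eqI) simp
qed

end

section \<open>Vanishing at a point\<close>

context dynamics
begin

lemma it_nat: "it (int k) x = (\<sigma> ^^ k) x"
  by (simp add: int_iter_def)

lemma Per_iff: "x \<in> Per \<sigma> \<longleftrightarrow> (\<exists>n. n \<noteq> 0 \<and> it n x = x)"
proof
  assume "x \<in> Per \<sigma>"
  then obtain n :: nat where "n > 0" "(\<sigma> ^^ n) x = x" by (auto simp: Per_def)
  then show "\<exists>n. n \<noteq> 0 \<and> it n x = x"
    by (intro exI[of _ "int n"]) (simp add: it_nat)
next
  assume "\<exists>n. n \<noteq> 0 \<and> it n x = x"
  then obtain n where n: "n \<noteq> 0" "it n x = x" by blast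
  have "it (- n) x = x"
    using it_eq_iff[of 0 x n] n by simp
  with n have "it (int (nat \<bar>n\<bar>)) x = x" by (cases "0 \<le> n") auto
  with n show "x \<in> Per \<sigma>" unfolding Per_def it_nat by (auto intro!: exI[of _ "nat \<bar>n\<bar>"])
qed

lemma Aper_iff: "x \<in> Aper \<sigma> \<longleftrightarrow> (\<forall>n. it n x = x \<longrightarrow> n = 0)"
  unfolding Aper_def using Per_iff by auto

text \<open>For the last claim, the remainder of a return time modulo the period is again a return
  time, below the period, hence 0 by minimality.\<close>

lemma period_props:
  assumes "x \<in> Per \<sigma>"
  shows "0 < period \<sigma> x" "it (int (period \<sigma> x)) x = x"
    and "it n x = x \<longleftrightarrow> int (period \<sigma> x) dvd n"
proof -
  let ?p = "period \<sigma> x"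
  have ex: "\<exists>n. 0 < n \<and> (\<sigma> ^^ n) x = x" using assms by (auto simp: Per_def)
  show p: "0 < ?p" "it (int ?p) x = x"
    using LeastI_ex[OF ex] unfolding period_def it_nat by auto
  have mult: "it (int ?p * k) x = x" for k
  proof (induction k rule: int_induct[where k = 0])
    case (step1 i)
    then show ?case using it_it[of "int ?p * i" "int ?p" x] p by (simp add: algebra_simps)
  next
    case (step2 i)
    then show ?case using it_it[of "int ?p * (i - 1)" "int ?p" x] p by (simp add: algebra_simps)
  qed simp
  show "it n x = x \<longleftrightarrow> int ?p dvd n"
  proof
    assume n: "it n x = x"
    have "it (n mod int ?p) x = it (n mod int ?p) (it (int ?p * (n div int ?p)) x)"
      by (simp add: mult)
    also have "\<dots> = x" by (simp add: n)
    finally have "(\<sigma> ^^ nat (n mod int ?p)) x = x" using p by (simp flip: it_nat)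
    moreover have "nat (n mod int ?p) < ?p" using p by (simp add: nat_less_iff)
    ultimately have "nat (n mod int ?p) = 0"
      using not_less_Least[of "nat (n mod int ?p)" "\<lambda>n. 0 < n \<and> (\<sigma> ^^ n) x = x"]
      unfolding period_def by simp
    moreover have "0 \<le> n mod int ?p" using p by simp
    ultimately show "int ?p dvd n" by (simp add: dvd_eq_mod_eq_0)
  next
    assume "int ?p dvd n"
    then show "it n x = x" using mult by auto
  qed
qed

lemma period_it:
  assumes "x \<in> Per \<sigma>"
  shows "it k x \<in> Per \<sigma>" "period \<sigma> (it k x) = period \<sigma> x"
proof -
  have iff: "it n (it k x) = it k x \<longleftrightarrow> it n x = x" for n
    using it_inj[of k "it n x" x] by (simp add: add.commute)
  show "it k x \<in> Per \<sigma>" using assms unfolding Per_iff iff .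
  show "period \<sigma> (it k x) = period \<sigma> x"
    unfolding period_def by (simp flip: it_nat add: iff del: it_it)
qed

text \<open>This is the matrix entry between \<open>y\<close> and \<open>x\<close> in the
  representation in which \<delta> moves along the orbit with phase \<mu>; compare
  \<open>orep\<close>. The fibre summed over is a residue class modulo the period on a periodic
  orbit and has at most one element on an aperiodic one.\<close>

definition entry :: "(int \<Rightarrow> ('a \<Rightarrow>\<^sub>C complex)) \<Rightarrow> 'a \<Rightarrow> complex \<Rightarrow> 'a \<Rightarrow> complex" where
  "entry a x \<mu> y = (\<Sum>\<^sub>\<infinity>n\<in>{n. it (- n) x = y}. \<mu> powi n * apply_bcontfun (a n) x)"

definition vanishes :: "(int \<Rightarrow> ('a \<Rightarrow>\<^sub>C complex)) \<Rightarrow> 'a \<Rightarrow> complex \<Rightarrow> bool" where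
  "vanishes a x \<mu> \<longleftrightarrow> (\<forall>y. entry a x \<mu> y = 0)"

lemma term_summable:
  assumes "a \<in> l1" "norm \<mu> = 1" "\<And>n. norm (c n) \<le> B"
  shows "(\<lambda>n. norm (\<mu> powi n * apply_bcontfun (a n) x * c n)) summable_on A"
    "(\<lambda>n. \<mu> powi n * apply_bcontfun (a n) x * c n) summable_on A"
proof -
  have "(\<lambda>n. norm (a n) * B) summable_on A"
    using assms(1) unfolding l1_iff
    by (intro summable_on_cmult_left) (erule summable_on_subset_banach, simp)
  then show s: "(\<lambda>n. norm (\<mu> powi n * apply_bcontfun (a n) x * c n)) summable_on A"
    by (rule summable_on_comparison_test)
       (auto simp: norm_mult norm_power_int assms(2) intro!: mult_mono norm_bounded assms(3))
  then show "(\<lambda>n. \<mu> powi n * apply_bcontfun (a n) x * c n) summable_on A"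
    by (rule abs_summable_summable)
qed

lemma transform_mul_embed:
  "transform (mul a (l1_embed f)) (x, \<mu>) =
    (\<Sum>\<^sub>\<infinity>n. \<mu> powi n * apply_bcontfun (a n) x * apply_bcontfun f (it (- n) x))"
  by (simp add: transform_def l1_embed_eq mul_mono_right apply_cf_mult mult.assoc)

text \<open>Absolute convergence permits grouping the integers \<open>n\<close> by the point
  \<open>it (- n) x\<close>, and each group sums to \<open>entry a x \<mu> y * g y\<close>. The test
  function \<open>g\<close> is arbitrary and bounded because \<open>orep_kernel\<close> inserts the
  coordinates of a vector.\<close>

lemma vanishes_sum_zero:
  assumes "a \<in> l1" "norm \<mu> = 1" "vanishes a x \<mu>" "\<And>y. norm (g y) \<le> B"
  shows "(\<Sum>\<^sub>\<infinity>n. \<mu> powi n * apply_bcontfun (a n) x * g (it (- n) x)) = 0"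
proof -
  let ?g = "\<lambda>n. \<mu> powi n * apply_bcontfun (a n) x * g (it (- n) x)"
  let ?B = "\<lambda>y. {n. it (- n) x = y}"
  have sg: "?g summable_on UNIV"
    by (rule term_summable[OF assms(1,2), where B = B]) (rule assms(4))
  have bij: "bij_betw (\<lambda>n. (it (- n) x, n)) UNIV (Sigma UNIV ?B)"
    by (rule bij_betw_byWitness[where f' = snd]) auto
  have s2: "(\<lambda>(y, n). ?g n) summable_on Sigma UNIV ?B"
    using summable_on_reindex_bij_betw[OF bij, of "\<lambda>(y, n). ?g n"] sg
    by (simp only: prod.case)
  have "(\<Sum>\<^sub>\<infinity>n. ?g n) = (\<Sum>\<^sub>\<infinity>(y, n)\<in>Sigma UNIV ?B. ?g n)"
    using infsum_reindex_bij_betw[OF bij, of "\<lambda>(y, n). ?g n"] by (simp only: prod.case)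
  also have "\<dots> = (\<Sum>\<^sub>\<infinity>y. \<Sum>\<^sub>\<infinity>n\<in>?B y. ?g n)"
    using infsum_Sigma'_banach[OF s2] by (simp only:)
  also have "\<dots> = (\<Sum>\<^sub>\<infinity>y. entry a x \<mu> y * g y)"
    unfolding entry_def
    by (intro infsum_cong) (auto simp flip: infsum_cmult_left' intro!: infsum_cong)
  also have "\<dots> = 0" using assms(3) by (simp add: vanishes_def)
  finally show ?thesis .
qed

text \<open>A continuous function can isolate an orbit point only from finitely many others. The
  entries are therefore recovered up to a tail of the norm of \<open>a\<close>, which can be made
  arbitrarily small.\<close>

lemma vanishes_iff:
  assumes "a \<in> l1" "norm \<mu> = 1"
  shows "(\<forall>f. transform (mul a (l1_embed f)) (x, \<mu>) = 0) \<longleftrightarrow> vanishes a x \<mu>"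
proof
  assume v: "vanishes a x \<mu>"
  show "\<forall>f. transform (mul a (l1_embed f)) (x, \<mu>) = 0"
    unfolding transform_mul_embed
    by (intro allI vanishes_sum_zero[OF assms v, where B = "norm _"]) (rule norm_bounded)
next
  assume t: "\<forall>f. transform (mul a (l1_embed f)) (x, \<mu>) = 0"
  have small: "norm (entry a x \<mu> y) \<le> e" if e: "0 < e" for y e
  proof -
    let ?B = "{n. it (- n) x = y}"
    obtain N where N: "l1_norm (l1_cut (- {- int N..int N}) a) < e"
      using l1_tail_small[OF assms(1) e] by auto
    \<comment> \<open>The orbit points other than \<open>y\<close> met at times up to
      \<open>N\<close>; the bump function at \<open>y\<close> has to vanish on them.\<close>
    define Y where "Y = (\<lambda>n. it (- n) x) ` {- int N..int N} - {y}"
    have "finite Y" by (simp add: Y_def)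
    then have Y: "open (- Y)" by (intro open_Compl finite_imp_closed)
    have yY: "y \<in> - Y" by (simp add: Y_def)
    obtain f :: "'a \<Rightarrow>\<^sub>C complex" and F where
      f: "\<And>y. apply_bcontfun f y = of_real (F y)" "\<And>y. 0 \<le> F y" "\<And>y. F y \<le> 1"
      "F y = 1" "\<And>z. z \<notin> - Y \<Longrightarrow> F z = 0" by (rule urysohn_point[OF compact_X Y yY]) (rule that)
    \<comment> \<open>\<open>?c\<close> compares the indicator of the fibre over \<open>y\<close>
      with the bump function: it is 0 for |n| up to \<open>N\<close> and of modulus at most 1
      beyond.\<close>
    let ?c = "\<lambda>n. (if n \<in> ?B then 1 else 0) - complex_of_real (F (it (- n) x))"
    let ?m = "\<lambda>n. \<mu> powi n * apply_bcontfun (a n) x"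
    have cb: "norm (?c n) \<le> 1" for n
    proof -
      have "?c n = of_real ((if n \<in> ?B then 1 else 0) - F (it (- n) x))" by auto
      then show ?thesis
        using f(2,3)[of "it (- n) x"] by (simp only: norm_of_real) auto
    qed
    have c0: "?c n = 0" if "n \<in> {- int N..int N}" for n
    proof (cases "n \<in> ?B")
      case True
      then show ?thesis using f(4) by simp
    next
      case False
      then have "it (- n) x \<in> Y" using that by (auto simp: Y_def)
      then show ?thesis using f(5) False by simp
    qed
    have "entry a x \<mu> y = (\<Sum>\<^sub>\<infinity>n. ?m n * (if n \<in> ?B then 1 else 0))"
      unfolding entry_def by (rule infsum_cong_neutral) auto
    also have "\<dots> = (\<Sum>\<^sub>\<infinity>n. ?m n * ?c n) + (\<Sum>\<^sub>\<infinity>n. ?m n * of_real (F (it (- n) x)))"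
    proof (subst infsum_add[symmetric])
      show "(\<lambda>n. ?m n * ?c n) summable_on UNIV"
        by (rule term_summable(2)[OF assms, where B = 1]) (rule cb)
      show "(\<lambda>n. ?m n * of_real (F (it (- n) x))) summable_on UNIV"
        using f(2,3) by (intro term_summable(2)[OF assms, where B = 1]) simp
    qed (intro infsum_cong, simp add: algebra_simps)
    also have "(\<Sum>\<^sub>\<infinity>n. ?m n * of_real (F (it (- n) x))) = 0"
      using spec[OF t, of f] by (simp add: transform_mul_embed f(1))
    finally have "norm (entry a x \<mu> y) = norm (\<Sum>\<^sub>\<infinity>n. ?m n * ?c n)" by simp
    also have "\<dots> \<le> l1_norm (l1_cut (- {- int N..int N}) a)"
      unfolding l1_norm_def
    proof (rule norm_infsum_le[OF has_sum_infsum has_sum_infsum])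
      show "(\<lambda>n. norm (l1_cut (- {- int N..int N}) a n)) summable_on UNIV"
        using l1_cut_in[OF assms(1)] by (simp add: l1_iff)
      show "norm (?m n * ?c n) \<le> norm (l1_cut (- {- int N..int N}) a n)" for n
      proof (cases "n \<in> {- int N..int N}")
        case True
        then show ?thesis by (simp only: c0 mult_zero_right norm_zero norm_ge_zero)
      next
        case False
        then have "norm (?m n * ?c n) \<le> norm (a n) * 1"
          unfolding norm_mult norm_power_int assms(2)
          by (intro mult_mono cb) (auto intro: norm_bounded)
        with False show ?thesis by (simp add: l1_cut_def)
      qed
      show "(\<lambda>n. ?m n * ?c n) summable_on UNIV"
        by (rule term_summable(2)[OF assms, where B = 1]) (rule cb)
    qed
    finally show ?thesis using N by simp
  qed
  have "norm (entry a x \<mu> y) \<le> 0" for y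
    using small[of _ y] by (rule field_le_epsilon[where y = 0, simplified])
  then show "vanishes a x \<mu>" by (simp add: vanishes_def)
qed

text \<open>All fibres over the orbit are singletons, so the power of \<mu> cancels and the
  condition does not depend on the phase.\<close>

lemma vanishes_Aper:
  assumes "x \<in> Aper \<sigma>" "\<mu> \<noteq> 0"
  shows "vanishes a x \<mu> \<longleftrightarrow> (\<forall>n. apply_bcontfun (a n) x = 0)"
proof -
  have B: "{n. it (- n) x = it (- m) x} = {m}" for m
    using assms(1) unfolding Aper_iff it_eq_iff by force
  have e: "entry a x \<mu> (it (- m) x) = \<mu> powi m * apply_bcontfun (a m) x" for m
    unfolding entry_def B by simp
  show ?thesis
  proof
    assume "vanishes a x \<mu>"
    then show "\<forall>n. apply_bcontfun (a n) x = 0"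
      using assms(2) unfolding vanishes_def by (metis e mult_eq_0_iff power_int_eq_0_iff)
  qed (simp add: vanishes_def entry_def)
qed

lemma entry_Per:
  assumes "x \<in> Per \<sigma>"
  shows "entry a (it k x) \<mu> (it j x) =
    (\<Sum>\<^sub>\<infinity>n\<in>{n. int (period \<sigma> x) dvd n - (k - j)}. \<mu> powi n * apply_bcontfun (a n) (it k x))"
proof -
  have "it (- n) (it k x) = it j x \<longleftrightarrow> int (period \<sigma> x) dvd n - (k - j)" for n
    using period_props(3)[OF assms, of "- (n - (k - j))"] it_eq_iff[of "k - n" x j]
      dvd_minus_iff[of "int (period \<sigma> x)" "n - (k - j)"]
    by (simp add: algebra_simps)
  then show ?thesis unfolding entry_def by simp
qed

lemma vanishes_Per:
  assumes "x \<in> Per \<sigma>"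
  shows "vanishes a (it k x) \<mu> \<longleftrightarrow> (\<forall>j. entry a (it k x) \<mu> (it j x) = 0)"
proof
  assume e: "\<forall>j. entry a (it k x) \<mu> (it j x) = 0"
  have "entry a (it k x) \<mu> y = 0" for y
  proof (cases "\<exists>n. it (- n) (it k x) = y")
    case True
    then show ?thesis using e by auto
  next
    case False
    then show ?thesis by (simp add: entry_def)
  qed
  then show "vanishes a (it k x) \<mu>" by (simp add: vanishes_def)
qed (simp add: vanishes_def)

section \<open>The ideals attached to points\<close>

lemma int_iter_shift: "int_iter shift n \<xi> k = \<xi> (k - n)"
proof -
  have b: "bij shift"
    by (rule bij_betw_byWitness[where f' = "\<lambda>\<xi> k. \<xi> (k + 1)"]) (auto simp: shift_def)
  have "int_iter shift n \<xi> = (\<lambda>k. \<xi> (k - n))"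
  proof (induction n rule: int_induct[where k = 0])
    case (step1 i)
    then show ?case
      by (simp only: int_iter_succ[OF b]) (simp add: shift_def algebra_simps)
  next
    case (step2 i)
    have "shift (int_iter shift (i - 1) \<xi>) = shift (\<lambda>k. \<xi> (k - (i - 1)))"
      using int_iter_succ[OF b, of "i - 1" \<xi>] step2 by (simp add: shift_def)
    then show ?case using bij_is_inj[OF b] by (simp add: inj_eq)
  qed simp
  then show ?thesis by simp
qed

lemma basis_vec_ell2: "i \<in> J \<Longrightarrow> basis_vec i \<in> vecs (ell2 J)"
  unfolding ell2_def basis_vec_def
  by (auto intro!: finite_nonzero_values_imp_summable_on finite_subset[of _ "{i}"] split: if_splits)

lemma aper_ideal_iff:
  "a \<in> aper_ideal \<sigma> x \<longleftrightarrow> a \<in> l1 \<and> (\<forall>k n. apply_bcontfun (a n) (it k x) = 0)"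
proof -
  have "apply_bcontfun (a n) (it k x) = 0"
    if "a \<in> aper_ideal \<sigma> x" for k n
  proof -
    \<comment> \<open>Only \<delta>^n moves the basis vector at \<open>k - n\<close> to position
      \<open>k\<close>, so this coordinate is the single number \<open>a n\<close> at
      \<open>it k x\<close>.\<close>
    have "aper_rep \<sigma> x a (basis_vec (k - n)) k = 0"
      using that basis_vec_ell2[of "k - n" UNIV]
      by (simp add: aper_ideal_def rep_kernel_def) (simp add: ell2_def)
    then show ?thesis
      unfolding aper_rep_def int_iter_shift
      by (subst (asm) infsum_single[of n]) (auto simp: basis_vec_def)
  qed
  moreover have "a \<in> aper_ideal \<sigma> x"
    if "a \<in> l1" "\<forall>k n. apply_bcontfun (a n) (it k x) = 0"
    using that by (simp add: aper_ideal_def rep_kernel_def aper_rep_def ell2_def)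
  ultimately show ?thesis by (auto simp: aper_ideal_def rep_kernel_def)
qed

lemma aper_ideal_vanishes:
  assumes "x \<in> Aper \<sigma>" "\<mu> \<noteq> 0"
  shows "a \<in> aper_ideal \<sigma> x \<longleftrightarrow> a \<in> l1 \<and> (\<forall>k. vanishes a (it k x) \<mu>)"
proof -
  have "it k x \<in> Aper \<sigma>" for k
    using assms(1) it_inj[of k] unfolding Aper_iff it_it by (metis add.commute it_it)
  then show ?thesis using vanishes_Aper assms(2) aper_ideal_iff by simp
qed

lemma cyclic_shift_bij:
  assumes "0 < p" "\<mu> \<noteq> 0"
  shows "bij (cyclic_shift p \<mu>)"
proof (rule bij_betw_byWitness[where f' = "\<lambda>\<xi> k. if p \<le> k then \<xi> k else if k = p - 1 then \<xi> 0 / \<mu> else \<xi> (k + 1)"])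
qed (use assms in \<open>auto simp: cyclic_shift_def fun_eq_iff\<close>)

text \<open>Coordinate \<open>k\<close> is fed from position (k - n) mod p, with one factor \<nu>^p
  for every passage through 0. The exponent n - k + (k - n) mod p is p times the number of these
  passages.\<close>

lemma int_iter_cyclic_shift:
  assumes p: "0 < p" and l: "\<nu> \<noteq> 0" and k: "k < p"
  shows "int_iter (cyclic_shift p (\<nu> ^ p)) n \<xi> k =
    \<nu> powi (n - int k + (int k - n) mod int p) * \<xi> (nat ((int k - n) mod int p))"
proof -
  define C where "C = cyclic_shift p (\<nu> ^ p)"
  define X where "X n = (\<lambda>k. if p \<le> k then \<xi> k else
    \<nu> powi (n - int k + (int k - n) mod int p) * \<xi> (nat ((int k - n) mod int p)))" for n
  have b: "bij C" unfolding C_def using assms by (intro cyclic_shift_bij) auto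
  have step: "C (X n) = X (n + 1)" for n
  proof
    fix k
    show "C (X n) k = X (n + 1) k"
    proof (cases "p \<le> k")
      case True
      then show ?thesis by (simp add: C_def X_def cyclic_shift_def)
    next
      case False
      show ?thesis
      proof (cases "k = 0")
        case True
        have m: "(int p - (1 + n)) mod int p = (- n - 1) mod int p"
          using mod_add_self1[of "int p" "- n - 1"] by (simp add: algebra_simps)
        have "\<nu> ^ p * \<nu> powi (n + 1 - int p + (- n - 1) mod int p) = \<nu> powi (n + 1 + (- n - 1) mod int p)"
          using l by (simp flip: power_int_of_nat power_int_add add: add.assoc)
        then show ?thesis using False True p m
          by (auto simp: C_def X_def cyclic_shift_def algebra_simps of_nat_diff)
      next
        case nz: False
        then show ?thesis using False
          by (simp add: C_def X_def cyclic_shift_def algebra_simps of_nat_diff)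
      qed
    qed
  qed
  have "int_iter C n \<xi> = X n"
  proof (induction n rule: int_induct[where k = 0])
    case base
    show ?case by (auto simp: X_def)
  next
    case (step1 i)
    then show ?case by (simp add: int_iter_succ[OF b] step)
  next
    case (step2 i)
    have "C (int_iter C (i - 1) \<xi>) = C (X (i - 1))"
      using int_iter_succ[OF b, of "i - 1" \<xi>] step2 by (simp add: step)
    then show ?case using bij_is_inj[OF b] by (simp add: inj_eq)
  qed
  then show ?thesis using k by (simp add: C_def X_def)
qed

text \<open>By \<open>int_iter_cyclic_shift\<close> the matrix of \<open>per_rep\<close> at
  parameter \<nu>^p has the entries
  \<open>\<nu> powi (j - k) * entry a (it k x) \<nu> (it j x)\<close>. It is the matrix of
  \<open>entry\<close> conjugated by a diagonal unitary, so both vanish together.\<close>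

lemma per_ideal_vanishes:
  assumes x: "x \<in> Per \<sigma>" and l: "norm \<nu> = 1"
  shows "a \<in> per_ideal \<sigma> x (\<nu> ^ period \<sigma> x) \<longleftrightarrow> a \<in> l1 \<and> (\<forall>k. vanishes a (it k x) \<nu>)"
proof -
  let ?p = "period \<sigma> x"
  note p = period_props[OF x]
  have l0: "\<nu> \<noteq> 0" using l by auto
  have rep: "per_rep \<sigma> x (\<nu> ^ ?p) a \<xi> k =
      (\<Sum>j<?p. \<xi> j * \<nu> powi (int j - int k) * entry a (it (int k) x) \<nu> (it (int j) x))"
    if k: "k < ?p" and a: "a \<in> l1" for \<xi> k
  proof -
    let ?h = "\<lambda>n. apply_bcontfun (a n) (it (int k) x) *
      (\<nu> powi (n - int k + (int k - n) mod int ?p) * \<xi> (nat ((int k - n) mod int ?p)))"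
    let ?B = "\<lambda>j. {n. int ?p dvd n - (int k - int j)}"
    have mem: "n \<in> ?B j \<longleftrightarrow> (int k - n) mod int ?p = int j" if "j < ?p" for n j
    proof -
      have "n \<in> ?B j \<longleftrightarrow> int ?p dvd (int k - n) - int j"
        using dvd_minus_iff[of "int ?p" "n - (int k - int j)"] by (simp add: algebra_simps)
      also have "\<dots> \<longleftrightarrow> (int k - n) mod int ?p = int j mod int ?p"
        by (simp add: mod_eq_dvd_iff)
      finally show ?thesis using that by simp
    qed
    have eqB: "?h n = \<xi> j * \<nu> powi (int j - int k) * (\<nu> powi n * apply_bcontfun (a n) (it (int k) x))"
      if "j < ?p" "n \<in> ?B j" for j n
    proof -
      have "\<nu> powi (n - int k + int j) = \<nu> powi (int j - int k) * \<nu> powi n"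
        using l0 by (simp flip: power_int_add add: algebra_simps)
      then show ?thesis using mem[OF that(1), of n] that(2) by simp
    qed
    have sB: "?h summable_on ?B j" if j: "j < ?p" for j
    proof -
      have "(\<lambda>n. \<xi> j * \<nu> powi (int j - int k) * (\<nu> powi n * apply_bcontfun (a n) (it (int k) x))) summable_on ?B j"
        using term_summable(2)[OF a l, of "\<lambda>_. 1" 1]
        by (intro summable_on_cmult_right) simp
      then show ?thesis by (rule summable_on_cong[THEN iffD1, rotated]) (simp add: eqB[OF j])
    qed
    have U: "(\<Union>j<?p. ?B j) = UNIV"
    proof -
      have "n \<in> ?B (nat ((int k - n) mod int ?p)) \<and> nat ((int k - n) mod int ?p) < ?p" for n
        using mem[of "nat ((int k - n) mod int ?p)" n] p(1) by (simp add: nat_less_iff)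
      then show ?thesis by blast
    qed
    have "per_rep \<sigma> x (\<nu> ^ ?p) a \<xi> k = (\<Sum>\<^sub>\<infinity>n. ?h n)"
      unfolding per_rep_def using int_iter_cyclic_shift[OF p(1) l0 k] by (simp add: it_nat)
    also have "\<dots> = (\<Sum>j<?p. \<Sum>\<^sub>\<infinity>n\<in>?B j. ?h n)"
      unfolding U[symmetric]
    proof (rule sum_infsum[symmetric])
      show "?B i \<inter> ?B j = {}" if "i \<in> {..<?p}" "j \<in> {..<?p}" "i \<noteq> j" for i j
        using that mem by fastforce
    qed (simp_all add: sB)
    also have "\<dots> = (\<Sum>j<?p. \<xi> j * \<nu> powi (int j - int k) * entry a (it (int k) x) \<nu> (it (int j) x))"
      unfolding entry_Per[OF x]
    proof (rule sum.cong[OF refl])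
      fix j assume "j \<in> {..<?p}"
      then have "(\<Sum>\<^sub>\<infinity>n\<in>?B j. ?h n) = (\<Sum>\<^sub>\<infinity>n\<in>?B j. \<xi> j * \<nu> powi (int j - int k) *
          (\<nu> powi n * apply_bcontfun (a n) (it (int k) x)))"
        using eqB by (intro infsum_cong) auto
      then show "(\<Sum>\<^sub>\<infinity>n\<in>?B j. ?h n) = \<xi> j * \<nu> powi (int j - int k) *
          (\<Sum>\<^sub>\<infinity>n\<in>?B j. \<nu> powi n * apply_bcontfun (a n) (it (int k) x))"
        by (simp only: infsum_cmult_right')
    qed
    finally show ?thesis .
  qed
  show ?thesis
  proof
    assume a: "a \<in> per_ideal \<sigma> x (\<nu> ^ ?p)"
    then have a1: "a \<in> l1" by (simp add: per_ideal_def rep_kernel_def)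
    have e0: "entry a (it (int k) x) \<nu> (it (int j) x) = 0" if "k < ?p" "j < ?p" for k j
    proof -
      have "per_rep \<sigma> x (\<nu> ^ ?p) a (basis_vec j) k = 0"
        using a basis_vec_ell2[of j "{..<?p}"] that
        by (simp add: per_ideal_def rep_kernel_def) (simp add: ell2_def)
      then have "0 = (\<Sum>i<?p. basis_vec j i * \<nu> powi (int i - int k) *
          entry a (it (int k) x) \<nu> (it (int i) x))"
        unfolding rep[OF that(1) a1] by simp
      also have "\<dots> = (\<Sum>i<?p. if i = j then \<nu> powi (int j - int k) *
          entry a (it (int k) x) \<nu> (it (int j) x) else 0)"
        by (rule sum.cong) (auto simp: basis_vec_def)
      finally show ?thesis using that(2) l0 by simp
    qed
    have red: "\<exists>i<?p. it k x = it (int i) x" for k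
    proof (intro exI conjI)
      show "nat (k mod int ?p) < ?p" using p(1) by (simp add: nat_less_iff)
      have "int ?p dvd k - k mod int ?p" by (simp add: minus_mod_eq_mult_div)
      then show "it k x = it (int (nat (k mod int ?p))) x"
        using p(1,3) it_eq_iff[of k x "k mod int ?p"] by simp
    qed
    have "entry a (it k x) \<nu> (it j x) = 0" for k j
      using red[of k] red[of j] e0 by auto
    then show "a \<in> l1 \<and> (\<forall>k. vanishes a (it k x) \<nu>)"
      using a1 vanishes_Per[OF x] by simp
  next
    assume a: "a \<in> l1 \<and> (\<forall>k. vanishes a (it k x) \<nu>)"
    have "per_rep \<sigma> x (\<nu> ^ ?p) a \<xi> = (\<lambda>i. 0)" if "\<xi> \<in> vecs (ell2 {..<?p})" for \<xi>
    proof
      fix k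
      show "per_rep \<sigma> x (\<nu> ^ ?p) a \<xi> k = 0"
      proof (cases "k < ?p")
        case True
        then show ?thesis using rep[OF True] a by (simp add: vanishes_def)
      next
        case False
        \<comment> \<open>Coordinates from the period on are fixed by \<open>cyclic_shift\<close>
          and are 0 in every vector of the space.\<close>
        have "int_iter (cyclic_shift ?p (\<nu> ^ ?p)) n \<xi> k = 0" for n
        proof -
          define C where "C = cyclic_shift ?p (\<nu> ^ ?p)"
          have b: "bij C" unfolding C_def using p(1) l0 by (intro cyclic_shift_bij) auto
          have "C \<zeta> k = \<zeta> k" for \<zeta> using False by (simp add: C_def cyclic_shift_def)
          then have st: "int_iter C (m + 1) \<xi> k = int_iter C m \<xi> k" for m
            by (simp add: int_iter_succ[OF b])
          have "int_iter C n \<xi> k = \<xi> k"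
          proof (induction n rule: int_induct[where k = 0])
            case (step1 i)
            then show ?case using st[of i] by simp
          next
            case (step2 i)
            then show ?case using st[of "i - 1"] by simp
          qed simp
          also have "\<xi> k = 0" using that False by (simp add: ell2_def)
          finally show ?thesis by (simp add: C_def)
        qed
        then show ?thesis by (simp add: per_rep_def)
      qed
    qed
    then show "a \<in> per_ideal \<sigma> x (\<nu> ^ ?p)"
      using a unfolding per_ideal_def rep_kernel_def by (simp add: ell2_def)
  qed
qed

section \<open>Zero sets of ideals\<close>

lemma vanishing_ideal_iff:
  assumes "S \<subseteq> UNIV \<times> unit_circle"
  shows "a \<in> vanishing_ideal \<sigma> S \<longleftrightarrow> a \<in> l1 \<and> (\<forall>(x, \<mu>)\<in>S. vanishes a x \<mu>)"
proof -
  have "norm \<mu> = 1" if "(x, \<mu>) \<in> S" for x \<mu> using assms that by auto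
  then show ?thesis
    unfolding vanishing_ideal_def using vanishes_iff[of a] by fast
qed

lemma zero_set_circle: "zero_set L \<subseteq> UNIV \<times> unit_circle"
  by (auto simp: zero_set_def)

text \<open>\<open>I\<close> is a right ideal: along with \<open>a\<close> it contains every
  \<open>mul a (l1_embed f)\<close>, and f = 1 gives back \<open>a\<close>.\<close>

lemma zero_set_iff:
  assumes "l1_ideal \<sigma> I"
  shows "(x, \<mu>) \<in> zero_set I \<longleftrightarrow> norm \<mu> = 1 \<and> (\<forall>a\<in>I. vanishes a x \<mu>)"
proof -
  have I: "I \<subseteq> l1" "\<And>a b. a \<in> I \<Longrightarrow> b \<in> l1 \<Longrightarrow> mul a b \<in> I"
    using assms by (auto simp: l1_ideal_def)
  have "(\<forall>a\<in>I. transform a (x, \<mu>) = 0) \<longleftrightarrow> (\<forall>a\<in>I. \<forall>f. transform (mul a (l1_embed f)) (x, \<mu>) = 0)"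
    using I(2)[of _ "l1_embed _"] mul_one_right by (metis l1_embed_eq l1_mono_in)
  moreover have "(\<forall>a\<in>I. \<forall>f. transform (mul a (l1_embed f)) (x, \<mu>) = 0) \<longleftrightarrow> (\<forall>a\<in>I. vanishes a x \<mu>)"
    if "norm \<mu> = 1"
    using that I(1) by (intro ball_cong refl vanishes_iff) auto
  ultimately show ?thesis unfolding zero_set_def by auto
qed

lemma ideal_subset_vanishing:
  assumes "l1_ideal \<sigma> I"
  shows "I \<subseteq> vanishing_ideal \<sigma> (zero_set I)"
proof
  fix a assume "a \<in> I"
  with assms show "a \<in> vanishing_ideal \<sigma> (zero_set I)"
    by (auto simp: vanishing_ideal_iff[OF zero_set_circle] zero_set_iff l1_ideal_def)
qed

text \<open>The transform of \<delta>^(-k) a at (x, \<mu>) is \<mu>^(-k) times that of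
  \<open>a\<close> at (it k x, \<mu>), and \<open>I\<close> is a left ideal.\<close>

lemma zero_set_invariant:
  assumes I: "l1_ideal \<sigma> I" and z: "(x, \<mu>) \<in> zero_set I"
  shows "(it k x, \<mu>) \<in> zero_set I"
proof -
  have \<mu>: "\<mu> \<in> unit_circle" using z by (auto simp: zero_set_def)
  then have "\<mu> \<noteq> 0" by auto
  have "transform a (it k x, \<mu>) = 0" if a: "a \<in> I" for a
  proof -
    let ?b = "mul (l1_mono (const_bcontfun 1) (- k)) a"
    have "?b \<in> I" using I a by (auto simp: l1_ideal_def)
    then have "0 = transform ?b (x, \<mu>)" using z by (auto simp: zero_set_def)
    also have "\<dots> = (\<Sum>\<^sub>\<infinity>n. \<mu> powi n * apply_bcontfun (a (n + k)) (it k x))"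
      by (simp add: transform_def mul_mono_left apply_cf_mult)
    also have "\<dots> = (\<Sum>\<^sub>\<infinity>n. \<mu> powi (n - k) * apply_bcontfun (a n) (it k x))"
      by (rule infsum_reindex_bij_witness[of _ "\<lambda>n. n - k" "\<lambda>n. n + k"]) auto
    also have "\<dots> = \<mu> powi (- k) * transform a (it k x, \<mu>)"
      using \<open>\<mu> \<noteq> 0\<close>
      by (simp add: transform_def power_int_diff power_int_minus divide_inverse
          infsum_cmult_right'[symmetric] algebra_simps)
    finally show ?thesis using \<open>\<mu> \<noteq> 0\<close> by simp
  qed
  then show ?thesis using \<mu> by (auto simp: zero_set_def)
qed

text \<open>On an aperiodic orbit a single phase already gives the whole of
  \<open>aper_ideal\<close>. A point with empty \<open>T x\<close> would add nothing to the set but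
  still an ideal to the intersection, hence the nonemptiness for \<open>Sap\<close>. For periodic
  points both sides run over the same phases.\<close>

lemma vanishing_eq_Inter:
  assumes Sap: "Sap \<subseteq> Aper \<sigma>" "\<And>x. x \<in> Sap \<Longrightarrow> T x \<noteq> {}"
    and Sp: "Sp \<subseteq> Per \<sigma>" and T: "\<And>x. x \<in> Sap \<union> Sp \<Longrightarrow> T x \<subseteq> unit_circle"
  shows "vanishing_ideal \<sigma> ((\<Union>x\<in>Sap. \<Union>\<mu>\<in>T x. orbit_of \<sigma> x \<times> {\<mu>}) \<union>
      (\<Union>x\<in>Sp. \<Union>\<mu>\<in>T x. orbit_of \<sigma> x \<times> {\<mu>})) =
    l1 \<inter> (\<Inter>x\<in>Sap. aper_ideal \<sigma> x) \<inter> (\<Inter>x\<in>Sp. \<Inter>\<mu>\<in>T x. per_ideal \<sigma> x (\<mu> ^ period \<sigma> x))"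
    (is "vanishing_ideal \<sigma> ?S = ?R")
proof -
  have S: "?S \<subseteq> UNIV \<times> unit_circle" using T by fast
  have 1: "(\<forall>\<mu>\<in>T x. \<forall>k. vanishes a (it k x) \<mu>) \<longleftrightarrow> a \<in> aper_ideal \<sigma> x"
    if "x \<in> Sap" "a \<in> l1" for x a
  proof -
    have "\<mu> \<noteq> 0" if "\<mu> \<in> T x" for \<mu> using T \<open>x \<in> Sap\<close> that by force
    then show ?thesis using Sap that aper_ideal_vanishes by blast
  qed
  have 2: "(\<forall>\<mu>\<in>T x. \<forall>k. vanishes a (it k x) \<mu>) \<longleftrightarrow> (\<forall>\<mu>\<in>T x. a \<in> per_ideal \<sigma> x (\<mu> ^ period \<sigma> x))"
    if "x \<in> Sp" "a \<in> l1" for x a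
  proof -
    have "norm \<mu> = 1" if "\<mu> \<in> T x" for \<mu> using T \<open>x \<in> Sp\<close> that by force
    then show ?thesis using Sp that per_ideal_vanishes by blast
  qed
  have "a \<in> vanishing_ideal \<sigma> ?S \<longleftrightarrow> a \<in> ?R" for a
  proof -
    have "a \<in> vanishing_ideal \<sigma> ?S \<longleftrightarrow> a \<in> l1 \<and>
        (\<forall>x\<in>Sap. \<forall>\<mu>\<in>T x. \<forall>k. vanishes a (it k x) \<mu>) \<and> (\<forall>x\<in>Sp. \<forall>\<mu>\<in>T x. \<forall>k. vanishes a (it k x) \<mu>)"
      unfolding vanishing_ideal_iff[OF S] unfolding orbit_of_def by blast
    also have "\<dots> \<longleftrightarrow> a \<in> l1 \<and> (\<forall>x\<in>Sap. a \<in> aper_ideal \<sigma> x) \<and>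
        (\<forall>x\<in>Sp. \<forall>\<mu>\<in>T x. a \<in> per_ideal \<sigma> x (\<mu> ^ period \<sigma> x))"
      by (intro conj_cong refl ball_cong 1 2)
    also have "\<dots> \<longleftrightarrow> a \<in> ?R" by auto
    finally show ?thesis .
  qed
  then show ?thesis by blast
qed

lemma zero_set_decomposition:
  assumes "l1_ideal \<sigma> I"
  defines "T \<equiv> \<lambda>x. {\<mu>. (x, \<mu>) \<in> zero_set I}"
  shows "zero_set I = (\<Union>x\<in>{x \<in> Aper \<sigma>. T x \<noteq> {}}. \<Union>\<mu>\<in>T x. orbit_of \<sigma> x \<times> {\<mu>}) \<union>
      (\<Union>x\<in>Per \<sigma>. \<Union>\<mu>\<in>T x. orbit_of \<sigma> x \<times> {\<mu>})" (is "_ = ?R")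
proof
  show "?R \<subseteq> zero_set I"
    using zero_set_invariant[OF assms(1)] by (auto simp: T_def orbit_of_def)
  show "zero_set I \<subseteq> ?R"
  proof
    fix z assume z: "z \<in> zero_set I"
    obtain x \<mu> where [simp]: "z = (x, \<mu>)" by (cases z)
    have "x \<in> orbit_of \<sigma> x" unfolding orbit_of_def using int_iter_0 by (metis rangeI)
    then show "z \<in> ?R" using z by (auto simp: T_def Aper_def)
  qed
qed

lemma vanishing_iff_Inter:
  assumes I: "l1_ideal \<sigma> I"
  shows "vanishing_ideal \<sigma> (zero_set I) = I \<longleftrightarrow>
       (\<exists>Sap Sp T. Sap \<subseteq> Aper \<sigma> \<and> Sp \<subseteq> Per \<sigma> \<and> (\<forall>x\<in>Sp. T x \<subseteq> unit_circle) \<and>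
         I = l1 \<inter> (\<Inter>x\<in>Sap. aper_ideal \<sigma> x) \<inter> (\<Inter>x\<in>Sp. \<Inter>\<mu>\<in>T x. per_ideal \<sigma> x \<mu>))"
    (is "_ \<longleftrightarrow> ?R")
proof
  assume eq: "vanishing_ideal \<sigma> (zero_set I) = I"
  define T where "T x = {\<mu>. (x, \<mu>) \<in> zero_set I}" for x
  have T: "T x \<subseteq> unit_circle" for x using zero_set_circle by (auto simp: T_def)
  have "I = l1 \<inter> (\<Inter>x\<in>{x \<in> Aper \<sigma>. T x \<noteq> {}}. aper_ideal \<sigma> x) \<inter>
      (\<Inter>x\<in>Per \<sigma>. \<Inter>\<mu>\<in>T x. per_ideal \<sigma> x (\<mu> ^ period \<sigma> x))"
    using vanishing_eq_Inter[of "{x \<in> Aper \<sigma>. T x \<noteq> {}}" T "Per \<sigma>"] T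
      zero_set_decomposition[OF I] eq by (simp add: T_def)
  also have "\<dots> = l1 \<inter> (\<Inter>x\<in>{x \<in> Aper \<sigma>. T x \<noteq> {}}. aper_ideal \<sigma> x) \<inter>
      (\<Inter>x\<in>Per \<sigma>. \<Inter>\<mu>\<in>(\<lambda>\<mu>. \<mu> ^ period \<sigma> x) ` T x. per_ideal \<sigma> x \<mu>)" by simp
  finally have "I = l1 \<inter> (\<Inter>x\<in>{x \<in> Aper \<sigma>. T x \<noteq> {}}. aper_ideal \<sigma> x) \<inter>
      (\<Inter>x\<in>Per \<sigma>. \<Inter>\<mu>\<in>(\<lambda>\<mu>. \<mu> ^ period \<sigma> x) ` T x. per_ideal \<sigma> x \<mu>)" .
  moreover have "(\<lambda>\<mu>. \<mu> ^ period \<sigma> x) ` T x \<subseteq> unit_circle" for x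
    using T[of x] by (auto simp: norm_power)
  ultimately show ?R
    by (intro exI[of _ "{x \<in> Aper \<sigma>. T x \<noteq> {}}"] exI[of _ "Per \<sigma>"]
        exI[of _ "\<lambda>x. (\<lambda>\<mu>. \<mu> ^ period \<sigma> x) ` T x"] conjI ballI) auto
next
  assume ?R
  then obtain Sap Sp T where S: "Sap \<subseteq> Aper \<sigma>" "Sp \<subseteq> Per \<sigma>" "\<forall>x\<in>Sp. T x \<subseteq> unit_circle"
    and Ieq: "I = l1 \<inter> (\<Inter>x\<in>Sap. aper_ideal \<sigma> x) \<inter> (\<Inter>x\<in>Sp. \<Inter>\<mu>\<in>T x. per_ideal \<sigma> x \<mu>)"
    by blast
  have "vanishing_ideal \<sigma> (zero_set I) \<subseteq> I"
  proof
    fix a assume "a \<in> vanishing_ideal \<sigma> (zero_set I)"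
    then have a: "a \<in> l1" "\<And>x \<mu>. (x, \<mu>) \<in> zero_set I \<Longrightarrow> vanishes a x \<mu>"
      by (auto simp: vanishing_ideal_iff[OF zero_set_circle])
    have "a \<in> aper_ideal \<sigma> x" if x: "x \<in> Sap" for x
    proof -
      have "x \<in> Aper \<sigma>" using S x by blast
      note av = aper_ideal_vanishes[OF this, of 1]
      have "(it k x, 1) \<in> zero_set I" for k
        unfolding zero_set_iff[OF I] using Ieq x av by auto
      then show ?thesis using av a by simp
    qed
    moreover have "a \<in> per_ideal \<sigma> x \<mu>" if x: "x \<in> Sp" and m: "\<mu> \<in> T x" for x \<mu>
    proof -
      have xp: "x \<in> Per \<sigma>" using S x by blast
      have m1: "norm \<mu> = 1" using subsetD[OF bspec[OF S(3) x] m] by simp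
      \<comment> \<open>A root of \<mu> of order \<open>period \<sigma> x\<close>. Membership in the
        point kernel for \<mu> becomes vanishing at the phase \<nu>, and the orbit of
        \<open>x\<close> with this phase lies in the zero set of \<open>I\<close>.\<close>
      define \<nu> where "\<nu> = cis (Arg \<mu> / real (period \<sigma> x))"
      have l1: "norm \<nu> = 1" by (simp add: \<nu>_def)
      have "\<nu> ^ period \<sigma> x = cis (Arg \<mu>)"
        using period_props(1)[OF xp] by (simp add: \<nu>_def Complex.DeMoivre)
      also have "\<dots> = \<mu>" using m1 by (metis cis_Arg norm_zero sgn_eq div_by_1 of_real_1 zero_neq_one)
      finally have lp: "\<nu> ^ period \<sigma> x = \<mu>" .
      note pv = per_ideal_vanishes[OF xp l1, unfolded lp]
      have "(it k x, \<nu>) \<in> zero_set I" for k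
        unfolding zero_set_iff[OF I] using Ieq x m pv l1 by auto
      then show ?thesis using pv a by simp
    qed
    ultimately show "a \<in> I" using a(1) Ieq by blast
  qed
  then show "vanishing_ideal \<sigma> (zero_set I) = I" using ideal_subset_vanishing[OF I] by blast
qed

end

section \<open>Completeness of sequence spaces\<close>

text \<open>Serves \<open>l1\<close> with e = 1 and \<open>ell2\<close> with e = 2. A Cauchy
  condition phrased through finite sums survives the coordinatewise limit.\<close>

lemma power_sum_complete:
  fixes X :: "nat \<Rightarrow> 'i \<Rightarrow> 'b::banach"
  assumes e: "0 < e"
    and cauchy: "\<And>r. 0 < r \<Longrightarrow> \<exists>N. \<forall>m\<ge>N. \<forall>n\<ge>N. \<forall>A. finite A \<longrightarrow> (\<Sum>i\<in>A. norm (X m i - X n i) ^ e) \<le> r"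
  obtains L where "\<And>r. 0 < r \<Longrightarrow> \<exists>N. \<forall>n\<ge>N. \<forall>A. finite A \<longrightarrow> (\<Sum>i\<in>A. norm (X n i - L i) ^ e) \<le> r"
proof -
  have "Cauchy (\<lambda>n. X n i)" for i
  proof (rule metric_CauchyI)
    fix r :: real assume r: "0 < r"
    then obtain N where N: "\<forall>m\<ge>N. \<forall>n\<ge>N. \<forall>A. finite A \<longrightarrow> (\<Sum>i\<in>A. norm (X m i - X n i) ^ e) \<le> (r / 2) ^ e"
      using cauchy[of "(r / 2) ^ e"] by auto
    have "dist (X m i) (X n i) < r" if "N \<le> m" "N \<le> n" for m n
    proof -
      have "norm (X m i - X n i) ^ e \<le> (r / 2) ^ e"
        using N[rule_format, OF that, of "{i}"] by simp
      then have "norm (X m i - X n i) \<le> r / 2"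
        using r e by (simp add: power_mono_iff)
      then show ?thesis using r by (simp add: dist_norm)
    qed
    then show "\<exists>M. \<forall>m\<ge>M. \<forall>n\<ge>M. dist (X m i) (X n i) < r" by blast
  qed
  then have L: "(\<lambda>n. X n i) \<longlonglongrightarrow> lim (\<lambda>n. X n i)" for i
    by (simp add: Cauchy_convergent_iff convergent_LIMSEQ_iff)
  show ?thesis
  proof (rule that)
    fix r :: real assume "0 < r"
    then obtain N where N: "\<forall>m\<ge>N. \<forall>n\<ge>N. \<forall>A. finite A \<longrightarrow> (\<Sum>i\<in>A. norm (X m i - X n i) ^ e) \<le> r"
      using cauchy by blast
    have "(\<Sum>i\<in>A. norm (X n i - lim (\<lambda>n. X n i)) ^ e) \<le> r" if "N \<le> n" "finite A" for n A
    proof (rule LIMSEQ_le_const2)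
      show "(\<lambda>m. \<Sum>i\<in>A. norm (X n i - X m i) ^ e) \<longlonglongrightarrow> (\<Sum>i\<in>A. norm (X n i - lim (\<lambda>n. X n i)) ^ e)"
        by (intro tendsto_intros L)
      show "\<exists>M. \<forall>m\<ge>M. (\<Sum>i\<in>A. norm (X n i - X m i) ^ e) \<le> r" using N that by blast
    qed
    then show "\<exists>N. \<forall>n\<ge>N. \<forall>A. finite A \<longrightarrow> (\<Sum>i\<in>A. norm (X n i - lim (\<lambda>n. X n i)) ^ e) \<le> r" by blast
  qed
qed

lemma infsum_le_of_finite_sums:
  fixes f :: "'i \<Rightarrow> real"
  assumes "\<And>i. 0 \<le> f i" "\<And>A. finite A \<Longrightarrow> sum f A \<le> r"
  shows "f summable_on B" "infsum f B \<le> r"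
proof -
  show s: "f summable_on B"
    by (rule nonneg_bdd_above_summable_on) (use assms in \<open>auto intro!: bdd_aboveI2\<close>)
  show "infsum f B \<le> r" by (rule infsum_le_finite_sums[OF s]) (use assms in auto)
qed

section \<open>Inner product spaces\<close>

text \<open>The axioms of \<open>complex_hilbert_space\<close> without completeness, so that norm
  estimates are available for \<open>ell2 J\<close> before its completeness is proved.\<close>

locale inner_product_space =
  fixes H :: "'h inner_space"
  assumes zero_closed: "vzero H \<in> vecs H"
    and add_closed: "\<lbrakk>u \<in> vecs H; v \<in> vecs H\<rbrakk> \<Longrightarrow> vadd H u v \<in> vecs H"
    and scale_closed: "u \<in> vecs H \<Longrightarrow> vscale H c u \<in> vecs H"
    and add_assoc: "\<lbrakk>u \<in> vecs H; v \<in> vecs H; w \<in> vecs H\<rbrakk> \<Longrightarrow>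
      vadd H (vadd H u v) w = vadd H u (vadd H v w)"
    and add_commute: "\<lbrakk>u \<in> vecs H; v \<in> vecs H\<rbrakk> \<Longrightarrow> vadd H u v = vadd H v u"
    and add_zero: "u \<in> vecs H \<Longrightarrow> vadd H u (vzero H) = u"
    and add_inverse: "u \<in> vecs H \<Longrightarrow> \<exists>v\<in>vecs H. vadd H u v = vzero H"
    and scale_add_right: "\<lbrakk>u \<in> vecs H; v \<in> vecs H\<rbrakk> \<Longrightarrow>
      vscale H c (vadd H u v) = vadd H (vscale H c u) (vscale H c v)"
    and scale_add_left: "u \<in> vecs H \<Longrightarrow>
      vscale H (c + d) u = vadd H (vscale H c u) (vscale H d u)"
    and scale_scale: "u \<in> vecs H \<Longrightarrow> vscale H c (vscale H d u) = vscale H (c * d) u"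
    and scale_one: "u \<in> vecs H \<Longrightarrow> vscale H 1 u = u"
    and inner_commute: "\<lbrakk>u \<in> vecs H; v \<in> vecs H\<rbrakk> \<Longrightarrow> vinner H v u = cnj (vinner H u v)"
    and inner_add_left: "\<lbrakk>u \<in> vecs H; v \<in> vecs H; w \<in> vecs H\<rbrakk> \<Longrightarrow>
      vinner H (vadd H u v) w = vinner H u w + vinner H v w"
    and inner_scale_left: "\<lbrakk>u \<in> vecs H; v \<in> vecs H\<rbrakk> \<Longrightarrow>
      vinner H (vscale H c u) v = c * vinner H u v"
    and inner_nonneg: "u \<in> vecs H \<Longrightarrow> 0 \<le> Re (vinner H u u)"
    and inner_definite: "\<lbrakk>u \<in> vecs H; vinner H u u = 0\<rbrakk> \<Longrightarrow> u = vzero H"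

lemma hilbert_iff:
  "complex_hilbert_space H \<longleftrightarrow> inner_product_space H \<and> Metric_space.mcomplete (vecs H) (vdist H)"
  unfolding complex_hilbert_space_def inner_product_space_def by (simp only: conj_assoc)

context inner_product_space
begin

lemma inner_add_right:
  "\<lbrakk>u \<in> vecs H; v \<in> vecs H; w \<in> vecs H\<rbrakk> \<Longrightarrow> vinner H w (vadd H u v) = vinner H w u + vinner H w v"
  by (subst (1 2 3) inner_commute) (simp_all add: add_closed inner_add_left)

lemma inner_scale_right:
  "\<lbrakk>u \<in> vecs H; v \<in> vecs H\<rbrakk> \<Longrightarrow> vinner H v (vscale H c u) = cnj c * vinner H v u"
  by (subst (1 2) inner_commute) (simp_all add: scale_closed inner_scale_left)

lemma inner_self: "u \<in> vecs H \<Longrightarrow> vinner H u u = of_real ((vnorm H u)\<^sup>2)"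
  using inner_commute[of u u] inner_nonneg[of u]
  by (auto simp: vnorm_def complex_eq_iff)

lemma norm_sq: "u \<in> vecs H \<Longrightarrow> (vnorm H u)\<^sup>2 = Re (vinner H u u)"
  by (simp add: inner_self)

lemma norm_nonneg: "u \<in> vecs H \<Longrightarrow> 0 \<le> vnorm H u"
  by (simp add: vnorm_def inner_nonneg)

lemma scale_zero: "u \<in> vecs H \<Longrightarrow> vscale H 0 u = vzero H"
  by (rule inner_definite) (auto simp: scale_closed inner_scale_left)

lemma inner_zero: "u \<in> vecs H \<Longrightarrow> vinner H (vzero H) u = 0"
  using inner_scale_left[of "vzero H" u 0] scale_zero[OF zero_closed] zero_closed by simp

lemma norm_zero_iff:
  assumes u: "u \<in> vecs H"
  shows "vnorm H u = 0 \<longleftrightarrow> u = vzero H"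
proof
  assume "vnorm H u = 0"
  then have "vinner H u u = 0" by (simp add: inner_self[OF u])
  then show "u = vzero H" by (rule inner_definite[OF u])
next
  assume "u = vzero H"
  then show "vnorm H u = 0" by (simp add: vnorm_def inner_zero[OF zero_closed])
qed

lemma cauchy_schwarz:
  assumes u: "u \<in> vecs H" and v: "v \<in> vecs H"
  shows "norm (vinner H u v) \<le> vnorm H u * vnorm H v"
proof (cases "vnorm H v = 0")
  case True
  then have "vinner H u v = 0"
    using inner_commute[OF v u] inner_zero[OF u] norm_zero_iff[OF v] by simp
  then show ?thesis using norm_nonneg u v by simp
next
  case False
  define s where "s = (vnorm H v)\<^sup>2"
  have s: "0 < s" using False by (simp add: s_def)
  \<comment> \<open>With this \<open>c\<close> the vector \<open>w\<close> is the component of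
    \<open>u\<close> orthogonal to \<open>v\<close>.\<close>
  define c where "c = - (vinner H u v / of_real s)"
  define w where "w = vadd H u (vscale H c v)"
  have "0 \<le> Re (vinner H w w)" using u v by (simp add: w_def inner_nonneg add_closed scale_closed)
  also have "vinner H w w = of_real ((vnorm H u)\<^sup>2) + cnj c * vinner H u v
      + c * cnj (vinner H u v) + c * cnj c * of_real s"
    unfolding w_def s_def using u v
    by (simp add: inner_add_left inner_add_right inner_scale_left inner_scale_right add_closed
        scale_closed inner_self[OF u] inner_self[OF v] inner_commute[of u v] algebra_simps)
  also have "\<dots> = of_real ((vnorm H u)\<^sup>2 - (norm (vinner H u v))\<^sup>2 / s)"
    using s by (simp add: c_def complex_norm_square field_simps del: of_real_power)
  finally have "(norm (vinner H u v))\<^sup>2 \<le> (vnorm H u)\<^sup>2 * s" using s by (simp add: field_simps)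
  then have "(norm (vinner H u v))\<^sup>2 \<le> (vnorm H u * vnorm H v)\<^sup>2"
    by (simp add: s_def power_mult_distrib)
  then show ?thesis by (rule power2_le_imp_le) (simp add: norm_nonneg u v)
qed

lemma norm_add_sq:
  assumes "u \<in> vecs H" "v \<in> vecs H"
  shows "(vnorm H (vadd H u v))\<^sup>2 = (vnorm H u)\<^sup>2 + (vnorm H v)\<^sup>2 + 2 * Re (vinner H u v)"
  using assms by (simp add: norm_sq add_closed inner_add_left inner_add_right inner_commute[of u v])

lemma norm_triangle:
  assumes "u \<in> vecs H" "v \<in> vecs H"
  shows "vnorm H (vadd H u v) \<le> vnorm H u + vnorm H v"
proof (rule power2_le_imp_le)
  have "Re (vinner H u v) \<le> vnorm H u * vnorm H v"
    using cauchy_schwarz[OF assms] complex_Re_le_cmod order_trans by blast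
  then show "(vnorm H (vadd H u v))\<^sup>2 \<le> (vnorm H u + vnorm H v)\<^sup>2"
    by (simp add: norm_add_sq assms power2_sum)
qed (use assms norm_nonneg in auto)

lemma norm_scale: "u \<in> vecs H \<Longrightarrow> vnorm H (vscale H c u) = norm c * vnorm H u"
proof -
  assume u: "u \<in> vecs H"
  have "vinner H (vscale H c u) (vscale H c u) = (c * cnj c) * vinner H u u"
    using u by (simp add: scale_closed inner_scale_left inner_scale_right)
  also have "\<dots> = of_real ((norm c * vnorm H u)\<^sup>2)"
    unfolding inner_self[OF u] complex_norm_square[symmetric] by (simp add: power_mult_distrib)
  finally have "(vnorm H (vscale H c u))\<^sup>2 = (norm c * vnorm H u)\<^sup>2"
    using u by (simp only: norm_sq scale_closed Re_complex_of_real)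
  then show ?thesis by (rule power2_eq_imp_eq) (simp_all add: u norm_nonneg scale_closed)
qed

lemma sub_sub:
  assumes "u \<in> vecs H" "v \<in> vecs H" "w \<in> vecs H"
  shows "vadd H u (vscale H (-1) w) = vadd H (vadd H u (vscale H (-1) v)) (vadd H v (vscale H (-1) w))"
proof -
  have "vadd H (vscale H (-1) v) v = vzero H"
    using scale_add_left[of v "-1" 1] assms by (simp add: scale_one scale_zero)
  then have "vadd H (vscale H (-1) v) (vadd H v (vscale H (-1) w)) = vscale H (-1) w"
    using add_assoc[of "vscale H (-1) v" v "vscale H (-1) w"] assms
      add_commute[of "vzero H" "vscale H (-1) w"]
    by (simp add: scale_closed zero_closed add_zero)
  then show ?thesis using assms by (simp add: add_assoc add_closed scale_closed)
qed

end

section \<open>Square-summable families\<close>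

lemma ell2_simps:
  "vecs (ell2 J) = {\<xi>. (\<forall>i. i \<notin> J \<longrightarrow> \<xi> i = 0) \<and> (\<lambda>i. (cmod (\<xi> i))\<^sup>2) summable_on J}"
  "vzero (ell2 J) = (\<lambda>i. 0)"
  "vadd (ell2 J) \<xi> \<eta> = (\<lambda>i. \<xi> i + \<eta> i)"
  "vscale (ell2 J) c \<xi> = (\<lambda>i. c * \<xi> i)"
  "vinner (ell2 J) \<xi> \<eta> = (\<Sum>\<^sub>\<infinity>i\<in>J. \<xi> i * cnj (\<eta> i))"
  by (simp_all add: ell2_def)

lemma sq_sum_le: "(cmod (x + y))\<^sup>2 \<le> 2 * (cmod x)\<^sup>2 + 2 * (cmod y)\<^sup>2"
proof -
  have "(cmod (x + y))\<^sup>2 \<le> (cmod x + cmod y)\<^sup>2"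
    by (intro power_mono norm_triangle_ineq) auto
  also have "\<dots> \<le> 2 * (cmod x)\<^sup>2 + 2 * (cmod y)\<^sup>2"
    using zero_le_power2[of "cmod x - cmod y"] by (simp add: power2_eq_square algebra_simps)
  finally show ?thesis .
qed

lemma prod_le_sq: "cmod x * cmod y \<le> (cmod x)\<^sup>2 + (cmod y)\<^sup>2"
proof -
  have "0 \<le> cmod x * cmod y" by simp
  moreover have "0 \<le> (cmod x - cmod y)\<^sup>2" by simp
  moreover have "(cmod x - cmod y)\<^sup>2 = (cmod x)\<^sup>2 + (cmod y)\<^sup>2 - 2 * (cmod x * cmod y)"
    by (simp add: power2_diff)
  ultimately show ?thesis by linarith
qed

lemma ell2_add:
  assumes "\<xi> \<in> vecs (ell2 J)" "\<eta> \<in> vecs (ell2 J)"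
  shows "(\<lambda>i. \<xi> i + \<eta> i) \<in> vecs (ell2 J)"
proof -
  have "(\<lambda>i. 2 * (cmod (\<xi> i))\<^sup>2 + 2 * (cmod (\<eta> i))\<^sup>2) summable_on J"
    using assms by (auto simp: ell2_simps intro!: summable_on_add summable_on_cmult_right)
  then have "(\<lambda>i. (cmod (\<xi> i + \<eta> i))\<^sup>2) summable_on J"
    by (rule summable_on_comparison_test) (auto intro: sq_sum_le)
  then show ?thesis using assms by (simp add: ell2_simps)
qed

lemma ell2_scale:
  assumes "\<xi> \<in> vecs (ell2 J)"
  shows "(\<lambda>i. c * \<xi> i) \<in> vecs (ell2 J)"
  using assms by (auto simp: ell2_simps norm_mult power_mult_distrib intro!: summable_on_cmult_right)

lemma ell2_prod_summable:
  assumes "\<xi> \<in> vecs (ell2 J)" "\<eta> \<in> vecs (ell2 J)"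
  shows "(\<lambda>i. \<xi> i * cnj (\<eta> i)) summable_on J"
proof (rule abs_summable_summable, rule summable_on_comparison_test)
  show "(\<lambda>i. (cmod (\<xi> i))\<^sup>2 + (cmod (\<eta> i))\<^sup>2) summable_on J"
    using assms by (auto simp: ell2_simps intro!: summable_on_add)
qed (auto simp: norm_mult prod_le_sq)

lemma ell2_inner_self: "vinner (ell2 J) \<xi> \<xi> = of_real (\<Sum>\<^sub>\<infinity>i\<in>J. (cmod (\<xi> i))\<^sup>2)"
proof -
  have "\<xi> i * cnj (\<xi> i) = of_real ((cmod (\<xi> i))\<^sup>2)" for i
    by (simp only: complex_norm_square)
  then have "vinner (ell2 J) \<xi> \<xi> = (\<Sum>\<^sub>\<infinity>i\<in>J. of_real ((cmod (\<xi> i))\<^sup>2))"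
    unfolding ell2_simps by (simp only:)
  also have "\<dots> = of_real (\<Sum>\<^sub>\<infinity>i\<in>J. (cmod (\<xi> i))\<^sup>2)"
  proof (cases "(\<lambda>i. (cmod (\<xi> i))\<^sup>2) summable_on J")
    case True
    then show ?thesis by (intro infsumI has_sum_of_real has_sum_infsum)
  next
    \<comment> \<open>Both sums take the default value 0 when the squares are not summable.\<close>
    case False
    then have "\<not> (\<lambda>i. complex_of_real ((cmod (\<xi> i))\<^sup>2)) summable_on J"
      using summable_on_Re[of "\<lambda>i. complex_of_real ((cmod (\<xi> i))\<^sup>2)" J] by auto
    with False show ?thesis by (simp add: infsum_not_exists)
  qed
  finally show ?thesis .
qed

lemma ell2_norm: "vnorm (ell2 J) \<xi> = sqrt (\<Sum>\<^sub>\<infinity>i\<in>J. (cmod (\<xi> i))\<^sup>2)"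
  by (simp only: vnorm_def ell2_inner_self Re_complex_of_real)

lemma ell2_dist: "vdist (ell2 J) \<xi> \<eta> = sqrt (\<Sum>\<^sub>\<infinity>i\<in>J. (cmod (\<xi> i - \<eta> i))\<^sup>2)"
  by (simp add: vdist_def ell2_norm ell2_simps)

lemma ell2_inner_product: "inner_product_space (ell2 J)"
proof
  fix \<xi> \<eta> \<zeta> :: "'a \<Rightarrow> complex" and c d :: complex
  assume x: "\<xi> \<in> vecs (ell2 J)"
  show "\<exists>v\<in>vecs (ell2 J). vadd (ell2 J) \<xi> v = vzero (ell2 J)"
    using ell2_scale[OF x, of "-1"] by (intro bexI[of _ "\<lambda>i. - 1 * \<xi> i"]) (auto simp: ell2_simps)
  show "0 \<le> Re (vinner (ell2 J) \<xi> \<xi>)"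
    by (simp add: ell2_inner_self infsum_nonneg)
  show "\<xi> = vzero (ell2 J)" if "vinner (ell2 J) \<xi> \<xi> = 0"
  proof
    fix i
    have "(\<Sum>\<^sub>\<infinity>i\<in>J. (cmod (\<xi> i))\<^sup>2) = 0" using that by (simp only: ell2_inner_self of_real_eq_0_iff)
    then have "(cmod (\<xi> i))\<^sup>2 = 0" if "i \<in> J"
      using x that by (intro nonneg_infsum_le_0D[of "\<lambda>i. (cmod (\<xi> i))\<^sup>2" J]) (auto simp: ell2_simps)
    then show "\<xi> i = vzero (ell2 J) i" using x by (cases "i \<in> J") (auto simp: ell2_simps)
  qed
  show "vscale (ell2 J) c \<xi> \<in> vecs (ell2 J)" using ell2_scale[OF x] by (simp add: ell2_simps)
  assume y: "\<eta> \<in> vecs (ell2 J)"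
  show "vadd (ell2 J) \<xi> \<eta> \<in> vecs (ell2 J)" using ell2_add[OF x y] by (simp add: ell2_simps)
  show "vinner (ell2 J) \<eta> \<xi> = cnj (vinner (ell2 J) \<xi> \<eta>)"
    by (simp add: ell2_simps mult.commute flip: infsum_cnj)
  show "vinner (ell2 J) (vscale (ell2 J) c \<xi>) \<eta> = c * vinner (ell2 J) \<xi> \<eta>"
    by (simp add: ell2_simps mult.assoc infsum_cmult_right')
  assume z: "\<zeta> \<in> vecs (ell2 J)"
  show "vinner (ell2 J) (vadd (ell2 J) \<xi> \<eta>) \<zeta> = vinner (ell2 J) \<xi> \<zeta> + vinner (ell2 J) \<eta> \<zeta>"
    using infsum_add[OF ell2_prod_summable[OF x z] ell2_prod_summable[OF y z]]
    by (simp add: ell2_simps algebra_simps)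
qed (auto simp: ell2_simps algebra_simps)

lemma ell2_metric: "Metric_space (vecs (ell2 J)) (vdist (ell2 J))"
proof
  interpret inner_product_space "ell2 J" by (rule ell2_inner_product)
  show "0 \<le> vdist (ell2 J) \<xi> \<eta>" for \<xi> \<eta> by (simp add: ell2_dist infsum_nonneg)
  show "vdist (ell2 J) \<xi> \<eta> = vdist (ell2 J) \<eta> \<xi>" for \<xi> \<eta>
    by (simp add: ell2_dist norm_minus_commute)
  fix \<xi> \<eta> assume m: "\<xi> \<in> vecs (ell2 J)" "\<eta> \<in> vecs (ell2 J)"
  show "vdist (ell2 J) \<xi> \<eta> = 0 \<longleftrightarrow> \<xi> = \<eta>"
    unfolding vdist_def using m
    by (simp add: norm_zero_iff add_closed scale_closed) (auto simp: ell2_simps fun_eq_iff)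
  fix \<zeta> assume "\<zeta> \<in> vecs (ell2 J)"
  then show "vdist (ell2 J) \<xi> \<zeta> \<le> vdist (ell2 J) \<xi> \<eta> + vdist (ell2 J) \<eta> \<zeta>"
    unfolding vdist_def using m sub_sub[of \<xi> \<eta> \<zeta>] norm_triangle
    by (simp add: add_closed scale_closed)
qed

lemma ell2_hilbert: "complex_hilbert_space (ell2 J)"
proof -
  interpret M: Metric_space "vecs (ell2 J)" "vdist (ell2 J)" by (rule ell2_metric)
  have "\<exists>L. limitin M.mtopology X L sequentially" if cX: "M.MCauchy X" for X
  proof -
    have X: "X n \<in> vecs (ell2 J)" for n using cX by (auto simp: M.MCauchy_def)
    have diff: "(\<lambda>i. X m i - X n i) \<in> vecs (ell2 J)" for m n
      using ell2_add[OF X[of m] ell2_scale[OF X[of n], of "-1"]] by simp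
    obtain L where L: "\<And>r. 0 < r \<Longrightarrow>
        \<exists>N. \<forall>n\<ge>N. \<forall>A. finite A \<longrightarrow> (\<Sum>i\<in>A. norm (X n i - L i) ^ 2) \<le> r"
    proof (rule power_sum_complete[of 2 X])
      fix r :: real assume r: "0 < r"
      then obtain N where N: "\<And>m n. N \<le> m \<Longrightarrow> N \<le> n \<Longrightarrow> vdist (ell2 J) (X m) (X n) < sqrt r"
        using cX unfolding M.MCauchy_def by (meson real_sqrt_gt_0_iff)
      have "(\<Sum>i\<in>A. norm (X m i - X n i) ^ 2) \<le> r" if "N \<le> m" "N \<le> n" "finite A" for m n A
      proof -
        have s: "(\<lambda>i. (cmod (X m i - X n i))\<^sup>2) summable_on J" using diff[of m n] by (simp add: ell2_simps)
        have "(\<Sum>i\<in>A. (cmod (X m i - X n i))\<^sup>2) = (\<Sum>i\<in>A \<inter> J. (cmod (X m i - X n i))\<^sup>2)"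
          by (rule sum.mono_neutral_right) (use that diff[of m n] in \<open>auto simp: ell2_simps\<close>)
        also have "\<dots> \<le> (\<Sum>\<^sub>\<infinity>i\<in>J. (cmod (X m i - X n i))\<^sup>2)"
          by (rule finite_sum_le_infsum[OF s]) (use that in auto)
        also have "\<dots> \<le> r" using N[OF that(1,2)] by (simp add: ell2_dist)
        finally show ?thesis .
      qed
      then show "\<exists>N. \<forall>m\<ge>N. \<forall>n\<ge>N. \<forall>A. finite A \<longrightarrow> (\<Sum>i\<in>A. norm (X m i - X n i) ^ 2) \<le> r" by blast
    qed (simp, rule that)
    have L0: "L i = 0" if "i \<notin> J" for i
    proof -
      have "(cmod (L i))\<^sup>2 \<le> 0 + r" if "0 < r" for r
      proof -
        obtain n where "\<forall>A. finite A \<longrightarrow> (\<Sum>i\<in>A. norm (X n i - L i) ^ 2) \<le> r" using L[OF \<open>0 < r\<close>] by blast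
        then have "(\<Sum>i\<in>{i}. norm (X n i - L i) ^ 2) \<le> r" by blast
        moreover have "X n i = 0" using X[of n] \<open>i \<notin> J\<close> by (simp add: ell2_simps)
        ultimately show ?thesis by simp
      qed
      then have "(cmod (L i))\<^sup>2 \<le> 0" by (rule field_le_epsilon)
      then show ?thesis by simp
    qed
    have LX: "(\<lambda>i. X n i - L i) \<in> vecs (ell2 J) \<and> vdist (ell2 J) (X n) L \<le> sqrt r"
      if "\<forall>A. finite A \<longrightarrow> (\<Sum>i\<in>A. norm (X n i - L i) ^ 2) \<le> r" for n r
      using infsum_le_of_finite_sums[of "\<lambda>i. norm (X n i - L i) ^ 2" r J] that X[of n] L0
      by (simp add: ell2_simps ell2_dist)
    obtain n where "(\<lambda>i. X n i - L i) \<in> vecs (ell2 J)" using L[of 1] LX by (meson order_refl zero_less_one)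
    \<comment> \<open>One index is enough: \<open>L\<close> is the difference of the square-summable
      families \<open>X n\<close> and \<open>X n - L\<close>.\<close>
    from ell2_add[OF X[of n] ell2_scale[OF this, of "-1"]] have Lv: "L \<in> vecs (ell2 J)" by simp
    have "\<exists>N. \<forall>n\<ge>N. vdist (ell2 J) (X n) L < e" if e: "0 < e" for e
    proof -
      obtain N where "\<forall>n\<ge>N. vdist (ell2 J) (X n) L \<le> sqrt ((e/2)\<^sup>2)"
        using L[of "(e/2)\<^sup>2"] LX e by (meson half_gt_zero zero_less_power)
      then show ?thesis using e by (intro exI[of _ N]) force
    qed
    then have "limitin M.mtopology X L sequentially"
      unfolding M.limit_metric_sequentially using X Lv by meson
    then show ?thesis by blast
  qed
  then show ?thesis unfolding hilbert_iff M.mcomplete_def using ell2_inner_product by blast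
qed

section \<open>Transport of representations\<close>

text \<open>Transport of structure along an injection. The representation on the zero set lives on
  functions of pairs, whereas the theorem asks for a carrier inside
  \<open>hilbert_universe\<close>.\<close>

definition hcopy :: "('g \<Rightarrow> 'h) \<Rightarrow> 'g inner_space \<Rightarrow> 'h inner_space" where
  "hcopy e H = \<lparr>vecs = e ` vecs H, vzero = e (vzero H),
     vadd = (\<lambda>u v. e (vadd H (inv e u) (inv e v))),
     vscale = (\<lambda>c u. e (vscale H c (inv e u))),
     vinner = (\<lambda>u v. vinner H (inv e u) (inv e v))\<rparr>"

lemma hcopy_hilbert:
  assumes e: "inj e" and H: "complex_hilbert_space H" and M: "Metric_space (vecs H) (vdist H)"
  shows "complex_hilbert_space (hcopy e H)"
proof -
  interpret H: complex_hilbert_space H by (rule H)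
  interpret M: Metric_space "vecs H" "vdist H" by (rule M)
  have [simp]: "inv e (e u) = u" for u using e by simp
  have d: "vdist (hcopy e H) u v = vdist H (inv e u) (inv e v)" for u v
    by (simp add: vdist_def vnorm_def hcopy_def)
  have c: "vecs (hcopy e H) = e ` vecs H" by (simp add: hcopy_def)
  interpret M': Metric_space "vecs (hcopy e H)" "vdist (hcopy e H)"
  proof
    show "vdist (hcopy e H) u v = vdist (hcopy e H) v u" for u v unfolding d by (rule M.commute)
    fix u v assume uv: "u \<in> vecs (hcopy e H)" "v \<in> vecs (hcopy e H)"
    then show "vdist (hcopy e H) u v = 0 \<longleftrightarrow> u = v" unfolding d c by auto
    fix w assume "w \<in> vecs (hcopy e H)"
    with uv show "vdist (hcopy e H) u w \<le> vdist (hcopy e H) u v + vdist (hcopy e H) v w"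
      unfolding d c by (auto intro: M.triangle)
  qed (simp add: d)
  have "inner_product_space (hcopy e H)"
  proof
    show "\<exists>v\<in>vecs (hcopy e H). vadd (hcopy e H) u v = vzero (hcopy e H)" if uv: "u \<in> vecs (hcopy e H)" for u
    proof -
      obtain u' where u: "u = e u'" "u' \<in> vecs H" using uv c by auto
      then obtain v where "v \<in> vecs H" "vadd H u' v = vzero H" using H.add_inverse by blast
      then show ?thesis using u by (intro bexI[of _ "e v"]) (auto simp: hcopy_def)
    qed
    show "u = vzero (hcopy e H)" if "u \<in> vecs (hcopy e H)" "vinner (hcopy e H) u u = 0" for u
      using that H.inner_definite by (auto simp: hcopy_def)
    show "vinner (hcopy e H) v u = cnj (vinner (hcopy e H) u v)"
      if "u \<in> vecs (hcopy e H)" "v \<in> vecs (hcopy e H)" for u v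
      using that by (auto simp: hcopy_def intro: H.inner_commute)
    show "vadd (hcopy e H) u v = vadd (hcopy e H) v u"
      if "u \<in> vecs (hcopy e H)" "v \<in> vecs (hcopy e H)" for u v
      using that by (auto simp: hcopy_def intro!: arg_cong[where f = e] H.add_commute)
  qed (auto simp: hcopy_def H.zero_closed H.add_closed H.scale_closed H.add_assoc H.add_zero
      H.scale_add_right H.scale_add_left H.scale_scale H.scale_one H.inner_add_left
      H.inner_scale_left H.inner_nonneg)
  moreover have "M'.mcomplete"
    unfolding M'.mcomplete_def
  proof (intro allI impI)
    fix X assume X: "M'.MCauchy X"
    then have "range X \<subseteq> vecs (hcopy e H)" unfolding M'.MCauchy_def by blast
    then have r: "X n \<in> e ` vecs H" for n unfolding c by auto
    have "M.MCauchy (inv e \<circ> X)"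
      unfolding M.MCauchy_def
    proof (intro conjI)
      show "range (inv e \<circ> X) \<subseteq> vecs H" 
      proof safe
        fix n
        obtain u where "X n = e u" "u \<in> vecs H" using r[of n] by blast
        then show "(inv e \<circ> X) n \<in> vecs H" by simp
      qed
      show "\<forall>\<epsilon>>0. \<exists>N. \<forall>n n'. N \<le> n \<longrightarrow> N \<le> n' \<longrightarrow> vdist H ((inv e \<circ> X) n) ((inv e \<circ> X) n') < \<epsilon>"
        using X[unfolded M'.MCauchy_def, THEN conjunct2] by (simp only: d o_apply)
    qed
    then obtain L where "limitin M.mtopology (inv e \<circ> X) L sequentially"
      using H.complete unfolding M.mcomplete_def by blast
    then have L: "L \<in> vecs H" "\<forall>\<epsilon>>0. \<exists>N. \<forall>n\<ge>N. vdist H (inv e (X n)) L < \<epsilon>"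
      unfolding M.limit_metric_sequentially o_apply by meson+
    have "limitin M'.mtopology X (e L) sequentially"
      unfolding M'.limit_metric_sequentially using L r by (simp add: d c)
    then show "\<exists>L. limitin M'.mtopology X L sequentially" by blast
  qed
  ultimately show ?thesis unfolding hilbert_iff by blast
qed

lemma hcopy_representation:
  assumes e: "inj e" and r: "involutive_representation \<sigma> H \<rho>" and M: "Metric_space (vecs H) (vdist H)"
  defines "\<rho>' \<equiv> \<lambda>a u. e (\<rho> a (inv e u))"
  shows "involutive_representation \<sigma> (hcopy e H) \<rho>'" "rep_kernel (hcopy e H) \<rho>' = rep_kernel H \<rho>"
proof -
  have [simp]: "inv e (e u) = u" for u using e by simp
  have cv: "vecs (hcopy e H) = e ` vecs H" by (simp add: hcopy_def)
  have nrm: "vnorm (hcopy e H) (e u) = vnorm H u" for u by (simp add: vnorm_def hcopy_def)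
  have b: "bounded_operator (hcopy e H) (\<rho>' a)" if bd: "bounded_operator H (\<rho> a)" for a
  proof -
    obtain K where "\<forall>u\<in>vecs H. vnorm H (\<rho> a u) \<le> K * vnorm H u"
      using bd by (auto simp: bounded_operator_def)
    then have "\<forall>u\<in>vecs (hcopy e H). vnorm (hcopy e H) (\<rho>' a u) \<le> K * vnorm (hcopy e H) u"
      unfolding \<rho>'_def cv by (auto simp: nrm)
    moreover have "(\<forall>u\<in>vecs (hcopy e H). \<rho>' a u \<in> vecs (hcopy e H)) \<and>
       (\<forall>u\<in>vecs (hcopy e H). \<forall>v\<in>vecs (hcopy e H). \<rho>' a (vadd (hcopy e H) u v) = vadd (hcopy e H) (\<rho>' a u) (\<rho>' a v)) \<and>
       (\<forall>c. \<forall>u\<in>vecs (hcopy e H). \<rho>' a (vscale (hcopy e H) c u) = vscale (hcopy e H) c (\<rho>' a u))"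
      using bd unfolding bounded_operator_def by (auto simp: \<rho>'_def hcopy_def)
    ultimately show ?thesis unfolding bounded_operator_def by blast
  qed
  show "involutive_representation \<sigma> (hcopy e H) \<rho>'"
    using r hcopy_hilbert[OF e _ M] b unfolding involutive_representation_def
    by (auto simp: \<rho>'_def hcopy_def)
  show "rep_kernel (hcopy e H) \<rho>' = rep_kernel H \<rho>"
    using inj_eq[OF e] by (auto simp: rep_kernel_def \<rho>'_def hcopy_def)
qed

section \<open>The representation on an invariant set\<close>

lemma weighted_square_sum:
  fixes w f :: "int \<Rightarrow> real"
  assumes w: "w summable_on UNIV" "\<And>n. 0 \<le> w n" and f: "\<And>n. 0 \<le> f n" "\<And>n. f n \<le> B"
  shows "(\<lambda>n. w n * f n) summable_on UNIV" "(\<lambda>n. w n * (f n)\<^sup>2) summable_on UNIV"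
    "(\<Sum>\<^sub>\<infinity>n. w n * f n)\<^sup>2 \<le> infsum w UNIV * (\<Sum>\<^sub>\<infinity>n. w n * (f n)\<^sup>2)"
proof -
  have B: "0 \<le> B" using f[of 0] by linarith
  show s1: "(\<lambda>n. w n * f n) summable_on UNIV"
    by (rule summable_on_comparison_test[OF summable_on_cmult_left[OF w(1), of B]])
       (auto intro: mult_left_mono mult_nonneg_nonneg w f)
  show s2: "(\<lambda>n. w n * (f n)\<^sup>2) summable_on UNIV"
    by (rule summable_on_comparison_test[OF summable_on_cmult_left[OF w(1), of "B\<^sup>2"]])
       (auto intro!: mult_left_mono w f power_mono mult_nonneg_nonneg)
  let ?A = "infsum w UNIV" and ?t = "\<Sum>\<^sub>\<infinity>n. w n * f n" and ?Q = "\<Sum>\<^sub>\<infinity>n. w n * (f n)\<^sup>2"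
  show "?t\<^sup>2 \<le> ?A * ?Q"
  proof (cases "?A = 0")
    case True
    then have "w n = 0" for n using nonneg_infsum_le_0D[of w UNIV n] w by simp
    then show ?thesis by simp
  next
    case False
    then have A: "0 < ?A" using infsum_nonneg[of UNIV w] w by auto
    \<comment> \<open>The weighted mean of \<open>f\<close>; expanding the nonnegative variance
      around it gives the inequality.\<close>
    define s where "s = ?t / ?A"
    have "0 \<le> (\<Sum>\<^sub>\<infinity>n. w n * (f n - s)\<^sup>2)" by (intro infsum_nonneg) (simp add: w)
    also have "\<dots> = (\<Sum>\<^sub>\<infinity>n. w n * (f n)\<^sup>2 + ((- 2 * s) * (w n * f n) + s\<^sup>2 * w n))"
      by (intro infsum_cong) (simp add: power2_eq_square algebra_simps)
    also have "\<dots> = ?Q + ((- 2 * s) * ?t + s\<^sup>2 * ?A)"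
      by (intro infsumI has_sum_add has_sum_cmult_right has_sum_infsum s1 s2 w)
    also have "\<dots> = ?Q - ?t\<^sup>2 / ?A"
      using A by (simp add: s_def power2_eq_square field_simps)
    finally show ?thesis using A by (simp add: field_simps)
  qed
qed

locale invariant_set = dynamics \<sigma> for \<sigma> :: "'a::t2_space \<Rightarrow> 'a" +
  fixes S :: "('a \<times> complex) set"
  assumes S_circle: "S \<subseteq> UNIV \<times> unit_circle"
    and S_inv: "(x, \<mu>) \<in> S \<Longrightarrow> (it k x, \<mu>) \<in> S"
begin

definition sh :: "int \<Rightarrow> 'a \<times> complex \<Rightarrow> 'a \<times> complex" where
  "sh n z = (it (- n) (fst z), snd z)"

text \<open>The direct sum, over the phases and orbits in \<open>S\<close>, of the orbit
  representations: f \<delta>^n turns \<xi> into the family with value \<mu>^n f(x)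
  \<xi>(\<sigma>^(-n) x, \<mu>) at (x, \<mu>). Its matrix entries are those of
  \<open>entry\<close>.\<close>

definition orep ::
  "(int \<Rightarrow> ('a \<Rightarrow>\<^sub>C complex)) \<Rightarrow> ('a \<times> complex \<Rightarrow> complex) \<Rightarrow> 'a \<times> complex \<Rightarrow> complex" where
  "orep a \<xi> z = (\<Sum>\<^sub>\<infinity>n. snd z powi n * apply_bcontfun (a n) (fst z) * \<xi> (sh n z))"

abbreviation E :: "('a \<times> complex \<Rightarrow> complex) inner_space" where "E \<equiv> ell2 S"

lemma sh_sh: "sh m (sh n z) = sh (m + n) z"
  by (simp add: sh_def)

lemma fst_sh [simp]: "fst (sh n z) = it (- n) (fst z)" and snd_sh [simp]: "snd (sh n z) = snd z"
  by (simp_all add: sh_def)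

lemma sh_0 [simp]: "sh 0 z = z"
  by (simp add: sh_def)

lemma sh_in: "sh n z \<in> S \<longleftrightarrow> z \<in> S"
proof -
  have "sh n z \<in> S" if "z \<in> S" for n z using that S_inv by (cases z) (auto simp: sh_def)
  then show ?thesis using sh_sh[of "- n" n z] by (metis add.left_inverse sh_0)
qed

lemma sh_bij: "bij_betw (sh n) S S"
  by (rule bij_betw_byWitness[where f' = "sh (- n)"]) (auto simp: sh_sh sh_in)

lemma norm_snd: "z \<in> S \<Longrightarrow> norm (snd z) = 1"
  using S_circle by auto

lemma E_outside: "\<xi> \<in> vecs E \<Longrightarrow> z \<notin> S \<Longrightarrow> \<xi> z = 0"
  by (cases z) (auto simp: ell2_simps)

lemma E_bound: "\<xi> \<in> vecs E \<Longrightarrow> norm (\<xi> z) \<le> vnorm E \<xi>"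
proof (cases "z \<in> S")
  case True
  assume x: "\<xi> \<in> vecs E"
  have "(\<Sum>z\<in>{z}. (norm (\<xi> z))\<^sup>2) \<le> (\<Sum>\<^sub>\<infinity>z\<in>S. (norm (\<xi> z))\<^sup>2)"
    by (rule finite_sum_le_infsum) (use x True in \<open>auto simp: ell2_simps\<close>)
  then show ?thesis unfolding ell2_norm by (intro real_le_rsqrt) simp
next
  case False
  assume "\<xi> \<in> vecs E"
  with False show ?thesis by (simp add: E_outside ell2_norm infsum_nonneg)
qed

lemma orep_summable:
  assumes "a \<in> l1" "\<xi> \<in> vecs E" "z \<in> S"
  shows "(\<lambda>n. snd z powi n * apply_bcontfun (a n) (fst z) * \<xi> (sh n z)) summable_on UNIV"
  by (rule term_summable[OF assms(1) norm_snd[OF assms(3)]]) (rule E_bound[OF assms(2)])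

lemma orep_outside: "\<xi> \<in> vecs E \<Longrightarrow> z \<notin> S \<Longrightarrow> orep a \<xi> z = 0"
  by (simp add: orep_def E_outside sh_in)

text \<open>Each \<open>sh n\<close> permutes \<open>S\<close>, so for fixed \<open>n\<close> the
  sum over \<open>z\<close> is \<open>norm (a n)\<close> times the sum of \<open>q\<close>.\<close>

lemma weight_sum:
  assumes a: "a \<in> l1" and q: "q summable_on S" "\<And>z. 0 \<le> q z"
  shows "((\<lambda>(z, n). norm (a n) * q (sh n z)) has_sum (l1_norm a * infsum q S)) (S \<times> UNIV)"
    "(\<lambda>(z, n). norm (a n) * q z) summable_on (S \<times> UNIV)"
proof -
  have s: "((\<lambda>z. norm (a n) * q (sh n z)) has_sum (norm (a n) * infsum q S)) S" for n
    using has_sum_reindex_bij_betw[OF sh_bij[of n], of q "infsum q S"] q(1)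
    by (intro has_sum_cmult_right) (simp add: has_sum_infsum)
  have t: "((\<lambda>n. norm (a n) * infsum q S) has_sum (l1_norm a * infsum q S)) UNIV"
    unfolding l1_norm_def using a by (intro has_sum_cmult_left has_sum_infsum) (simp add: l1_iff)
  have "((\<lambda>(n, z). norm (a n) * q (sh n z)) has_sum (l1_norm a * infsum q S)) (UNIV \<times> S)"
  proof (rule has_sum_SigmaI)
    show "(\<lambda>(n, z). norm (a n) * q (sh n z)) summable_on UNIV \<times> S"
      by (rule summable_on_SigmaI[OF _ has_sum_imp_summable[OF t]]) (use s q in auto)
  qed (use s t in auto)
  then show "((\<lambda>(z, n). norm (a n) * q (sh n z)) has_sum (l1_norm a * infsum q S)) (S \<times> UNIV)"
    by (subst has_sum_swap) simp
  show "(\<lambda>(z, n). norm (a n) * q z) summable_on (S \<times> UNIV)"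
  proof (rule summable_on_SigmaI)
    show "(\<lambda>z. l1_norm a * q z) summable_on S" using q by (intro summable_on_cmult_right)
    show "((\<lambda>n. (\<lambda>(z, n). norm (a n) * q z) (z, n)) has_sum (l1_norm a * q z)) UNIV" for z
      unfolding l1_norm_def using a by (auto intro!: has_sum_cmult_left has_sum_infsum simp: l1_iff)
  qed (use q in auto)
qed

text \<open>Cauchy-Schwarz with the weights \<open>norm (a n)\<close> at every point gives one
  factor \<open>l1_norm a\<close>; summing over the points with \<open>weight_sum\<close> gives the
  second.\<close>

lemma orep_bounded:
  assumes a: "a \<in> l1" and x: "\<xi> \<in> vecs E"
  shows "orep a \<xi> \<in> vecs E" "vnorm E (orep a \<xi>) \<le> l1_norm a * vnorm E \<xi>"
proof -
  let ?q = "\<lambda>z. (norm (\<xi> z))\<^sup>2"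
  let ?Q = "\<lambda>z. \<Sum>\<^sub>\<infinity>n. norm (a n) * ?q (sh n z)"
  have q: "?q summable_on S" using x by (simp add: ell2_simps)
  have an: "(\<lambda>n. norm (a n)) summable_on UNIV" using a by (simp add: l1_iff)
  note ws = weighted_square_sum[OF an norm_ge_zero, of "\<lambda>n. norm (\<xi> (sh n _))" "vnorm E \<xi>",
      OF norm_ge_zero E_bound[OF x]]
  have pt: "(norm (orep a \<xi> z))\<^sup>2 \<le> l1_norm a * ?Q z" if z: "z \<in> S" for z
  proof -
    have "norm (orep a \<xi> z) \<le> (\<Sum>\<^sub>\<infinity>n. norm (a n) * norm (\<xi> (sh n z)))"
      unfolding orep_def
      by (rule norm_infsum_le[OF has_sum_infsum[OF orep_summable[OF a x z]] has_sum_infsum[OF ws(1)]])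
         (auto simp: norm_mult norm_power_int norm_snd[OF z] intro!: mult_right_mono norm_bounded)
    then have "(norm (orep a \<xi> z))\<^sup>2 \<le> (\<Sum>\<^sub>\<infinity>n. norm (a n) * norm (\<xi> (sh n z)))\<^sup>2"
      by (intro power_mono) auto
    also have "\<dots> \<le> l1_norm a * ?Q z" using ws(3)[of z] by (simp add: l1_norm_def)
    finally show ?thesis .
  qed
  have "(?Q has_sum (l1_norm a * infsum ?q S)) S"
  proof (rule has_sum_SigmaD[OF weight_sum(1)[OF a q]])
    show "((\<lambda>n. (\<lambda>(z, n). norm (a n) * ?q (sh n z)) (z, n)) has_sum ?Q z) UNIV" for z
      using has_sum_infsum[OF ws(2)] by simp
  qed auto
  then have Q: "((\<lambda>z. l1_norm a * ?Q z) has_sum (l1_norm a * (l1_norm a * infsum ?q S))) S"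
    by (rule has_sum_cmult_right)
  have s: "(\<lambda>z. (norm (orep a \<xi> z))\<^sup>2) summable_on S"
    by (rule summable_on_comparison_test[OF has_sum_imp_summable[OF Q]]) (use pt in auto)
  then show "orep a \<xi> \<in> vecs E" using orep_outside[OF x] by (auto simp: ell2_simps)
  have "(\<Sum>\<^sub>\<infinity>z\<in>S. (norm (orep a \<xi> z))\<^sup>2) \<le> l1_norm a * (l1_norm a * infsum ?q S)"
    by (rule has_sum_mono[OF has_sum_infsum[OF s] Q]) (rule pt)
  then have "vnorm E (orep a \<xi>) \<le> sqrt ((l1_norm a)\<^sup>2 * infsum ?q S)"
    by (simp add: ell2_norm power2_eq_square mult.assoc)
  then show "vnorm E (orep a \<xi>) \<le> l1_norm a * vnorm E \<xi>"
    by (simp add: real_sqrt_mult ell2_norm)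
qed

lemma orep_add_vec:
  assumes "a \<in> l1" "\<xi> \<in> vecs E" "\<eta> \<in> vecs E"
  shows "orep a (\<lambda>i. \<xi> i + \<eta> i) = (\<lambda>i. orep a \<xi> i + orep a \<eta> i)"
proof
  fix z
  show "orep a (\<lambda>i. \<xi> i + \<eta> i) z = orep a \<xi> z + orep a \<eta> z"
  proof (cases "z \<in> S")
    case True
    show ?thesis
      using infsum_add[OF orep_summable[OF assms(1,2) True] orep_summable[OF assms(1,3) True]]
      by (simp add: orep_def distrib_left)
  qed (simp add: orep_outside assms ell2_add)
qed

lemma orep_add:
  assumes "a \<in> l1" "b \<in> l1" "\<xi> \<in> vecs E"
  shows "orep (l1_add a b) \<xi> = (\<lambda>i. orep a \<xi> i + orep b \<xi> i)"
proof
  fix z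
  show "orep (l1_add a b) \<xi> z = orep a \<xi> z + orep b \<xi> z"
  proof (cases "z \<in> S")
    case True
    show ?thesis
      using infsum_add[OF orep_summable[OF assms(1,3) True] orep_summable[OF assms(2,3) True]]
      by (simp add: orep_def l1_add_def algebra_simps)
  qed (simp add: orep_outside assms)
qed

lemma orep_scale_vec: "orep a (\<lambda>i. c * \<xi> i) = (\<lambda>i. c * orep a \<xi> i)"
  unfolding orep_def by (simp add: infsum_cmult_right'[symmetric] mult.left_commute)

lemma orep_scale: "orep (l1_scale c a) \<xi> = (\<lambda>i. c * orep a \<xi> i)"
  unfolding orep_def
  by (simp add: infsum_cmult_right'[symmetric] l1_scale_def apply_scale mult_ac)

lemma orep_mul:
  assumes a: "a \<in> l1" and b: "b \<in> l1" and x: "\<xi> \<in> vecs E"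
  shows "orep (mul a b) \<xi> = orep a (orep b \<xi>)"
proof
  fix z
  show "orep (mul a b) \<xi> z = orep a (orep b \<xi>) z"
  proof (cases "z \<in> S")
    case False
    then show ?thesis using orep_bounded[OF b x] by (simp add: orep_outside x)
  next
    case z: True
    let ?x = "fst z" and ?\<mu> = "snd z"
    have mu: "norm ?\<mu> = 1" "?\<mu> \<noteq> 0" using norm_snd[OF z] by auto
    let ?g = "\<lambda>k m. ?\<mu> powi (k + m) * apply_bcontfun (a k) ?x * apply_bcontfun (b m) (it (- k) ?x) * \<xi> (sh (k + m) z)"
    let ?h = "\<lambda>n k. ?g k (n - k)"
    \<comment> \<open>Coordinates of \<xi> are bounded by its norm, so the convolution family of
      \<open>a\<close> and \<open>b\<close> dominates.\<close>
    have hs: "(\<lambda>(n, k). ?h n k) summable_on UNIV \<times> UNIV"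
    proof (rule abs_summable_summable, rule summable_on_comparison_test)
      show "(\<lambda>p. (\<lambda>(n, k). norm (a k) * norm (b (n - k))) p * vnorm E \<xi>) summable_on UNIV \<times> UNIV"
        using has_sum_imp_summable[OF convolution_summable[OF a b]]
        by (intro summable_on_cmult_left) simp
    qed (auto simp: norm_mult norm_power_int mu intro!: mult_mono norm_bounded E_bound[OF x])
    have gs: "(\<lambda>(k, m). ?g k m) summable_on UNIV \<times> UNIV"
      using hs by (subst summable_on_reindex_bij_witness[of _ "\<lambda>(n, k). (k, n - k)" "\<lambda>(k, m). (k + m, k)"
            "UNIV \<times> UNIV" "\<lambda>(n, k). ?h n k"]) auto
    have "orep (mul a b) \<xi> z = (\<Sum>\<^sub>\<infinity>n. \<Sum>\<^sub>\<infinity>k. ?h n k)"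
      unfolding orep_def
      by (intro infsum_cong)
         (simp add: apply_mul[OF a b] infsum_cmult_right'[symmetric] infsum_cmult_left'[symmetric] mult_ac)
    also have "\<dots> = (\<Sum>\<^sub>\<infinity>(n, k)\<in>UNIV \<times> UNIV. ?h n k)"
      by (rule infsum_Sigma'_banach[OF hs])
    also have "\<dots> = (\<Sum>\<^sub>\<infinity>(k, m)\<in>UNIV \<times> UNIV. ?g k m)"
      by (rule infsum_reindex_bij_witness[of _ "\<lambda>(k, m). (k + m, k)" "\<lambda>(n, k). (k, n - k)"]) auto
    also have "\<dots> = (\<Sum>\<^sub>\<infinity>k. \<Sum>\<^sub>\<infinity>m. ?g k m)"
      by (rule infsum_Sigma'_banach[OF gs, symmetric])
    also have "\<dots> = orep a (orep b \<xi>) z"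
      unfolding orep_def
      by (intro infsum_cong)
         (simp add: infsum_cmult_right'[symmetric] sh_sh power_int_add mu mult_ac add.commute)
    finally show ?thesis .
  qed
qed

lemma orep_star:
  assumes a: "a \<in> l1" and x: "\<xi> \<in> vecs E" and y: "\<eta> \<in> vecs E"
  shows "vinner E (orep (star a) \<xi>) \<eta> = vinner E \<xi> (orep a \<eta>)"
proof -
  let ?g = "\<lambda>z n. \<xi> z * cnj (snd z powi n * apply_bcontfun (a n) (fst z) * \<eta> (sh n z))"
  let ?h = "\<lambda>z n. snd z powi n * apply_bcontfun (star a n) (fst z) * \<xi> (sh n z) * cnj (\<eta> z)"
  have q: "(\<lambda>z. (norm (\<xi> z))\<^sup>2) summable_on S" "(\<lambda>z. (norm (\<eta> z))\<^sup>2) summable_on S"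
    using x y by (simp_all add: ell2_simps)
  have gs: "(\<lambda>(z, n). ?g z n) summable_on S \<times> UNIV"
  proof (rule abs_summable_summable, rule summable_on_comparison_test)
    show "(\<lambda>p. (\<lambda>(z, n). norm (a n) * (norm (\<xi> z))\<^sup>2) p + (\<lambda>(z, n). norm (a n) * (norm (\<eta> (sh n z)))\<^sup>2) p)
      summable_on S \<times> UNIV"
      using weight_sum(2)[OF a q(1)] has_sum_imp_summable[OF weight_sum(1)[OF a q(2)]]
      by (intro summable_on_add) auto
    fix p assume p: "p \<in> S \<times> (UNIV :: int set)"
    obtain z n where [simp]: "p = (z, n)" by (cases p)
    have "norm (?g z n) = norm (apply_bcontfun (a n) (fst z)) * (norm (\<xi> z) * norm (\<eta> (sh n z)))"
      using p by (simp add: norm_mult norm_power_int norm_snd)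
    also have "\<dots> \<le> norm (a n) * ((norm (\<xi> z))\<^sup>2 + (norm (\<eta> (sh n z)))\<^sup>2)"
      by (intro mult_mono norm_bounded prod_le_sq) auto
    finally show "norm (case p of (z, n) \<Rightarrow> ?g z n) \<le>
        (\<lambda>(z, n). norm (a n) * (norm (\<xi> z))\<^sup>2) p + (\<lambda>(z, n). norm (a n) * (norm (\<eta> (sh n z)))\<^sup>2) p"
      by (simp add: algebra_simps)
  qed simp
  have eq: "?h (sh n z) (- n) = ?g z n" if "z \<in> S" for z n
  proof -
    have "cnj (snd z) = inverse (snd z)"
      using norm_snd[OF that] by (metis complex_norm_square div_by_1 divide_inverse inverse_unique of_real_1 power_one)
    then have "cnj (snd z powi n) = snd z powi (- n)"
      by (simp add: power_int_minus power_int_inverse power_int_def)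
    then show ?thesis by (simp add: apply_star sh_sh)
  qed
  \<comment> \<open>This involution of the index set exchanges the summands of the two inner
    products.\<close>
  let ?b = "\<lambda>(z, n). (sh n z, - n)"
  have bij: "bij_betw ?b (S \<times> UNIV) (S \<times> UNIV)"
    by (rule bij_betw_byWitness[where f' = ?b]) (auto simp: sh_sh sh_in)
  have eq': "(case ?b p of (z, n) \<Rightarrow> ?h z n) = (case p of (z, n) \<Rightarrow> ?g z n)" if "p \<in> S \<times> UNIV" for p
  proof -
    obtain z n where p: "p = (z, n)" by (cases p)
    then have "z \<in> S" using that by blast
    from eq[OF this, of n] show ?thesis by (simp only: p prod.case)
  qed
  have hs: "(\<lambda>(z, n). ?h z n) summable_on S \<times> UNIV"
    by (rule summable_on_reindex_bij_betw[OF bij, THEN iffD1])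
       (rule summable_on_cong[OF eq', THEN iffD2, OF _ gs])
  have "vinner E (orep (star a) \<xi>) \<eta> = (\<Sum>\<^sub>\<infinity>z\<in>S. \<Sum>\<^sub>\<infinity>n. ?h z n)"
    unfolding ell2_simps orep_def by (simp only: infsum_cmult_left'[symmetric])
  also have "\<dots> = (\<Sum>\<^sub>\<infinity>(z, n)\<in>S \<times> UNIV. ?h z n)" by (rule infsum_Sigma'_banach[OF hs])
  also have "\<dots> = (\<Sum>\<^sub>\<infinity>(z, n)\<in>S \<times> UNIV. ?g z n)"
    by (subst infsum_reindex_bij_betw[OF bij, symmetric]) (rule infsum_cong[OF eq'])
  also have "\<dots> = (\<Sum>\<^sub>\<infinity>z\<in>S. \<Sum>\<^sub>\<infinity>n. ?g z n)" by (rule infsum_Sigma'_banach[OF gs, symmetric])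
  also have "\<dots> = vinner E \<xi> (orep a \<eta>)"
    unfolding ell2_simps orep_def by (simp only: infsum_cmult_right'[symmetric] infsum_cnj[symmetric])
  finally show ?thesis .
qed

lemma orep_representation: "involutive_representation \<sigma> E orep"
  unfolding involutive_representation_def
proof (intro conjI ballI allI)
  fix a :: "int \<Rightarrow> ('a \<Rightarrow>\<^sub>C complex)" assume a: "a \<in> l1"
  have "\<exists>K. \<forall>u\<in>vecs E. vnorm E (orep a u) \<le> K * vnorm E u" using orep_bounded(2)[OF a] by blast
  then show "bounded_operator E (orep a)"
    unfolding bounded_operator_def using orep_bounded(1)[OF a] orep_add_vec[OF a] orep_scale_vec
    by (auto simp: ell2_simps(3,4))
qed (auto simp: ell2_hilbert orep_star orep_mul orep_add[unfolded fun_eq_iff] orep_scale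
      orep_add_vec orep_scale_vec ell2_simps(3,4) fun_eq_iff)

text \<open>Basis vectors read off the entries. Conversely each coordinate of
  \<open>orep a \<xi>\<close> is a sum as in \<open>vanishes_sum_zero\<close>, with \<xi> at fixed
  phase as test function.\<close>

lemma orep_kernel: "rep_kernel E orep = vanishing_ideal \<sigma> S"
proof -
  have "a \<in> rep_kernel E orep \<longleftrightarrow> (\<forall>(x, \<mu>)\<in>S. vanishes a x \<mu>)" if a: "a \<in> l1" for a
  proof
    assume k: "a \<in> rep_kernel E orep"
    have "entry a x \<mu> y = 0" if z: "(x, \<mu>) \<in> S" for x \<mu> y
    proof (cases "(y, \<mu>) \<in> S")
      case True
      then have "orep a (basis_vec (y, \<mu>)) (x, \<mu>) = 0"
        using k basis_vec_ell2[OF True] by (simp add: rep_kernel_def ell2_simps(2))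
      also have "orep a (basis_vec (y, \<mu>)) (x, \<mu>) = entry a x \<mu> y"
        unfolding orep_def entry_def
        by (rule infsum_cong_neutral) (auto simp: basis_vec_def sh_def)
      finally show ?thesis .
    next
      case False
      then have "{n. it (- n) x = y} = {}" using S_inv[OF z] by blast
      then show ?thesis by (simp add: entry_def)
    qed
    then show "\<forall>(x, \<mu>)\<in>S. vanishes a x \<mu>" by (auto simp: vanishes_def)
  next
    assume v: "\<forall>(x, \<mu>)\<in>S. vanishes a x \<mu>"
    have "orep a \<xi> z = 0" if x: "\<xi> \<in> vecs E" for \<xi> z
    proof (cases "z \<in> S")
      case True
      then have "vanishes a (fst z) (snd z)" using v by auto
      from vanishes_sum_zero[OF a norm_snd[OF True] this, of "\<lambda>y. \<xi> (y, snd z)" "vnorm E \<xi>"]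
      show ?thesis using E_bound[OF x] by (simp add: orep_def sh_def)
    qed (simp add: orep_outside x)
    then show "a \<in> rep_kernel E orep" using a by (auto simp: rep_kernel_def ell2_simps(2))
  qed
  moreover have "a \<in> l1" if "a \<in> rep_kernel E orep" for a using that by (simp add: rep_kernel_def)
  ultimately show ?thesis using vanishing_ideal_iff[OF S_circle] by blast
qed

end

section \<open>Kernels of representations\<close>

lemma (in dynamics) rep_kernel_ideal:
  assumes "involutive_representation \<sigma> H \<rho>"
  shows "l1_ideal \<sigma> (rep_kernel H \<rho>)" "l1_self_adjoint \<sigma> (rep_kernel H \<rho>)"
proof -
  have hs: "complex_hilbert_space H" using assms by (simp add: involutive_representation_def)
  then interpret inner_product_space H by (simp add: hilbert_iff)
  have cl: "\<rho> a u \<in> vecs H" if "a \<in> l1" "u \<in> vecs H" for a u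
    using assms that by (auto simp: involutive_representation_def bounded_operator_def)
  have r: "\<rho> (l1_add a b) u = vadd H (\<rho> a u) (\<rho> b u)" "\<rho> (l1_scale c a) u = vscale H c (\<rho> a u)"
    "\<rho> (mul a b) u = \<rho> a (\<rho> b u)" "vinner H (\<rho> (star a) u) v = vinner H u (\<rho> a v)"
    if "a \<in> l1" "b \<in> l1" "u \<in> vecs H" "v \<in> vecs H" for a b u v c
    using assms that by (auto simp: involutive_representation_def)
  have sz: "vscale H c (vzero H) = vzero H" for c
    by (rule inner_definite) (simp_all add: scale_closed zero_closed inner_scale_left inner_zero)
  have lin: "\<rho> a (vzero H) = vzero H" if "a \<in> l1" for a
  proof -
    have "\<rho> a (vscale H 0 (vzero H)) = vscale H 0 (\<rho> a (vzero H))"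
      using assms that zero_closed by (auto simp: involutive_representation_def bounded_operator_def)
    then show ?thesis using cl[OF that zero_closed] by (simp add: sz scale_zero)
  qed
  have z0: "\<rho> l1_zero u = vzero H" if "u \<in> vecs H" for u
  proof -
    have "l1_scale 0 l1_zero = (l1_zero :: int \<Rightarrow> ('a \<Rightarrow>\<^sub>C complex))"
      by (intro ext bcontfun_eqI) (simp add: l1_scale_def apply_scale l1_zero_def)
    then show ?thesis using r(2)[of l1_zero l1_zero u u 0] that cl[of l1_zero u] by (simp add: scale_zero)
  qed
  show "l1_ideal \<sigma> (rep_kernel H \<rho>)"
    unfolding l1_ideal_def rep_kernel_def
    using r cl lin sz z0 add_zero[OF zero_closed] by auto
  show "l1_self_adjoint \<sigma> (rep_kernel H \<rho>)"
    unfolding l1_self_adjoint_def rep_kernel_def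
  proof (safe intro!: star_in)
    fix a u assume a: "a \<in> l1" "\<forall>u\<in>vecs H. \<rho> a u = vzero H" and u: "u \<in> vecs H"
    \<comment> \<open>Moving \<open>star a\<close> to the other side leaves \<open>\<rho> a\<close>
      applied to a vector, which is 0.\<close>
    have "vinner H (\<rho> (star a) u) (\<rho> (star a) u) = vinner H u (vzero H)"
      using r(4)[of a a u "\<rho> (star a) u"] a u cl by simp
    also have "\<dots> = 0" using inner_commute[OF zero_closed u] inner_zero[OF u] by simp
    finally show "\<rho> (star a) u = vzero H" using inner_definite cl a u by simp
  qed
qed

section \<open>The metric of the algebra\<close>

lemma l1_sum_le_norm:
  assumes "a \<in> l1" "finite A"
  shows "(\<Sum>n\<in>A. norm (a n)) \<le> l1_norm a"
  unfolding l1_norm_def using assms by (intro finite_sum_le_infsum) (auto simp: l1_iff)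

lemma l1_norm_leI:
  assumes "\<And>A. finite A \<Longrightarrow> (\<Sum>n\<in>A. norm (a n)) \<le> r"
  shows "a \<in> l1" "l1_norm a \<le> r"
  unfolding l1_iff l1_norm_def using infsum_le_of_finite_sums[of "\<lambda>n. norm (a n)" r] assms by auto

lemma l1_norm_zero:
  assumes "a \<in> l1" "l1_norm a = 0"
  shows "a = l1_zero"
  using l1_norm_ge[OF assms(1)] assms(2) by (auto simp: l1_zero_def)

lemma l1_metric:
  assumes M: "M \<subseteq> l1"
  shows "Metric_space M l1_dist"
proof
  show "0 \<le> l1_dist a b" for a b by (simp add: l1_dist_eq)
  show "l1_dist a b = l1_dist b a" for a b by (simp add: l1_dist_def norm_minus_commute)
  fix a b :: "int \<Rightarrow> ('a \<Rightarrow>\<^sub>C complex)" assume a: "a \<in> M" and b: "b \<in> M"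
  show "l1_dist a b = 0 \<longleftrightarrow> a = b"
  proof
    assume "l1_dist a b = 0"
    then have "l1_sub a b = l1_zero" using a b M by (intro l1_norm_zero l1_sub_in) (auto simp: l1_dist_eq)
    then show "a = b" by (auto simp: l1_sub_def l1_zero_def fun_eq_iff)
  qed (simp add: l1_dist_def)
  fix c assume c: "c \<in> M"
  have "l1_sub a c = l1_add (l1_sub a b) (l1_sub b c)" by (simp add: l1_sub_def l1_add_def)
  then show "l1_dist a c \<le> l1_dist a b + l1_dist b c"
    unfolding l1_dist_eq using a b c M by (metis l1_norm_add l1_sub_in subsetD)
qed

text \<open>The iteration in \<open>l1_square_root\<close> takes place in such a ball; squaring is a
  contraction only on small balls, so the whole algebra would not do.\<close>

lemma l1_ball_complete:
  "Metric_space.mcomplete {a \<in> l1. l1_norm a \<le> r} (l1_dist :: (int \<Rightarrow> ('a::topological_space \<Rightarrow>\<^sub>C complex)) \<Rightarrow> _)"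
proof -
  define M :: "(int \<Rightarrow> ('a \<Rightarrow>\<^sub>C complex)) set" where "M = {a \<in> l1. l1_norm a \<le> r}"
  interpret M: Metric_space M l1_dist by (rule l1_metric) (simp add: M_def)
  have "M.mcomplete"
    unfolding M.mcomplete_def
  proof (intro allI impI)
    fix X assume X: "M.MCauchy X"
    then have "range X \<subseteq> M" unfolding M.MCauchy_def by blast
    then have XM: "X n \<in> l1" "l1_norm (X n) \<le> r" for n by (auto simp: M_def)
    obtain L where L: "\<And>e. 0 < e \<Longrightarrow>
        \<exists>N. \<forall>n\<ge>N. \<forall>A. finite A \<longrightarrow> (\<Sum>i\<in>A. norm (X n i - L i) ^ 1) \<le> e"
    proof (rule power_sum_complete[of 1 X])
      fix e :: real assume "0 < e"
      then obtain N where N: "\<And>m n. N \<le> m \<Longrightarrow> N \<le> n \<Longrightarrow> l1_dist (X m) (X n) < e"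
        using X unfolding M.MCauchy_def by meson
      have "(\<Sum>i\<in>A. norm (X m i - X n i) ^ 1) \<le> e" if "N \<le> m" "N \<le> n" "finite A" for m n A
        using l1_sum_le_norm[OF l1_sub_in[OF XM(1) XM(1)] that(3), of m n] N[OF that(1,2)]
        by (simp add: l1_dist_eq l1_sub_def)
      then show "\<exists>N. \<forall>m\<ge>N. \<forall>n\<ge>N. \<forall>A. finite A \<longrightarrow> (\<Sum>i\<in>A. norm (X m i - X n i) ^ 1) \<le> e" by blast
    qed (simp, rule that)
    have LX: "\<exists>N. \<forall>n\<ge>N. l1_sub (X n) L \<in> l1 \<and> l1_norm (l1_sub (X n) L) \<le> e" if e: "0 < e" for e
    proof -
      obtain N where N: "\<forall>n\<ge>N. \<forall>A. finite A \<longrightarrow> (\<Sum>i\<in>A. norm (X n i - L i) ^ 1) \<le> e"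
        using L[OF e] by blast
      have "l1_sub (X n) L \<in> l1 \<and> l1_norm (l1_sub (X n) L) \<le> e" if "N \<le> n" for n
        using l1_norm_leI[of "l1_sub (X n) L" e] N that by (simp add: l1_sub_def)
      then show ?thesis by blast
    qed
    have eqL: "L = l1_sub (X n) (l1_sub (X n) L)" for n by (simp add: l1_sub_def)
    obtain n where "l1_sub (X n) L \<in> l1" using LX[of 1] by auto
    then have Ll: "L \<in> l1" using eqL[of n] XM(1)[of n] l1_sub_in by metis
    have "l1_norm L \<le> r + e" if e: "0 < e" for e
    proof -
      obtain n where n: "l1_sub (X n) L \<in> l1" "l1_norm (l1_sub (X n) L) \<le> e" using LX[OF e] by blast
      have "l1_norm L \<le> l1_norm (X n) + l1_norm (l1_scale (-1) (l1_sub (X n) L))"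
        using l1_norm_add[OF XM(1)[of n] l1_scale_in[OF n(1), of "-1"]] eqL[of n] by (simp add: l1_sub_eq[symmetric])
      also have "l1_norm (l1_scale (-1) (l1_sub (X n) L)) \<le> e"
        using l1_norm_scale[OF n(1), of "-1"] n(2) by simp
      finally show ?thesis using XM(2)[of n] by linarith
    qed
    then have "l1_norm L \<le> r" by (rule field_le_epsilon)
    then have LM: "L \<in> M" using Ll by (simp add: M_def)
    have "\<exists>N. \<forall>n\<ge>N. X n \<in> M \<and> l1_dist (X n) L < e" if e: "0 < e" for e
    proof -
      obtain N where "\<forall>n\<ge>N. l1_norm (l1_sub (X n) L) \<le> e / 2" using LX[of "e / 2"] e by auto
      then show ?thesis using XM e by (intro exI[of _ N]) (fastforce simp: M_def l1_dist_eq)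
    qed
    then have "limitin M.mtopology X L sequentially"
      unfolding M.limit_metric_sequentially using LM by blast
    then show "\<exists>L. limitin M.mtopology X L sequentially" by blast
  qed
  then show ?thesis by (simp add: M_def)
qed

context dynamics
begin

lemma mul_sub:
  assumes "a \<in> l1" "b \<in> l1" "c \<in> l1"
  shows "mul (l1_sub a b) c = l1_sub (mul a c) (mul b c)" "mul c (l1_sub a b) = l1_sub (mul c a) (mul c b)"
  using assms by (simp_all add: l1_sub_eq mul_add_left mul_add_right mul_scale)

text \<open>The element \<open>y\<close> is \<open>1 - sqrt (1 - b)\<close>, the fixed point of \<open>y \<mapsto> (b + y\<^sup>2) / 2\<close>.\<close>

lemma l1_square_root:
  assumes b: "b \<in> l1" "star b = b" "l1_norm b < 1"
  obtains y where "y \<in> l1" "star y = y" "mul (l1_sub l1_one y) (l1_sub l1_one y) = l1_sub l1_one b"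
proof -
  define r where "r = l1_norm b"
  have r: "0 \<le> r" "r < 1" using b by (simp_all add: r_def)
  define M where "M = {a \<in> (l1 :: (int \<Rightarrow> ('a \<Rightarrow>\<^sub>C complex)) set). l1_norm a \<le> r}"
  interpret M: Metric_space M l1_dist by (rule l1_metric) (simp add: M_def)
  \<comment> \<open>On the ball of radius \<open>r\<close> the values have norm at most (r + r^2) /
    2, hence at most \<open>r\<close>, and the Lipschitz constant is \<open>r\<close>.\<close>
  define f where "f y = l1_scale (1/2) (l1_add b (mul y y))" for y
  have fM: "f y \<in> M" if y: "y \<in> M" for y
  proof -
    have y': "y \<in> l1" "l1_norm y \<le> r" using y by (auto simp: M_def)
    have "l1_norm (f y) \<le> 1/2 * (r + r * r)"
    proof -
      have "l1_norm (mul y y) \<le> r * r"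
        using l1_norm_mul[OF y'(1) y'(1)] y'(2) mult_mono[of "l1_norm y" r "l1_norm y" r] r by simp
      then show ?thesis
        using l1_norm_scale[of "l1_add b (mul y y)" "1/2"] l1_norm_add[OF b(1), of "mul y y"] b(1) y'(1)
        unfolding f_def r_def[symmetric] by simp
    qed
    also have "\<dots> \<le> r" using r mult_left_mono[of r 1 r] by simp
    finally show ?thesis using b y' by (simp add: M_def f_def)
  qed
  have con: "l1_dist (f x) (f y) \<le> r * l1_dist x y" if x: "x \<in> M" and y: "y \<in> M" for x y
  proof -
    have x': "x \<in> l1" "l1_norm x \<le> r" and y': "y \<in> l1" "l1_norm y \<le> r" using x y by (auto simp: M_def)
    have d: "l1_sub x y \<in> l1" using x' y' by simp
    have "l1_add (mul x (l1_sub x y)) (mul (l1_sub x y) y) = l1_sub (mul x x) (mul y y)"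
      using x' y' by (simp add: mul_sub) (simp add: l1_sub_def l1_add_def)
    then have "l1_sub (f x) (f y) = l1_scale (1/2) (l1_add (mul x (l1_sub x y)) (mul (l1_sub x y) y))"
      unfolding f_def
      by (intro ext bcontfun_eqI) (simp add: l1_scale_def l1_sub_def l1_add_def apply_scale algebra_simps)
    then have "l1_dist (f x) (f y) \<le> 1/2 * l1_norm (l1_add (mul x (l1_sub x y)) (mul (l1_sub x y) y))"
      using l1_norm_scale[of "l1_add (mul x (l1_sub x y)) (mul (l1_sub x y) y)" "1/2"] x' y' d
      by (simp add: l1_dist_eq)
    also have "\<dots> \<le> 1/2 * (l1_norm x * l1_norm (l1_sub x y) + l1_norm (l1_sub x y) * l1_norm y)"
      using l1_norm_add[of "mul x (l1_sub x y)" "mul (l1_sub x y) y"] l1_norm_mul[OF x'(1) d]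
        l1_norm_mul[OF d y'(1)] x' y' d by simp
    also have "\<dots> \<le> 1/2 * (r * l1_norm (l1_sub x y) + l1_norm (l1_sub x y) * r)"
      using x' y' by (intro mult_left_mono add_mono mult_right_mono) auto
    finally show ?thesis by (simp add: l1_dist_eq algebra_simps)
  qed
  have "b \<in> M" using b by (simp add: M_def r_def)
  then obtain y where y: "y \<in> M" "f y = y"
    using M.Banach_fixedpoint_thm[of f r] l1_ball_complete fM con r unfolding M_def by blast
  have yl: "y \<in> l1" using y by (simp add: M_def)
  \<comment> \<open>The star of the fixed point is again a fixed point in the ball; the contraction
    estimate then forces equality.\<close>
  have "star y \<in> M" using y by (simp add: M_def l1_norm_star)
  moreover have "f (star y) = star y"
  proof -
    have "star (f y) = f (star y)"
      using yl b by (simp add: f_def star_scale star_add star_mul)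
    then show ?thesis using y by simp
  qed
  ultimately have "l1_dist (star y) y \<le> r * l1_dist (star y) y" using con[of "star y" y] y by simp
  then have "(1 - r) * l1_dist (star y) y \<le> 0" by (simp add: left_diff_distrib)
  then have "l1_dist (star y) y = 0"
    using r M.nonneg[of "star y" y] by (simp add: mult_le_0_iff)
  then have sy: "star y = y" using \<open>star y \<in> M\<close> y by simp
  have "mul (l1_sub l1_one y) (l1_sub l1_one y) = l1_sub (l1_sub l1_one y) (l1_sub y (mul y y))"
    using yl by (simp add: mul_sub mul_one_left mul_one_right)
  also have "\<dots> = l1_sub l1_one b"
  proof (intro ext bcontfun_eqI)
    fix n x
    have "apply_bcontfun (y n) x = 1/2 * (apply_bcontfun (b n) x + apply_bcontfun (mul y y n) x)"
      using arg_cong[OF y(2), of "\<lambda>y. apply_bcontfun (y n) x"] by (simp add: f_def l1_scale_def apply_scale l1_add_def)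
    then show "apply_bcontfun (l1_sub (l1_sub l1_one y) (l1_sub y (mul y y)) n) x =
        apply_bcontfun (l1_sub l1_one b n) x"
      by (simp add: l1_sub_def field_simps)
  qed
  finally show ?thesis using that yl sy by blast
qed

end

section \<open>Representations are contractive\<close>

locale representation = dynamics \<sigma> for \<sigma> :: "'a::t2_space \<Rightarrow> 'a" +
  fixes H :: "'h inner_space" and \<rho> :: "(int \<Rightarrow> ('a \<Rightarrow>\<^sub>C complex)) \<Rightarrow> 'h \<Rightarrow> 'h"
  assumes rep: "involutive_representation \<sigma> H \<rho>"
begin

sublocale inner_product_space H
  using rep by (simp add: involutive_representation_def hilbert_iff)

abbreviation nrm :: "'h \<Rightarrow> real" where "nrm \<equiv> vnorm H"
abbreviation fn :: "('a \<Rightarrow>\<^sub>C complex) \<Rightarrow> int \<Rightarrow> ('a \<Rightarrow>\<^sub>C complex)" where "fn f \<equiv> l1_mono f 0"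
abbreviation dl :: "int \<Rightarrow> int \<Rightarrow> ('a \<Rightarrow>\<^sub>C complex)" where "dl n \<equiv> l1_mono (const_bcontfun 1) n"

lemma rho_closed [simp]: "\<lbrakk>a \<in> l1; u \<in> vecs H\<rbrakk> \<Longrightarrow> \<rho> a u \<in> vecs H"
  using rep by (auto simp: involutive_representation_def bounded_operator_def)

lemma rho_add: "\<lbrakk>a \<in> l1; b \<in> l1; u \<in> vecs H\<rbrakk> \<Longrightarrow> \<rho> (l1_add a b) u = vadd H (\<rho> a u) (\<rho> b u)"
  and rho_scale: "\<lbrakk>a \<in> l1; u \<in> vecs H\<rbrakk> \<Longrightarrow> \<rho> (l1_scale c a) u = vscale H c (\<rho> a u)"
  and rho_mul: "\<lbrakk>a \<in> l1; b \<in> l1; u \<in> vecs H\<rbrakk> \<Longrightarrow> \<rho> (mul a b) u = \<rho> a (\<rho> b u)"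
  and rho_star: "\<lbrakk>a \<in> l1; u \<in> vecs H; v \<in> vecs H\<rbrakk> \<Longrightarrow> vinner H (\<rho> (star a) u) v = vinner H u (\<rho> a v)"
  using rep by (auto simp: involutive_representation_def)

lemma rho_norm_sq:
  assumes "a \<in> l1" "u \<in> vecs H"
  shows "vinner H (\<rho> (mul (star a) a) u) u = of_real ((nrm (\<rho> a u))\<^sup>2)"
  using assms by (simp add: rho_mul rho_star inner_self)

lemma norm_rho_add:
  assumes "a \<in> l1" "b \<in> l1" "u \<in> vecs H"
  shows "nrm (\<rho> (l1_add a b) u) \<le> nrm (\<rho> a u) + nrm (\<rho> b u)"
  using assms by (simp add: rho_add norm_triangle)

lemma inner_rho_sub:
  assumes "a \<in> l1" "b \<in> l1" "u \<in> vecs H" "v \<in> vecs H"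
  shows "vinner H (\<rho> (l1_sub a b) u) v = vinner H (\<rho> a u) v - vinner H (\<rho> b u) v"
  using assms by (simp add: l1_sub_eq rho_add rho_scale inner_add_left inner_scale_left scale_closed)

lemma star_one: "star l1_one = l1_one"
  by (intro ext bcontfun_eqI) (auto simp: apply_star l1_mono_def)

text \<open>The element 1 acts as an orthogonal projection, a proper one if the representation is
  not unital.\<close>

lemma rho_one_inner:
  assumes "u \<in> vecs H"
  shows "Re (vinner H (\<rho> l1_one u) u) \<le> (nrm u)\<^sup>2"
proof -
  have e: "vinner H (\<rho> l1_one u) u = of_real ((nrm (\<rho> l1_one u))\<^sup>2)"
    using rho_norm_sq[of l1_one u] assms by (simp add: star_one mul_one_left)
  have "(nrm (\<rho> l1_one u))\<^sup>2 = norm (vinner H (\<rho> l1_one u) u)" by (simp add: e norm_power)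
  also have "\<dots> \<le> nrm (\<rho> l1_one u) * nrm u" using assms by (intro cauchy_schwarz) auto
  finally have "nrm (\<rho> l1_one u) \<le> nrm u"
    using norm_nonneg[of "\<rho> l1_one u"] norm_nonneg[of u] assms
    by (cases "nrm (\<rho> l1_one u) = 0") (auto simp: power2_eq_square)
  then show ?thesis using e norm_nonneg[of "\<rho> l1_one u"] assms by (simp add: power_mono)
qed

text \<open>By \<open>l1_square_root\<close> the element 1 - b is the square of a self-adjoint
  element and thus acts as a positive operator.\<close>

lemma inner_rho_selfadjoint_lt1:
  assumes "b \<in> l1" "star b = b" "l1_norm b < 1" "u \<in> vecs H"
  shows "Re (vinner H (\<rho> b u) u) \<le> (nrm u)\<^sup>2"
proof -
  obtain y where y: "y \<in> l1" "star y = y" "mul (l1_sub l1_one y) (l1_sub l1_one y) = l1_sub l1_one b"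
    using l1_square_root[OF assms(1,2,3)] .
  have "star (l1_sub l1_one y) = l1_sub l1_one y"
    by (simp add: l1_sub_eq star_add star_scale star_one y)
  then have "vinner H (\<rho> (l1_sub l1_one b) u) u = of_real ((nrm (\<rho> (l1_sub l1_one y) u))\<^sup>2)"
    using rho_norm_sq[of "l1_sub l1_one y" u] y assms by simp
  then have "0 \<le> Re (vinner H (\<rho> (l1_sub l1_one b) u) u)" by simp
  then show ?thesis using inner_rho_sub[of l1_one b u u] assms rho_one_inner[of u] by simp
qed

text \<open>Continuity is automatic: \<open>inner_rho_selfadjoint_lt1\<close> applies to
  \<open>mul (star a) a\<close> divided by any number above the squared norm of
  \<open>a\<close>.\<close>

lemma norm_rho_le:
  assumes a: "a \<in> l1" and u: "u \<in> vecs H"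
  shows "nrm (\<rho> a u) \<le> l1_norm a * nrm u"
proof -
  let ?b = "mul (star a) a"
  have le: "(nrm (\<rho> a u))\<^sup>2 \<le> ((l1_norm a)\<^sup>2 + e) * (nrm u)\<^sup>2" if e: "0 < e" for e
  proof -
    \<comment> \<open>The summand \<open>e\<close> makes the quotient of \<open>?b\<close> by
      \<open>K\<close> have norm strictly below 1; it is removed afterwards by letting
      \<open>e\<close> tend to 0.\<close>
    define K where "K = (l1_norm a)\<^sup>2 + e"
    have K: "0 < K" using e by (simp add: K_def add_nonneg_pos)
    have "l1_norm ?b \<le> (l1_norm a)\<^sup>2"
      using l1_norm_mul[of "star a" a] a by (simp add: l1_norm_star power2_eq_square)
    then have bK: "l1_norm ?b < K" using e by (simp add: K_def)
    let ?c = "l1_scale (of_real (1 / K)) ?b"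
    have "l1_norm ?c \<le> norm (complex_of_real (1 / K)) * l1_norm ?b" using a by (intro l1_norm_scale) simp
    also have "\<dots> < 1" using bK K by (simp add: norm_divide field_simps)
    finally have "Re (vinner H (\<rho> ?c u) u) \<le> (nrm u)\<^sup>2"
      using a u by (intro inner_rho_selfadjoint_lt1) (simp_all add: star_scale star_mul star_star)
    moreover have "vinner H (\<rho> ?c u) u = of_real (1 / K) * of_real ((nrm (\<rho> a u))\<^sup>2)"
      using a u by (simp only: rho_scale inner_scale_left rho_norm_sq mul_in star_in rho_closed)
    ultimately have "(nrm (\<rho> a u))\<^sup>2 / K \<le> (nrm u)\<^sup>2" by (simp flip: of_real_mult of_real_divide of_real_power)
    then show ?thesis unfolding K_def[symmetric] using K by (simp add: field_simps)
  qed
  have "(nrm (\<rho> a u))\<^sup>2 \<le> (l1_norm a)\<^sup>2 * (nrm u)\<^sup>2 + e" if e: "0 < e" for e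
  proof (cases "nrm u = 0")
    case True
    then show ?thesis using le[of 1] e by simp
  next
    case False
    then have "0 < e / (nrm u)\<^sup>2" "e / (nrm u)\<^sup>2 * (nrm u)\<^sup>2 = e" using e by simp_all
    then show ?thesis using le[of "e / (nrm u)\<^sup>2"] by (simp only: distrib_right)
  qed
  then have "(nrm (\<rho> a u))\<^sup>2 \<le> (l1_norm a)\<^sup>2 * (nrm u)\<^sup>2" by (rule field_le_epsilon)
  then have "(nrm (\<rho> a u))\<^sup>2 \<le> (l1_norm a * nrm u)\<^sup>2" by (simp add: power_mult_distrib)
  then show ?thesis by (rule power2_le_imp_le) (simp add: norm_nonneg u)
qed

section \<open>The support of a representation\<close>

definition null_fn :: "('a \<Rightarrow>\<^sub>C complex) \<Rightarrow> bool" where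
  "null_fn f \<longleftrightarrow> (\<forall>u\<in>vecs H. \<rho> (fn f) u = vzero H)"

definition F :: "'a set" where
  "F = {x. \<forall>f. null_fn f \<longrightarrow> apply_bcontfun f x = 0}"

lemma fn_mult: "fn (cf_mult f g) = mul (fn f) (fn g)"
  by (simp add: mul_mono_mono)

lemma fn_add: "fn (f + g) = l1_add (fn f) (fn g)"
  by (auto simp: l1_mono_def l1_add_def)

lemma fn_diff: "fn (f - g) = l1_sub (fn f) (fn g)"
  by (auto simp: l1_mono_def l1_sub_def)

lemma fn_scale: "fn (cf_scale c f) = l1_scale c (fn f)"
  by (intro ext bcontfun_eqI) (auto simp: l1_mono_def l1_scale_def apply_scale)

lemma star_fn: "star (fn f) = fn (cf_cnj f)"
  by (simp add: star_mono)

lemma rho_zero_vec: "a \<in> l1 \<Longrightarrow> \<rho> a (vzero H) = vzero H"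
  using norm_rho_le[of a "vzero H"] norm_zero_iff zero_closed norm_nonneg[of "\<rho> a (vzero H)"]
  by (metis mult_zero_right order_antisym rho_closed)

lemma null_fn_mult: "null_fn f \<Longrightarrow> null_fn (cf_mult g f)"
  unfolding null_fn_def fn_mult by (simp add: rho_mul rho_zero_vec)

lemma null_fn_add: "\<lbrakk>null_fn f; null_fn g\<rbrakk> \<Longrightarrow> null_fn (f + g)"
  unfolding null_fn_def fn_add by (simp add: rho_add add_zero zero_closed)

lemma null_fn_zero: "null_fn 0"
proof -
  have z: "l1_mono 0 0 = (l1_zero :: int \<Rightarrow> ('a \<Rightarrow>\<^sub>C complex))" by (auto simp: l1_mono_def l1_zero_def)
  have "nrm (\<rho> l1_zero u) = 0" if "u \<in> vecs H" for u
    using norm_rho_le[of l1_zero u] that norm_nonneg[of "\<rho> l1_zero u"]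
    by (simp add: l1_norm_def l1_zero_def[unfolded fun_eq_iff] flip: l1_zero_def)
  then show ?thesis unfolding null_fn_def z using norm_zero_iff by simp
qed

lemma apply_sum_bcontfun:
  "apply_bcontfun (sum h B) x = (\<Sum>i\<in>B. apply_bcontfun (h i :: 'a \<Rightarrow>\<^sub>C complex) x)"
  by (induction B rule: infinite_finite_induct) auto

text \<open>The classical fact that a closed ideal of C(X) is determined by its zero set. On the
  compact set where |f| is at least \<open>e\<close>, finitely many null functions have no common
  zero, so the sum G of their squared moduli is bounded below there, and the null function f G / (G
  + d) approximates \<open>f\<close> uniformly.\<close>

lemma null_fn_vanishing:
  assumes f: "\<And>x. x \<in> F \<Longrightarrow> apply_bcontfun f x = 0"
  shows "null_fn f"
proof -
  have small: "nrm (\<rho> (fn f) u) \<le> 0 + e * nrm u" if e: "0 < e" and u: "u \<in> vecs H" for e u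
  proof -
    define K where "K = {x. e \<le> norm (apply_bcontfun f x)}"
    have "closed K"
      unfolding K_def by (intro closed_Collect_le continuous_intros) simp_all
    then have K: "compact K" using compact_X by (metis compact_Int_closed inf_top_left)
    have "K \<subseteq> (\<Union>h\<in>Collect null_fn. {x. apply_bcontfun h x \<noteq> 0})"
    proof
      fix x assume "x \<in> K"
      then have "x \<notin> F" using f e by (auto simp: K_def)
      then show "x \<in> (\<Union>h\<in>Collect null_fn. {x. apply_bcontfun h x \<noteq> 0})" by (auto simp: F_def)
    qed
    moreover have "open {x. apply_bcontfun h x \<noteq> 0}" for h :: "'a \<Rightarrow>\<^sub>C complex"
      by (intro open_Collect_neq continuous_intros) simp_all
    ultimately obtain B where B: "B \<subseteq> Collect null_fn" "finite B" "K \<subseteq> (\<Union>h\<in>B. {x. apply_bcontfun h x \<noteq> 0})"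
      using compactE_image[OF K, of "Collect null_fn" "\<lambda>h. {x. apply_bcontfun h x \<noteq> 0}"] by metis
    define G where "G = (\<Sum>h\<in>B. cf_mult (cf_cnj h) h)"
    define g where "g x = (\<Sum>h\<in>B. (norm (apply_bcontfun h x))\<^sup>2)" for x
    have Gg: "apply_bcontfun G x = of_real (g x)" for x
      by (simp add: G_def g_def apply_sum_bcontfun apply_cf_mult apply_cf_cnj complex_norm_square mult.commute
          del: of_real_power)
    have "null_fn (\<Sum>h\<in>B'. cf_mult (cf_cnj h) h)" if "B' \<subseteq> Collect null_fn" for B'
      using that by (induction B' rule: infinite_finite_induct) (auto intro: null_fn_zero null_fn_add null_fn_mult)
    then have nG: "null_fn G" using B by (simp add: G_def)
    have gc: "continuous_on UNIV g"
      unfolding g_def by (intro continuous_intros) simp_all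
    have g0: "0 \<le> g x" for x by (simp add: g_def sum_nonneg)
    have "\<exists>c>0. \<forall>x\<in>K. c \<le> g x"
    proof (cases "K = {}")
      case False
      then obtain x0 where x0: "x0 \<in> K" "\<forall>x\<in>K. g x0 \<le> g x"
        using continuous_attains_inf[OF K] gc continuous_on_subset by (metis subset_UNIV)
      then obtain h where "h \<in> B" "apply_bcontfun h x0 \<noteq> 0" using B(3) by auto
      then have "0 < (\<Sum>h\<in>B. (norm (apply_bcontfun h x0))\<^sup>2)"
        using B(2) by (intro sum_pos2[of B h]) auto
      then show ?thesis using x0 by (auto simp: g_def)
    qed (auto intro: exI[of _ 1])
    then obtain c where c: "0 < c" "\<And>x. x \<in> K \<Longrightarrow> c \<le> g x" by blast
    \<comment> \<open>On \<open>K\<close> the relative error d / (g + d) is at most d / c, and its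
      product with \<open>norm f\<close> must not exceed \<open>e\<close>; the summand 1 avoids
      dividing by 0.\<close>
    define d where "d = e * c / (norm f + 1)"
    have d: "0 < d" using e c by (simp add: d_def add_nonneg_pos)
    have gd: "0 < g x + d" for x using g0[of x] d by linarith
    define q :: "'a \<Rightarrow>\<^sub>C complex" where "q = Bcontfun (\<lambda>x. of_real (1 / (g x + d)))"
    have q: "apply_bcontfun q x = of_real (1 / (g x + d))" for x
      unfolding q_def using gc gd
      by (subst apply_Bcontfun[OF compact_X])
         (auto intro!: continuous_intros simp del: of_real_add simp flip: of_real_add, metis less_irrefl)
    let ?f' = "cf_mult (cf_mult f q) G"
    have "null_fn ?f'" by (rule null_fn_mult[OF nG])
    have bound: "norm (apply_bcontfun (f - ?f') x) \<le> e" for x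
    proof -
      have ne: "complex_of_real (g x) + complex_of_real d \<noteq> 0"
        using gd[of x] by (metis less_irrefl of_real_add of_real_eq_0_iff)
      have "apply_bcontfun (f - ?f') x = apply_bcontfun f x * of_real (d / (g x + d))"
        using ne by (simp add: apply_cf_mult q Gg field_simps)
      then have eq: "norm (apply_bcontfun (f - ?f') x) = norm (apply_bcontfun f x) * (d / (g x + d))"
        using gd[of x] d by (simp add: norm_mult norm_divide flip: of_real_add)
      show ?thesis
      proof (cases "x \<in> K")
        case True
        have "norm (apply_bcontfun f x) * (d / (g x + d)) \<le> norm f * (d / c)"
          using c(2)[OF True] c(1) d by (intro mult_mono norm_bounded divide_left_mono) auto
        also have "\<dots> = e * (norm f / (norm f + 1))" using c(1) by (simp add: d_def)
        also have "\<dots> \<le> e * 1"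
          using e by (intro mult_left_mono) (simp_all add: divide_le_eq_1 add_nonneg_pos)
        finally show ?thesis using eq by simp
      next
        case False
        have "norm (apply_bcontfun f x) * (d / (g x + d)) \<le> e * 1"
          using False g0[of x] d e by (intro mult_mono) (auto simp: K_def)
        then show ?thesis using eq by simp
      qed
    qed
    have "f = (f - ?f') + ?f'" by simp
    then have "\<rho> (fn f) u = vadd H (\<rho> (fn (f - ?f')) u) (\<rho> (fn ?f') u)"
      using u by (metis fn_add l1_mono_in rho_add)
    then have "\<rho> (fn f) u = \<rho> (fn (f - ?f')) u"
      using \<open>null_fn ?f'\<close> u by (simp add: null_fn_def add_zero)
    then have "nrm (\<rho> (fn f) u) \<le> norm (f - ?f') * nrm u"
      using norm_rho_le[of "fn (f - ?f')" u] u by simp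
    also have "\<dots> \<le> e * nrm u"
      using bound norm_nonneg[OF u] by (intro mult_right_mono norm_bound) auto
    finally show ?thesis by simp
  qed
  have "nrm (\<rho> (fn f) u) = 0" if u: "u \<in> vecs H" for u
  proof -
    have "nrm (\<rho> (fn f) u) \<le> 0 + e" if e: "0 < e" for e
    proof (cases "nrm u = 0")
      case True
      then show ?thesis using small[of 1 u] u e by simp
    next
      case False
      then show ?thesis using small[of "e / nrm u" u] u e norm_nonneg[OF u] by simp
    qed
    then have "nrm (\<rho> (fn f) u) \<le> 0" by (rule field_le_epsilon)
    then show ?thesis using norm_nonneg[of "\<rho> (fn f) u"] u by simp
  qed
  then show ?thesis unfolding null_fn_def using norm_zero_iff by simp
qed

section \<open>Comparing operators of functions through values on the support\<close>

lemma rho_fn_cong: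
  assumes "\<And>x. x \<in> F \<Longrightarrow> apply_bcontfun f x = apply_bcontfun g x" "u \<in> vecs H"
  shows "\<rho> (fn f) u = \<rho> (fn g) u"
proof -
  have n: "null_fn (f - g)" by (rule null_fn_vanishing) (simp add: assms)
  have "fn f = l1_add (fn (f - g)) (fn g)" by (simp flip: fn_add)
  then have "\<rho> (fn f) u = vadd H (\<rho> (fn (f - g)) u) (\<rho> (fn g) u)" using assms by (simp add: rho_add)
  also have "\<dots> = \<rho> (fn g) u"
    using n assms add_commute[OF zero_closed, of "\<rho> (fn g) u"] by (simp add: null_fn_def add_zero)
  finally show ?thesis .
qed

lemma inner_fn_nonneg:
  assumes h: "\<And>x. x \<in> F \<Longrightarrow> apply_bcontfun f x = of_real (h x) \<and> 0 \<le> h x" and u: "u \<in> vecs H"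
  shows "0 \<le> Re (vinner H (\<rho> (fn f) u) u)"
proof -
  \<comment> \<open>Cutting off at 0 gives a root that is continuous everywhere, although
    nonnegativity is known only on \<open>F\<close>.\<close>
  define s :: "'a \<Rightarrow>\<^sub>C complex" where "s = Bcontfun (\<lambda>x. of_real (sqrt (max 0 (Re (apply_bcontfun f x)))))"
  have s: "apply_bcontfun s x = of_real (sqrt (max 0 (Re (apply_bcontfun f x))))" for x
    unfolding s_def by (subst apply_Bcontfun[OF compact_X]) (auto intro!: continuous_intros)
  have "\<rho> (fn f) u = \<rho> (fn (cf_mult s s)) u"
    by (rule rho_fn_cong[OF _ u]) (use h in \<open>auto simp: apply_cf_mult s simp flip: of_real_mult\<close>)
  also have "fn (cf_mult s s) = mul (star (fn s)) (fn s)"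
  proof -
    have "cf_cnj s = s" by (rule bcontfun_eqI) (simp add: apply_cf_cnj s)
    then show ?thesis by (simp add: fn_mult star_fn)
  qed
  finally have "vinner H (\<rho> (fn f) u) u = of_real ((nrm (\<rho> (fn s) u))\<^sup>2)"
    using rho_norm_sq[of "fn s" u] u by simp
  then show ?thesis by simp
qed

text \<open>The difference of the squared moduli is nonnegative on \<open>F\<close>, so
  \<open>inner_fn_nonneg\<close> compares the squared norms.\<close>

lemma norm_fn_mono:
  assumes le: "\<And>x. x \<in> F \<Longrightarrow> norm (apply_bcontfun f x) \<le> norm (apply_bcontfun g x)" and u: "u \<in> vecs H"
  shows "nrm (\<rho> (fn f) u) \<le> nrm (\<rho> (fn g) u)"
proof -
  let ?d = "cf_mult (cf_cnj g) g - cf_mult (cf_cnj f) f"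
  have "0 \<le> Re (vinner H (\<rho> (fn ?d) u) u)"
  proof (rule inner_fn_nonneg[OF _ u])
    fix x assume "x \<in> F"
    then show "apply_bcontfun ?d x = of_real ((norm (apply_bcontfun g x))\<^sup>2 - (norm (apply_bcontfun f x))\<^sup>2) \<and>
        0 \<le> (norm (apply_bcontfun g x))\<^sup>2 - (norm (apply_bcontfun f x))\<^sup>2"
      using le[of x] by (auto simp: apply_cf_mult apply_cf_cnj complex_norm_square mult.commute power_mono
          simp del: of_real_power)
  qed
  moreover have "vinner H (\<rho> (fn ?d) u) u = of_real ((nrm (\<rho> (fn g) u))\<^sup>2) - of_real ((nrm (\<rho> (fn f) u))\<^sup>2)"
    using u rho_norm_sq[of "fn g" u] rho_norm_sq[of "fn f" u]
    by (simp only: fn_diff inner_rho_sub l1_mono_in fn_mult star_fn[symmetric] mul_in star_in)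
  ultimately have "(nrm (\<rho> (fn f) u))\<^sup>2 \<le> (nrm (\<rho> (fn g) u))\<^sup>2" by simp
  then show ?thesis by (rule power2_le_imp_le) (simp add: norm_nonneg u)
qed

lemma norm_fn_const:
  assumes "0 \<le> t" "u \<in> vecs H"
  shows "nrm (\<rho> (fn (cf_scale (of_real t) f)) u) = t * nrm (\<rho> (fn f) u)"
  using assms by (simp add: fn_scale rho_scale norm_scale)

text \<open>A bump function \<open>h\<close> at a point of \<open>F\<close> is not null, so some
  vector \<open>\<rho> (fn h) w\<close> is nonzero. It is concentrated where |g| exceeds
  \<open>K'\<close>, and there the operator of \<open>g\<close> stretches by at least
  \<open>K'\<close>.\<close>

lemma support_norm_bound:
  assumes y: "y \<in> F" and K: "\<And>u. u \<in> vecs H \<Longrightarrow> nrm (\<rho> (fn g) u) \<le> K * nrm u"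
  shows "norm (apply_bcontfun g y) \<le> K"
proof (rule ccontr)
  assume "\<not> ?thesis"
  then obtain K' where K': "K < K'" "K' < norm (apply_bcontfun g y)" using dense by (metis not_le)
  define V where "V = {x. max 0 K' < norm (apply_bcontfun g x)}"
  show False
  proof (cases "\<exists>u\<in>vecs H. nrm u \<noteq> 0")
    \<comment> \<open>If all vectors have norm 0, the constant 1 is null and \<open>F\<close> is
      empty. In the other case a vector of nonzero norm shows that \<open>K\<close> is
      nonnegative.\<close>
    case False
    then have "null_fn (const_bcontfun 1)" unfolding null_fn_def using norm_zero_iff
      by (metis l1_mono_in rho_closed)
    then show False using y by (force simp: F_def)
  next
    case True
    then obtain u0 where u0: "u0 \<in> vecs H" "nrm u0 \<noteq> 0" by blast
    have "0 \<le> K * nrm u0" using K[OF u0(1)] norm_nonneg[of "\<rho> (fn g) u0"] u0 by simp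
    then have K0: "0 \<le> K" using u0 norm_nonneg[of u0] by (metis less_eq_real_def linorder_not_le mult_neg_pos)
    have "open V" unfolding V_def by (intro open_Collect_less continuous_intros) simp_all
    moreover have "y \<in> V" using K' K0 by (auto simp: V_def)
    ultimately obtain h :: "'a \<Rightarrow>\<^sub>C complex" and h' where
      h: "\<And>y. apply_bcontfun h y = of_real (h' y)" "\<And>y. 0 \<le> h' y" "\<And>y. h' y \<le> 1"
      "h' y = 1" "\<And>y. y \<notin> V \<Longrightarrow> h' y = 0"
      by (rule urysohn_point[OF compact_X]) (rule that)
    have "\<not> null_fn h" using y h(1,4) by (force simp: F_def)
    then obtain w where w: "w \<in> vecs H" "\<rho> (fn h) w \<noteq> vzero H" by (auto simp: null_fn_def)
    let ?u = "\<rho> (fn h) w"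
    have u: "?u \<in> vecs H" "0 < nrm ?u"
      using w norm_zero_iff[of ?u] norm_nonneg[of ?u] by auto
    have "K' * nrm ?u = nrm (\<rho> (fn (cf_scale (of_real K') h)) w)"
      using norm_fn_const[of K' w h] K' K0 w by simp
    also have "\<dots> \<le> nrm (\<rho> (fn (cf_mult g h)) w)"
    proof (rule norm_fn_mono[OF _ w(1)])
      fix x
      show "norm (apply_bcontfun (cf_scale (of_real K') h) x) \<le> norm (apply_bcontfun (cf_mult g h) x)"
        using K' K0 h(2)[of x] h(5)[of x]
        by (cases "x \<in> V") (auto simp: apply_scale apply_cf_mult norm_mult h(1) V_def intro!: mult_right_mono)
    qed
    also have "\<dots> = nrm (\<rho> (fn g) ?u)" using w by (simp add: fn_mult rho_mul)
    also have "\<dots> \<le> K * nrm ?u" by (rule K[OF u(1)])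
    finally show False using u(2) K' by simp
  qed
qed

text \<open>Conjugation by powers of \<delta> preserves null functions and translates them along the
  action.\<close>

lemma support_invariant:
  assumes "x \<in> F"
  shows "it k x \<in> F"
  unfolding F_def
proof (intro CollectI allI impI)
  fix f assume f: "null_fn f"
  have "fn (al (- k) f) = mul (dl (- k)) (mul (fn f) (dl k))"
    unfolding mul_mono_mono by (simp, rule arg_cong2[where f = l1_mono], rule bcontfun_eqI) (simp_all add: apply_cf_mult)
  then have "null_fn (al (- k) f)"
    using f unfolding null_fn_def by (simp add: rho_mul rho_zero_vec)
  then have "apply_bcontfun (al (- k) f) x = 0" using assms unfolding F_def by blast
  then show "apply_bcontfun f (it k x) = 0" by simp
qed

lemma norm_delta: "u \<in> vecs H \<Longrightarrow> nrm (\<rho> (dl n) u) \<le> nrm u"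
  using norm_rho_le[of "dl n" u] norm_const_le[where ?'a = 'a, of 1] norm_nonneg[of u]
    mult_right_mono[of "norm (const_bcontfun 1 :: 'a \<Rightarrow>\<^sub>C complex)" 1 "nrm u"] by simp

text \<open>Together these express the covariance relation \<delta>^n f = \<alpha>^n(f)
  \<delta>^n.\<close>

lemma mono_split: "l1_mono f n = mul (fn f) (dl n)" "l1_mono (al n f) n = mul (dl n) (fn f)"
  unfolding mul_mono_mono by (intro ext bcontfun_eqI; simp add: l1_mono_def apply_cf_mult)+

text \<open>On \<open>F\<close> the function agrees with its translate, so its operator commutes
  with that of \<delta>^n.\<close>

lemma norm_invariant_fn:
  assumes f: "\<And>y. y \<in> F \<Longrightarrow> apply_bcontfun f (it (- n) y) = apply_bcontfun f y" and w: "w \<in> vecs H"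
  shows "nrm (\<rho> (fn f) (\<rho> (dl n) w)) \<le> nrm (\<rho> (fn f) w)"
proof -
  have "\<rho> (fn f) (\<rho> (dl n) w) = \<rho> (fn (al n f)) (\<rho> (dl n) w)"
    by (rule rho_fn_cong) (use f w in auto)
  also have "\<dots> = \<rho> (dl n) (\<rho> (fn f) w)"
    using w mono_split(1)[of "al n f" n] mono_split(2)[of n f] by (simp flip: rho_mul)
  finally show ?thesis using norm_delta[of "\<rho> (fn f) w" n] w by simp
qed

lemma cut_insert: "n \<notin> A \<Longrightarrow> l1_cut (insert n A) c = l1_add (l1_cut A c) (l1_mono (c n) n)"
  by (auto simp: l1_cut_def l1_add_def l1_mono_def)

text \<open>The norm of \<open>\<rho> (fn f) w\<close> on the right keeps track of where
  \<open>f\<close> lives; a bound by the norm of \<open>w\<close> could not be summed over a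
  partition of unity. Monomials are treated one by one, the invariance of \<open>f\<close> carrying
  it past \<delta>^n.\<close>

lemma norm_rho_dominated:
  assumes c: "c \<in> l1" and t: "t summable_on UNIV" "\<And>n. 0 \<le> t n" and w: "w \<in> vecs H"
    and f: "\<And>y n. y \<in> F \<Longrightarrow> apply_bcontfun f (it n y) = apply_bcontfun f y"
    and le: "\<And>y n. y \<in> F \<Longrightarrow> norm (apply_bcontfun (c n) y) \<le> t n * norm (apply_bcontfun f y)"
  shows "nrm (\<rho> c w) \<le> infsum t UNIV * nrm (\<rho> (fn f) w)"
proof (rule field_le_epsilon)
  let ?R = "nrm (\<rho> (fn f) w)"
  have R: "0 \<le> ?R" using w norm_nonneg by simp
  have one: "nrm (\<rho> (l1_mono (c n) n) w) \<le> t n * ?R" for n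
  proof -
    have "nrm (\<rho> (l1_mono (c n) n) w) = nrm (\<rho> (fn (c n)) (\<rho> (dl n) w))"
      using w by (subst mono_split(1)) (simp add: rho_mul)
    also have "\<dots> \<le> nrm (\<rho> (fn (cf_scale (of_real (t n)) f)) (\<rho> (dl n) w))"
      by (rule norm_fn_mono) (use le w t in \<open>auto simp: apply_scale norm_mult\<close>)
    also have "\<dots> = t n * nrm (\<rho> (fn f) (\<rho> (dl n) w))" using t w by (intro norm_fn_const) auto
    also have "\<dots> \<le> t n * ?R" using f w t by (intro mult_left_mono norm_invariant_fn) auto
    finally show ?thesis .
  qed
  have fin: "nrm (\<rho> (l1_cut A c) w) \<le> sum t A * ?R" if "finite A" for A
    using that
  proof (induction A rule: finite_induct)
    case empty
    have "l1_cut {} c = fn 0" by (auto simp: l1_cut_def l1_mono_def)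
    then show ?case using null_fn_zero w norm_zero_iff[OF zero_closed] by (simp add: null_fn_def)
  next
    case (insert n A)
    have "nrm (\<rho> (l1_cut (insert n A) c) w) \<le> nrm (\<rho> (l1_cut A c) w) + nrm (\<rho> (l1_mono (c n) n) w)"
      unfolding cut_insert[OF insert(2)] using c w by (intro norm_rho_add) auto
    also have "\<dots> \<le> sum t A * ?R + t n * ?R" using insert one by (intro add_mono) auto
    finally show ?case using insert by (simp add: algebra_simps)
  qed
  fix e :: real assume e: "0 < e"
  \<comment> \<open>The summand 1 covers the case that \<open>w\<close> has norm 0; the tail then
    contributes at most \<open>e\<close>.\<close>
  have "0 < e / (nrm w + 1)" using e norm_nonneg[OF w] by (simp add: add_nonneg_pos)
  then obtain N where N: "l1_norm (l1_cut (- {- int N..int N}) c) < e / (nrm w + 1)"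
    using l1_tail_small[OF c] by blast
  let ?A = "{- int N..int N}"
  have "c = l1_add (l1_cut ?A c) (l1_cut (- ?A) c)" by (auto simp: l1_cut_def l1_add_def)
  then have "nrm (\<rho> c w) \<le> nrm (\<rho> (l1_cut ?A c) w) + nrm (\<rho> (l1_cut (- ?A) c) w)"
    using norm_rho_add[of "l1_cut ?A c" "l1_cut (- ?A) c" w] c w by simp
  also have "nrm (\<rho> (l1_cut ?A c) w) \<le> infsum t UNIV * ?R"
  proof -
    have "sum t ?A \<le> infsum t UNIV" by (rule finite_sum_le_infsum[OF t(1)]) (use t in auto)
    from mult_right_mono[OF this R] fin[of ?A] show ?thesis by simp
  qed
  also have "nrm (\<rho> (l1_cut (- ?A) c) w) \<le> l1_norm (l1_cut (- ?A) c) * nrm w"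
    using c w by (intro norm_rho_le) auto
  also have "\<dots> \<le> e / (nrm w + 1) * nrm w" using N norm_nonneg[OF w] by (intro mult_right_mono) auto
  also have "\<dots> \<le> e" using e norm_nonneg[OF w] by (simp add: field_simps)
  finally show "nrm (\<rho> c w) \<le> infsum t UNIV * ?R + e" by simp
qed

end

section \<open>Averages over roots of unity\<close>

definition unit_root :: "nat \<Rightarrow> nat \<Rightarrow> complex" where
  "unit_root M r = cis (2 * pi * real r / real M)"

lemma norm_unit_root [simp]: "norm (unit_root M r) = 1"
  by (simp add: unit_root_def)

lemma sum_unit_root_powi:
  assumes M: "0 < M"
  shows "(\<Sum>r<M. unit_root M r powi n) = (if int M dvd n then of_nat M else 0)"
proof -
  define z where "z = cis (2 * pi * of_int n / real M)"
  have p: "unit_root M r powi n = z ^ r" for r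
    by (simp add: unit_root_def z_def cis_power_int Complex.DeMoivre mult_ac)
  have zM: "z ^ M = 1"
  proof -
    have "z ^ M = cis (2 * pi * of_int n)" using M by (simp add: z_def Complex.DeMoivre)
    then show ?thesis by (simp add: cis_multiple_2pi)
  qed
  have z1: "z = 1 \<longleftrightarrow> int M dvd n"
  proof
    assume "z = 1"
    then have "exp (\<i> * of_real (2 * pi * of_int n / real M)) = 1" by (simp add: z_def cis_conv_exp)
    then obtain k :: int where "2 * pi * of_int n / real M = of_int (2 * k) * pi"
      unfolding exp_eq_1 by auto
    then have "real_of_int n = of_int k * real M" using M by (simp add: field_simps)
    then have "n = k * int M" by (metis of_int_eq_iff of_int_mult of_int_of_nat_eq)
    then show "int M dvd n" by simp
  next
    assume "int M dvd n"
    then obtain k where "n = int M * k" by (rule dvdE)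
    then have "2 * pi * of_int n / real M = 2 * pi * of_int k" using M by simp
    then show "z = 1" by (simp add: z_def cis_multiple_2pi)
  qed
  show ?thesis
  proof (cases "z = 1")
    case True
    then show ?thesis using z1 p by simp
  next
    case False
    then show ?thesis using z1 p zM by (simp add: geometric_sum)
  qed
qed

lemma has_sum_finite_sum:
  fixes f :: "'r \<Rightarrow> 'i \<Rightarrow> complex"
  assumes "finite R" "\<And>r. r \<in> R \<Longrightarrow> (f r has_sum s r) A"
  shows "((\<lambda>i. \<Sum>r\<in>R. f r i) has_sum (\<Sum>r\<in>R. s r)) A"
  using assms by (induction R rule: finite_induct) (auto intro!: has_sum_add)

text \<open>Averaging over the M-th roots of unity keeps only the coefficients whose index is
  congruent to \<open>m\<close> modulo M.\<close>

lemma fourier_unique: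
  assumes a: "a \<in> l1" and c: "\<And>n. norm (c n) \<le> norm (a n :: 'a::topological_space \<Rightarrow>\<^sub>C complex)"
    and zero: "\<And>\<mu>. norm \<mu> = 1 \<Longrightarrow> (\<Sum>\<^sub>\<infinity>n. \<mu> powi n * c n) = (0 :: complex)"
  shows "c m = 0"
proof -
  have "norm (c m) \<le> 0 + e" if e: "0 < e" for e
  proof -
    obtain N where N: "l1_norm (l1_cut (- {- int N..int N}) a) < e"
      using l1_tail_small[OF a e] by blast
    \<comment> \<open>With this size every index congruent to \<open>m\<close> other than
      \<open>m\<close> itself has absolute value above \<open>N\<close>.\<close>
    define M where "M = Suc (N + nat \<bar>m\<bar>)"
    have as: "(\<lambda>n. norm (a n)) summable_on UNIV" using a by (simp add: l1_iff)
    have hs: "((\<lambda>n. unit_root M r powi (n - m) * c n) has_sum 0) UNIV" for r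
    proof -
      have nz: "unit_root M r \<noteq> 0" using norm_unit_root[of M r] by (metis norm_zero zero_neq_one)
      have "(\<lambda>n. unit_root M r powi n * c n) summable_on UNIV"
        by (rule abs_summable_summable, rule summable_on_comparison_test[OF as])
           (auto simp: norm_mult norm_power_int c)
      then have "((\<lambda>n. unit_root M r powi n * c n) has_sum 0) UNIV"
        using zero[of "unit_root M r"] has_sum_infsum by fastforce
      then have "((\<lambda>n. unit_root M r powi (- m) * (unit_root M r powi n * c n)) has_sum (unit_root M r powi (- m) * 0)) UNIV"
        by (rule has_sum_cmult_right)
      then show ?thesis using nz by (simp add: power_int_diff power_int_minus field_simps)
    qed
    have "((\<lambda>n. \<Sum>r<M. unit_root M r powi (n - m) * c n) has_sum (\<Sum>r<M. 0)) UNIV"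
      by (rule has_sum_finite_sum) (use hs in auto)
    moreover have M: "0 < M" by (simp add: M_def)
    have "(\<Sum>r<M. unit_root M r powi (n - m) * c n) = (if int M dvd n - m then of_nat M * c n else 0)" for n
      by (simp add: sum_distrib_right[symmetric] sum_unit_root_powi[OF M])
    ultimately have "((\<lambda>n. if int M dvd n - m then of_nat M * c n else 0) has_sum 0) UNIV"
      by simp
    then have "((\<lambda>n. (1 / of_nat M) * (if int M dvd n - m then of_nat M * c n else 0)) has_sum ((1 / of_nat M) * 0)) UNIV"
      by (rule has_sum_cmult_right)
    moreover have "(1 / of_nat M) * (if int M dvd n - m then of_nat M * c n else 0) = (if int M dvd n - m then c n else 0)" for n
      using M by simp
    ultimately have h0: "((\<lambda>n. if int M dvd n - m then c n else 0) has_sum 0) UNIV" by simp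
    have "((\<lambda>n. if n = m then - c m else 0) has_sum (- c m)) UNIV"
      by (rule has_sum_finite_neutralI[of "{m}"]) auto
    from has_sum_add[OF h0 this]
    have h1: "((\<lambda>n. (if int M dvd n - m then c n else 0) + (if n = m then - c m else 0)) has_sum (- c m)) UNIV" by simp
    have "norm (- c m) \<le> l1_norm (l1_cut (- {- int N..int N}) a)"
      unfolding l1_norm_def
    proof (rule norm_infsum_le[OF h1 has_sum_infsum])
      show "(\<lambda>n. norm (l1_cut (- {- int N..int N}) a n)) summable_on UNIV"
        using l1_cut_in[OF a] by (simp add: l1_iff)
      fix n
      show "norm ((if int M dvd n - m then c n else 0) + (if n = m then - c m else 0)) \<le>
          norm (l1_cut (- {- int N..int N}) a n)"
      proof (cases "n \<noteq> m \<and> int M dvd n - m")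
        case True
        then have "int M \<le> \<bar>n - m\<bar>" using dvd_imp_le_int[of "n - m" "int M"] by simp
        then have "n \<notin> {- int N..int N}" unfolding M_def by auto
        then show ?thesis using True c[of n] by (simp add: l1_cut_def)
      qed auto
    qed
    then show ?thesis using N by simp
  qed
  then have "norm (c m) \<le> 0" by (rule field_le_epsilon)
  then show ?thesis by simp
qed

section \<open>Positive definite sequences\<close>

text \<open>The quadratic form of the Toeplitz kernel \<phi>(k - l). For \<phi>(n) =
  <\<rho>(\<delta>^n) u, u> it is the squared norm of the sum of the c_k \<rho>(\<delta>^k) u, see
  \<open>norm_sp\<close>.\<close>

definition pd_form :: "(int \<Rightarrow> complex) \<Rightarrow> int set \<Rightarrow> (int \<Rightarrow> complex) \<Rightarrow> complex" where
  "pd_form \<phi> A c = (\<Sum>k\<in>A. \<Sum>l\<in>A. c k * cnj (c l) * \<phi> (k - l))"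

lemma cnj_unit_powi: "norm z = 1 \<Longrightarrow> cnj (z powi k) = z powi (- k)"
proof -
  assume "norm z = 1"
  then have "cnj z = inverse z"
    by (metis complex_norm_square div_by_1 divide_inverse inverse_unique of_real_1 power_one)
  then show ?thesis by (simp add: power_int_minus power_int_inverse)
qed

text \<open>Divided by \<open>N\<close> this count is the Fejer factor 1 - |n| / N.\<close>

lemma card_differences:
  assumes "\<bar>n\<bar> \<le> int N"
  shows "card {(i, j) \<in> {0..<int N} \<times> {0..<int N}. i - j = n} = nat (int N - \<bar>n\<bar>)"
proof -
  have "{(i, j) \<in> {0..<int N} \<times> {0..<int N}. i - j = n} = (\<lambda>i. (i, i - n)) ` {max 0 n..<min (int N) (int N + n)}"
    by (auto simp: image_iff)
  moreover have "inj_on (\<lambda>i. (i, i - n)) X" for X by (auto simp: inj_on_def)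
  ultimately have "card {(i, j) \<in> {0..<int N} \<times> {0..<int N}. i - j = n} = card {max 0 n..<min (int N) (int N + n)}"
    by (simp add: card_image)
  also have "\<dots> = nat (int N - \<bar>n\<bar>)" using assms by auto
  finally show ?thesis .
qed

text \<open>Averaging against the positive weights \<open>R\<close> turns pointwise inequalities between trigonometric
  polynomials into inequalities between the forms, up to the Fejer factors.\<close>

lemma fejer_average:
  fixes L N :: nat and c \<phi> :: "int \<Rightarrow> complex"
  assumes N: "2 * L \<le> N"
  defines "M \<equiv> N + 2 * L + 1" and "A \<equiv> {- int L..int L}"
  defines "R \<equiv> \<lambda>z. pd_form \<phi> {0..<int N} (\<lambda>i. z powi (- i))"
  shows "(\<Sum>r<M. of_real ((norm (\<Sum>k\<in>A. c k * unit_root M r powi k))\<^sup>2) * R (unit_root M r)) =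
    of_nat M * (\<Sum>k\<in>A. \<Sum>l\<in>A. c k * cnj (c l) * (of_int (int N - \<bar>k - l\<bar>) * \<phi> (k - l)))"
proof -
  let ?I = "{0..<int N}"
  let ?w = "\<lambda>r. unit_root M r"
  have M: "0 < M" by (simp add: M_def)
  have w0: "?w r \<noteq> 0" for r using norm_unit_root[of M r] by (metis norm_zero zero_neq_one)
  have c2: "of_real ((norm (\<Sum>k\<in>A. c k * ?w r powi k))\<^sup>2) = (\<Sum>(k, l)\<in>A \<times> A. c k * cnj (c l) * ?w r powi (k - l))" for r
  proof -
    have "of_real ((norm (\<Sum>k\<in>A. c k * ?w r powi k))\<^sup>2) =
        (\<Sum>k\<in>A. c k * ?w r powi k) * (\<Sum>l\<in>A. cnj (c l) * ?w r powi (- l))"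
      by (simp only: complex_norm_square cnj_sum complex_cnj_mult cnj_unit_powi[OF norm_unit_root])
    also have "\<dots> = (\<Sum>(k, l)\<in>A \<times> A. (c k * ?w r powi k) * (cnj (c l) * ?w r powi (- l)))"
      by (simp add: sum_product sum.cartesian_product)
    also have "\<dots> = (\<Sum>(k, l)\<in>A \<times> A. c k * cnj (c l) * ?w r powi (k - l))"
      using w0[of r] by (intro sum.cong) (auto simp: power_int_diff power_int_minus divide_inverse)
    finally show ?thesis .
  qed
  have R2: "R (?w r) = (\<Sum>(i, j)\<in>?I \<times> ?I. ?w r powi (- (i - j)) * \<phi> (i - j))" for r
  proof -
    have "R (?w r) = (\<Sum>(i, j)\<in>?I \<times> ?I. ?w r powi (- i) * ?w r powi j * \<phi> (i - j))"
      unfolding R_def pd_form_def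
      by (simp only: sum.cartesian_product cnj_unit_powi[OF norm_unit_root] minus_minus)
    also have "\<dots> = (\<Sum>(i, j)\<in>?I \<times> ?I. ?w r powi (- (i - j)) * \<phi> (i - j))"
      using w0[of r] by (intro sum.cong) (auto simp: power_int_diff power_int_minus divide_inverse)
    finally show ?thesis .
  qed
  have "(\<Sum>r<M. of_real ((norm (\<Sum>k\<in>A. c k * ?w r powi k))\<^sup>2) * R (?w r)) =
      (\<Sum>r<M. \<Sum>p\<in>A \<times> A. \<Sum>q\<in>?I \<times> ?I. c (fst p) * cnj (c (snd p)) * \<phi> (fst q - snd q) *
         ?w r powi ((fst p - snd p) - (fst q - snd q)))"
    unfolding c2 R2 sum_product case_prod_unfold
  proof (intro sum.cong refl)
    fix r p q
    have "?w r powi ((fst p - snd p) - (fst q - snd q)) = ?w r powi (fst p - snd p) * ?w r powi (- (fst q - snd q))"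
      using w0[of r] by (simp only: diff_conv_add_uminus[of "fst p - snd p" "fst q - snd q"] power_int_add simp_thms)
    then show "c (fst p) * cnj (c (snd p)) * ?w r powi (fst p - snd p) * (?w r powi (- (fst q - snd q)) * \<phi> (fst q - snd q)) =
        c (fst p) * cnj (c (snd p)) * \<phi> (fst q - snd q) * ?w r powi ((fst p - snd p) - (fst q - snd q))"
      by (simp only: mult_ac)
  qed
  also have "\<dots> = (\<Sum>p\<in>A \<times> A. \<Sum>q\<in>?I \<times> ?I. \<Sum>r<M. c (fst p) * cnj (c (snd p)) * \<phi> (fst q - snd q) *
         ?w r powi ((fst p - snd p) - (fst q - snd q)))"
    by (subst sum.swap, rule sum.cong[OF refl], rule sum.swap)
  also have "\<dots> = (\<Sum>p\<in>A \<times> A. of_nat M * (c (fst p) * cnj (c (snd p)) *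
      (of_int (int N - \<bar>fst p - snd p\<bar>) * \<phi> (fst p - snd p))))"
  proof (rule sum.cong[OF refl])
    fix p assume p: "p \<in> A \<times> A"
    let ?n = "fst p - snd p"
    have n: "\<bar>?n\<bar> \<le> 2 * int L" using p by (auto simp: A_def)
    \<comment> \<open>\<open>M\<close> exceeds the sum of the largest possible values 2 L and N - 1
      of the two differences, so congruence modulo \<open>M\<close> is equality.\<close>
    have dvd: "int M dvd ?n - (fst q - snd q) \<longleftrightarrow> fst q - snd q = ?n" if "q \<in> ?I \<times> ?I" for q
    proof
      assume d: "int M dvd ?n - (fst q - snd q)"
      have "\<bar>?n - (fst q - snd q)\<bar> < int M" using n that by (auto simp: M_def)
      then have "?n - (fst q - snd q) = 0" using d zdvd_imp_le[of "int M" "\<bar>?n - (fst q - snd q)\<bar>"] by fastforce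
      then show "fst q - snd q = ?n" by simp
    qed simp
    have "(\<Sum>q\<in>?I \<times> ?I. \<Sum>r<M. c (fst p) * cnj (c (snd p)) * \<phi> (fst q - snd q) * ?w r powi (?n - (fst q - snd q)))
      = (\<Sum>q\<in>?I \<times> ?I. if fst q - snd q = ?n then c (fst p) * cnj (c (snd p)) * \<phi> ?n * of_nat M else 0)"
      by (intro sum.cong refl) (auto simp: sum_distrib_left[symmetric] sum_unit_root_powi[OF M] dvd)
    also have "\<dots> = of_nat (card {q \<in> ?I \<times> ?I. fst q - snd q = ?n}) * (c (fst p) * cnj (c (snd p)) * \<phi> ?n * of_nat M)"
      by (simp add: sum.If_cases Int_def)
    also have "{q \<in> ?I \<times> ?I. fst q - snd q = ?n} = {(i, j) \<in> ?I \<times> ?I. i - j = ?n}" by auto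
    also have "card \<dots> = nat (int N - \<bar>?n\<bar>)" using n N by (intro card_differences) auto
    also have "of_nat (nat (int N - \<bar>?n\<bar>)) = (of_int (int N - \<bar>?n\<bar>) :: complex)"
      using n N by (simp add: of_nat_nat)
    finally show "(\<Sum>q\<in>?I \<times> ?I. \<Sum>r<M. c (fst p) * cnj (c (snd p)) * \<phi> (fst q - snd q) * ?w r powi (?n - (fst q - snd q)))
      = of_nat M * (c (fst p) * cnj (c (snd p)) * (of_int (int N - \<bar>?n\<bar>) * \<phi> ?n))"
      by (simp add: mult_ac)
  qed
  also have "\<dots> = of_nat M * (\<Sum>k\<in>A. \<Sum>l\<in>A. c k * cnj (c l) * (of_int (int N - \<bar>k - l\<bar>) * \<phi> (k - l)))"
    by (simp add: sum_distrib_left sum.cartesian_product case_prod_unfold)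
  finally show ?thesis .
qed

text \<open>The hypothesis is multiplied by the nonnegative weights \<open>R\<close> and summed over
  roots of unity. After division by M N the forms carry the factors 1 - |k - l| / N, which tend to
  1. This takes the place of integrating against the spectral measure of a unitary.\<close>

lemma pd_form_inequality:
  fixes L :: nat and \<alpha> \<phi> :: "int \<Rightarrow> complex" and \<beta> :: "'b \<Rightarrow> int \<Rightarrow> complex"
  assumes pd: "\<And>A c. finite A \<Longrightarrow> 0 \<le> Re (pd_form \<phi> A c)"
    and le: "\<And>z. norm z = 1 \<Longrightarrow> (norm (\<Sum>k\<in>{- int L..int L}. \<alpha> k * z powi k))\<^sup>2 \<le>
      E + C * (\<Sum>b\<in>B. (norm (\<Sum>k\<in>{- int L..int L}. \<beta> b k * z powi k))\<^sup>2)"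
  shows "Re (pd_form \<phi> {- int L..int L} \<alpha>) \<le>
    E * Re (\<phi> 0) + C * (\<Sum>b\<in>B. Re (pd_form \<phi> {- int L..int L} (\<beta> b)))"
proof -
  define A where "A = {- int L..int L}"
  define q where "q N c = Re (\<Sum>k\<in>A. \<Sum>l\<in>A. c k * cnj (c l) * (of_real (1 - \<bar>of_int (k - l)\<bar> / real N) * \<phi> (k - l)))"
    for N :: nat and c
  have lim: "(\<lambda>N. q N c) \<longlonglongrightarrow> Re (pd_form \<phi> A c)" for c
  proof -
    have "(\<lambda>N. of_real (1 - \<bar>of_int (k - l)\<bar> / real N) * \<phi> (k - l)) \<longlonglongrightarrow> of_real (1 - 0) * \<phi> (k - l)" for k l
      by (intro tendsto_intros lim_const_over_n)
    then have t: "(\<lambda>N. of_real (1 - \<bar>of_int (k - l)\<bar> / real N) * \<phi> (k - l)) \<longlonglongrightarrow> \<phi> (k - l)" for k l by simp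
    show ?thesis unfolding q_def pd_form_def by (intro tendsto_intros t)
  qed
  have ineq: "q N \<alpha> \<le> E * Re (\<phi> 0) + C * (\<Sum>b\<in>B. q N (\<beta> b))" if N: "2 * L + 1 \<le> N" for N
  proof -
    define M where "M = N + 2 * L + 1"
    define R where "R z = pd_form \<phi> {0..<int N} (\<lambda>i. z powi (- i))" for z
    let ?T = "\<lambda>c r. norm (\<Sum>k\<in>A. c k * unit_root M r powi k)"
    have MN: "0 < real M * real N" using N by (simp add: M_def)
    have avg: "(\<Sum>r<M. (?T c r)\<^sup>2 * Re (R (unit_root M r))) = real M * real N * q N c" for c
    proof -
      have "(\<Sum>r<M. (?T c r)\<^sup>2 * Re (R (unit_root M r))) = Re (\<Sum>r<M. of_real ((?T c r)\<^sup>2) * R (unit_root M r))"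
        by (simp del: of_real_power)
      also have "\<dots> = Re (of_nat M * (\<Sum>k\<in>A. \<Sum>l\<in>A. c k * cnj (c l) * (of_int (int N - \<bar>k - l\<bar>) * \<phi> (k - l))))"
        using fejer_average[of L N c \<phi>] N by (simp only: A_def M_def R_def)
      also have "\<dots> = Re (of_real (real M * real N) * (\<Sum>k\<in>A. \<Sum>l\<in>A. c k * cnj (c l) *
          (of_real (1 - \<bar>of_int (k - l)\<bar> / real N) * \<phi> (k - l))))"
        unfolding sum_distrib_left
      proof (intro arg_cong[where f = Re] sum.cong refl)
        fix k l
        have "real N * (1 - \<bar>of_int (k - l)\<bar> / real N) = of_int (int N - \<bar>k - l\<bar>)"
          using N by (simp add: field_simps)
        then have "(of_int (int N - \<bar>k - l\<bar>) :: complex) = of_real (real N) * of_real (1 - \<bar>of_int (k - l)\<bar> / real N)"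
          by (metis of_real_mult of_real_of_int_eq)
        then show "of_nat M * (c k * cnj (c l) * (of_int (int N - \<bar>k - l\<bar>) * \<phi> (k - l))) =
            of_real (real M * real N) * (c k * cnj (c l) * (of_real (1 - \<bar>of_int (k - l)\<bar> / real N) * \<phi> (k - l)))"
          by (simp only: of_real_mult of_real_of_nat_eq mult_ac)
      qed
      also have "Re (of_real x * z) = x * Re z" for x z by simp
      finally show ?thesis unfolding q_def .
    qed
    \<comment> \<open>The total weight, obtained from the averaging formula for the constant
      polynomial 1.\<close>
    have one: "(\<Sum>r<M. Re (R (unit_root M r))) = real M * real N * Re (\<phi> 0)"
    proof -
      let ?d = "\<lambda>k :: int. if k = 0 then 1 else (0 :: complex)"
      have T1: "?T ?d r = 1" for r
        by (subst sum.cong[OF refl, of _ _ "\<lambda>k. if k = 0 then 1 else 0"]) (auto simp: A_def)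
      have "q N ?d = Re (\<Sum>k\<in>A. if k = 0 then (\<Sum>l\<in>A. if l = 0 then \<phi> 0 else 0) else 0)"
        unfolding q_def by (intro arg_cong[where f = Re] sum.cong refl) (auto intro!: sum.cong sum.neutral)
      also have "\<dots> = Re (\<phi> 0)" by (simp add: A_def)
      finally show ?thesis using avg[of ?d] by (simp add: T1)
    qed
    have "real M * real N * q N \<alpha> \<le> (\<Sum>r<M. (E + C * (\<Sum>b\<in>B. (?T (\<beta> b) r)\<^sup>2)) * Re (R (unit_root M r)))"
      unfolding avg[symmetric]
      by (intro sum_mono mult_right_mono) (use le pd in \<open>simp_all add: A_def R_def\<close>)
    also have "\<dots> = E * (\<Sum>r<M. Re (R (unit_root M r))) + C * (\<Sum>b\<in>B. \<Sum>r<M. (?T (\<beta> b) r)\<^sup>2 * Re (R (unit_root M r)))"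
      by (subst sum.swap) (simp add: sum_distrib_left sum_distrib_right distrib_right sum.distrib mult.assoc)
    also have "\<dots> = real M * real N * (E * Re (\<phi> 0) + C * (\<Sum>b\<in>B. q N (\<beta> b)))"
      unfolding one avg by (simp add: sum_distrib_left algebra_simps)
    finally show ?thesis using MN by (simp only: mult_le_cancel_left_pos)
  qed
  have "Re (pd_form \<phi> A \<alpha>) \<le> E * Re (\<phi> 0) + C * (\<Sum>b\<in>B. Re (pd_form \<phi> A (\<beta> b)))"
  proof (rule LIMSEQ_le[OF lim])
    show "(\<lambda>N. E * Re (\<phi> 0) + C * (\<Sum>b\<in>B. q N (\<beta> b))) \<longlonglongrightarrow> E * Re (\<phi> 0) + C * (\<Sum>b\<in>B. Re (pd_form \<phi> A (\<beta> b)))"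
      by (intro tendsto_intros lim)
  qed (use ineq in blast)
  then show ?thesis by (simp add: A_def)
qed

section \<open>Points of the support\<close>

context representation
begin

definition K where "K = rep_kernel H \<rho>"

lemma K_ideal: "l1_ideal \<sigma> K"
  unfolding K_def by (rule rep_kernel_ideal[OF rep])

lemma K_l1: "b \<in> K \<Longrightarrow> b \<in> l1"
  by (simp add: K_def rep_kernel_def)

lemma K_mul: "b \<in> K \<Longrightarrow> c \<in> l1 \<Longrightarrow> mul c b \<in> K" "b \<in> K \<Longrightarrow> c \<in> l1 \<Longrightarrow> mul b c \<in> K"
  using K_ideal by (auto simp: l1_ideal_def)

lemma K_zero: "b \<in> K \<Longrightarrow> u \<in> vecs H \<Longrightarrow> \<rho> b u = vzero H"
  by (simp add: K_def rep_kernel_def)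

lemma mul_dl: "mul b (dl m) = (\<lambda>n. b (n - m))"
  unfolding mul_mono_right by (intro ext bcontfun_eqI) (simp add: apply_cf_mult)

lemma mul_fn_left: "mul (fn f) b = (\<lambda>n. cf_mult f (b n))"
  unfolding mul_mono_left by simp

lemma mul_fn_right: "mul b (fn f) = (\<lambda>n. cf_mult (b n) (al n f))"
  unfolding mul_mono_right by simp

lemma separating_neighbourhood:
  assumes fin: "finite B" and ne: "\<And>n. n \<in> B \<Longrightarrow> it n y \<noteq> y"
  obtains V where "open V" "y \<in> V" "\<And>n z. n \<in> B \<Longrightarrow> z \<in> V \<Longrightarrow> it n z \<notin> V"
proof -
  have "\<exists>V. open V \<and> y \<in> V \<and> (\<forall>z\<in>V. it n z \<notin> V)" if n: "n \<in> B" for n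
  proof -
    obtain U W where UW: "open U" "open W" "y \<in> U" "it n y \<in> W" "U \<inter> W = {}"
      using hausdorff[of y "it n y"] ne[OF n] by metis
    have "open (it n -` W)" using continuous_it[of UNIV n] UW(2) by (simp add: continuous_on_open_vimage)
    then show ?thesis using UW by (intro exI[of _ "U \<inter> it n -` W"]) auto
  qed
  then obtain V where V: "\<And>n. n \<in> B \<Longrightarrow> open (V n) \<and> y \<in> V n \<and> (\<forall>z\<in>V n. it n z \<notin> V n)" by metis
  show ?thesis
    by (rule that[of "\<Inter>n\<in>B. V n"]) (use V fin in auto)
qed

text \<open>Compressing \<open>b\<close> by a function with small support around \<open>y\<close> removes the coefficients
  \<open>b n\<close> with \<open>0 < \<bar>n\<bar> \<le> N\<close>.\<close>

lemma kernel_coefficient_zero: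
  assumes y: "y \<in> F" and ne: "\<And>n. n \<noteq> 0 \<Longrightarrow> \<bar>n\<bar> \<le> int N \<Longrightarrow> it n y \<noteq> y" and b: "b \<in> K"
  shows "norm (apply_bcontfun (b 0) y) \<le> l1_norm (l1_cut (- {- int N..int N}) b)"
proof -
  let ?A = "{- int N..int N}"
  have bl: "b \<in> l1" using K_l1[OF b] .
  obtain V where V: "open V" "y \<in> V" "\<And>n z. n \<in> ?A - {0} \<Longrightarrow> z \<in> V \<Longrightarrow> it n z \<notin> V"
  proof (rule separating_neighbourhood[of "?A - {0}" y])
    show "it n y \<noteq> y" if "n \<in> ?A - {0}" for n using ne[of n] that by (auto simp: abs_le_iff)
  qed (simp, rule that)
  obtain f :: "'a \<Rightarrow>\<^sub>C complex" and f' where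
    f: "\<And>y. apply_bcontfun f y = of_real (f' y)" "\<And>y. 0 \<le> f' y" "\<And>y. f' y \<le> 1"
    "f' y = 1" "\<And>y. y \<notin> V \<Longrightarrow> f' y = 0"
    by (rule urysohn_point[OF compact_X V(1,2)]) (rule that)
  define c where "c = mul (fn f) (mul b (fn f))"
  have cK: "c \<in> K" unfolding c_def using b by (intro K_mul) auto
  then have cl: "c \<in> l1" by (rule K_l1)
  have cn: "apply_bcontfun (c n) z = of_real (f' z * f' (it (- n) z)) * apply_bcontfun (b n) z" for n z
    by (simp add: c_def mul_fn_left mul_fn_right apply_cf_mult f(1))
  have c0: "c n = 0" if "n \<in> ?A - {0}" for n
  proof (rule bcontfun_eqI)
    fix z
    have "f' z = 0 \<or> f' (it (- n) z) = 0"
      using V(3)[of "- n" z] f(5)[of z] f(5)[of "it (- n) z"] that by force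
    then show "apply_bcontfun (c n) z = apply_bcontfun 0 z" by (auto simp: cn)
  qed
  have cb: "norm (c n) \<le> norm (b n)" for n
  proof (rule norm_bound)
    fix z
    have "norm (apply_bcontfun (c n) z) = (f' z * f' (it (- n) z)) * norm (apply_bcontfun (b n) z)"
      using f(2) by (simp add: cn norm_mult)
    also have "\<dots> \<le> 1 * norm (b n)"
      using f(2,3) by (intro mult_mono norm_bounded mult_le_one) auto
    finally show "norm (apply_bcontfun (c n) z) \<le> norm (b n)" by simp
  qed
  \<comment> \<open>Since \<open>c\<close> lies in the kernel, \<open>d\<close> and
    \<open>fn (c 0)\<close> act alike, and \<open>d\<close> has only coefficients of degree beyond
    \<open>N\<close>.\<close>
  define d where "d = l1_sub (fn (c 0)) c"
  have dl: "d \<in> l1" using cl by (simp add: d_def)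
  have "norm (d n) \<le> norm (l1_cut (- ?A) b n)" for n
    using cb[of n] c0[of n] by (auto simp: d_def l1_sub_def l1_mono_def l1_cut_def)
  then have dn: "l1_norm d \<le> l1_norm (l1_cut (- ?A) b)"
    using l1_dominated(2)[of "\<lambda>n. norm (l1_cut (- ?A) b n)" d] l1_cut_in[OF bl] by (simp add: l1_iff l1_norm_def)
  have "norm (apply_bcontfun (c 0) y) \<le> l1_norm (l1_cut (- ?A) b)"
  proof (rule support_norm_bound[OF y])
    fix u assume u: "u \<in> vecs H"
    have "fn (c 0) = l1_add d c" by (simp add: d_def l1_sub_def l1_add_def)
    then have "\<rho> (fn (c 0)) u = \<rho> d u" using dl cl u K_zero[OF cK u] by (simp add: rho_add add_zero)
    then show "nrm (\<rho> (fn (c 0)) u) \<le> l1_norm (l1_cut (- ?A) b) * nrm u"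
      using norm_rho_le[OF dl u] mult_right_mono[OF dn norm_nonneg[OF u]] by simp
  qed
  then show ?thesis using f(4) by (simp add: cn)
qed

lemma kernel_coefficient:
  assumes y: "y \<in> F" and ne: "\<And>n. n \<noteq> 0 \<Longrightarrow> \<bar>n\<bar> \<le> int N + \<bar>m\<bar> \<Longrightarrow> it n y \<noteq> y" and b: "b \<in> K"
  shows "norm (apply_bcontfun (b m) y) \<le> l1_norm (l1_cut (- {- int N..int N}) b)"
proof -
  \<comment> \<open>The shift brings \<open>b m\<close> to degree 0. The window grows by |m| so that
    what lies outside it still comes from coefficients of \<open>b\<close> beyond
    \<open>N\<close>.\<close>
  let ?b = "mul b (dl (- m))" and ?N = "N + nat \<bar>m\<bar>"
  have bl: "b \<in> l1" using K_l1[OF b] .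
  have "norm (apply_bcontfun (?b 0) y) \<le> l1_norm (l1_cut (- {- int ?N..int ?N}) ?b)"
    by (rule kernel_coefficient_zero[OF y]) (use ne b in \<open>auto intro: K_mul\<close>)
  also have "\<dots> = (\<Sum>\<^sub>\<infinity>n. norm (l1_cut (- {- int ?N..int ?N}) ?b (n - m)))"
    unfolding l1_norm_def
    by (rule infsum_reindex_bij_witness[of _ "\<lambda>n. n - m" "\<lambda>n. n + m"]) auto
  also have "\<dots> \<le> l1_norm (l1_cut (- {- int N..int N}) b)"
    unfolding l1_norm_def
  proof (rule infsum_mono)
    have c: "l1_cut (- {- int ?N..int ?N}) ?b \<in> l1" using bl by simp
    show "(\<lambda>n. norm (l1_cut (- {- int ?N..int ?N}) ?b (n - m))) summable_on UNIV"
      using c unfolding l1_iff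
      by (subst summable_on_reindex_bij_witness[of _ "\<lambda>n. n + m" "\<lambda>n. n - m" UNIV
            "\<lambda>n. norm (l1_cut (- {- int ?N..int ?N}) ?b n)"]) auto
    show "(\<lambda>n. norm (l1_cut (- {- int N..int N}) b n)) summable_on UNIV"
      using l1_cut_in[OF bl] by (simp add: l1_iff)
  qed (auto simp: l1_cut_def mul_dl)
  finally show ?thesis by (simp add: mul_dl)
qed

text \<open>Without return times the window of \<open>kernel_coefficient\<close> can be taken as
  large as desired.\<close>

lemma kernel_Aper:
  assumes "y \<in> F" "y \<in> Aper \<sigma>" "b \<in> K"
  shows "apply_bcontfun (b m) y = 0"
proof -
  have "norm (apply_bcontfun (b m) y) \<le> 0 + e" if e: "0 < e" for e
  proof -
    obtain N where "l1_norm (l1_cut (- {- int N..int N}) b) < e"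
      using l1_tail_small[OF K_l1[OF assms(3)] e] by blast
    moreover have "norm (apply_bcontfun (b m) y) \<le> l1_norm (l1_cut (- {- int N..int N}) b)"
      by (rule kernel_coefficient) (use assms in \<open>auto simp: Aper_iff\<close>)
    ultimately show ?thesis by simp
  qed
  then have "norm (apply_bcontfun (b m) y) \<le> 0" by (rule field_le_epsilon)
  then show ?thesis by simp
qed

text \<open>At an aperiodic point of \<open>F\<close> all of \<open>K\<close> vanishes by
  \<open>kernel_Aper\<close>, hence so does \<open>a\<close>. If the fibre over \<open>x\<close>
  were the whole circle, each entry of \<open>a\<close> would be a vanishing Fourier series in the
  phase.\<close>

lemma nonvanishing_point:
  assumes a: "a \<in> vanishing_ideal \<sigma> (zero_set K)" and x: "x \<in> F" and nz: "apply_bcontfun (a m) x \<noteq> 0"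
  shows "x \<in> Per \<sigma>" "\<exists>\<mu>. norm \<mu> = 1 \<and> (x, \<mu>) \<notin> zero_set K"
proof -
  have al: "a \<in> l1" and av: "\<And>\<mu>. (x, \<mu>) \<in> zero_set K \<Longrightarrow> vanishes a x \<mu>"
    using a by (auto simp: vanishing_ideal_iff[OF zero_set_circle])
  show "x \<in> Per \<sigma>"
  proof (rule ccontr)
    assume "x \<notin> Per \<sigma>"
    then have x': "x \<in> Aper \<sigma>" by (simp add: Aper_def)
    have "(x, 1) \<in> zero_set K"
      using kernel_Aper[OF x x'] by (simp add: zero_set_iff[OF K_ideal] vanishes_Aper[OF x'])
    then have "vanishes a x 1" by (rule av)
    then show False using nz vanishes_Aper[OF x'] by simp
  qed
  show "\<exists>\<mu>. norm \<mu> = 1 \<and> (x, \<mu>) \<notin> zero_set K"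
  proof (rule ccontr)
    assume "\<nexists>\<mu>. norm \<mu> = 1 \<and> (x, \<mu>) \<notin> zero_set K"
    then have v: "vanishes a x \<mu>" if "norm \<mu> = 1" for \<mu> using that av by blast
    \<comment> \<open>The coefficients of \<open>a\<close> in the fibre containing \<open>m\<close>;
      their Fourier series is the entry at \<open>it (- m) x\<close>.\<close>
    let ?c = "\<lambda>n. if it (- n) x = it (- m) x then apply_bcontfun (a n) x else 0"
    have "?c m = 0"
    proof (rule fourier_unique[OF al, of ?c m])
      show "norm (?c n) \<le> norm (a n)" for n by (simp add: norm_bounded)
      fix \<mu> :: complex assume "norm \<mu> = 1"
      then have "entry a x \<mu> (it (- m) x) = 0" using v by (simp add: vanishes_def)
      moreover have "entry a x \<mu> (it (- m) x) = (\<Sum>\<^sub>\<infinity>n. \<mu> powi n * ?c n)"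
        unfolding entry_def by (rule infsum_cong_neutral) auto
      ultimately show "(\<Sum>\<^sub>\<infinity>n. \<mu> powi n * ?c n) = 0" by simp
    qed
    then show False using nz by simp
  qed
qed

lemma infsum_truncate:
  fixes c :: "int \<Rightarrow> complex"
  assumes a: "a \<in> l1" and c: "\<And>n. norm (c n) \<le> norm (a n :: 'a \<Rightarrow>\<^sub>C complex)" and \<mu>: "norm \<mu> = 1"
  shows "norm ((\<Sum>\<^sub>\<infinity>n. \<mu> powi n * c n) - (\<Sum>n\<in>{- int L..int L}. c n * \<mu> powi n)) \<le>
    l1_norm (l1_cut (- {- int L..int L}) a)"
proof -
  let ?A = "{- int L..int L}"
  have s: "(\<lambda>n. norm (\<mu> powi n * c n)) summable_on B" for B
  proof (rule summable_on_comparison_test)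
    show "(\<lambda>n. norm (a n)) summable_on B"
      using a unfolding l1_iff by (rule summable_on_subset_banach) simp
  qed (auto simp: norm_mult norm_power_int \<mu> c)
  have "(\<Sum>\<^sub>\<infinity>n. \<mu> powi n * c n) = (\<Sum>\<^sub>\<infinity>n\<in>?A \<union> - ?A. \<mu> powi n * c n)" by simp
  also have "\<dots> = (\<Sum>\<^sub>\<infinity>n\<in>?A. \<mu> powi n * c n) + (\<Sum>\<^sub>\<infinity>n\<in>-?A. \<mu> powi n * c n)"
    by (rule infsum_Un_disjoint) (auto intro: abs_summable_summable[OF s])
  finally have "(\<Sum>\<^sub>\<infinity>n. \<mu> powi n * c n) - (\<Sum>n\<in>?A. c n * \<mu> powi n) = (\<Sum>\<^sub>\<infinity>n\<in>-?A. \<mu> powi n * c n)"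
    by (simp add: mult.commute)
  also have "norm \<dots> \<le> (\<Sum>\<^sub>\<infinity>n\<in>-?A. norm (a n))"
  proof (rule norm_infsum_le[OF has_sum_infsum has_sum_infsum])
    show "(\<lambda>n. norm (a n)) summable_on - ?A"
      using a unfolding l1_iff by (rule summable_on_subset_banach) simp
  qed (auto simp: norm_mult norm_power_int \<mu> c intro: abs_summable_summable[OF s])
  finally show ?thesis by (simp add: l1_norm_cut[OF a])
qed

text \<open>A partial sum \<open>T\<close> of some element \<open>b\<close> of \<open>K\<close>
  stays away from 0 near \<open>x\<close>. At a point of \<open>F\<close> without short return times
  \<open>kernel_coefficient\<close> would make the coefficients of \<open>b\<close>, and hence
  \<open>T\<close>, too small.\<close>

lemma locally_periodic:
  assumes x: "x \<in> F" and \<mu>: "norm \<mu> = 1" and nz: "(x, \<mu>) \<notin> zero_set K"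
  obtains V and m :: nat where "open V" "x \<in> V" "0 < m" "\<And>y. y \<in> V \<Longrightarrow> y \<in> F \<Longrightarrow> it (int m) y = y"
proof -
  obtain b where b: "b \<in> K" "transform b (x, \<mu>) \<noteq> 0" using \<mu> nz by (auto simp: zero_set_def)
  have bl: "b \<in> l1" using K_l1[OF b(1)] .
  define c where "c = norm (transform b (x, \<mu>))"
  have c: "0 < c" using b by (simp add: c_def)
  obtain L where L: "l1_norm (l1_cut (- {- int L..int L}) b) < c / 4"
    using l1_tail_small[OF bl, of "c / 4"] c by auto
  let ?A = "{- int L..int L}"
  define T where "T y = (\<Sum>n\<in>?A. apply_bcontfun (b n) y * \<mu> powi n)" for y
  have "norm (transform b (x, \<mu>) - T x) \<le> l1_norm (l1_cut (- ?A) b)"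
    unfolding transform_def T_def prod.case by (rule infsum_truncate[OF bl _ \<mu>]) (rule norm_bounded)
  then have Tx: "c / 2 < norm (T x)"
    using L c norm_triangle_ineq2[of "transform b (x, \<mu>)" "T x"]
    unfolding c_def[symmetric] by linarith
  \<comment> \<open>The 2 L + 1 terms of \<open>T\<close>, each at most \<open>e\<close>, add up to
    at most c / 4.\<close>
  define e where "e = c / (4 * (2 * real L + 1))"
  have e: "0 < e" using c by (simp add: e_def)
  obtain N where N: "l1_norm (l1_cut (- {- int N..int N}) b) < e"
    using l1_tail_small[OF bl e] by auto
  define V where "V = {y. c / 2 < norm (T y)}"
  have Vo: "open V" unfolding V_def T_def by (intro open_Collect_less continuous_intros) simp_all
  have per: "\<exists>n. n \<noteq> 0 \<and> \<bar>n\<bar> \<le> int (N + L) \<and> it n y = y" if y: "y \<in> V" "y \<in> F" for y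
  proof (rule ccontr)
    assume no: "\<not> ?thesis"
    have "norm (apply_bcontfun (b m) y) \<le> e" if "m \<in> ?A" for m
      using kernel_coefficient[OF y(2) _ b(1), of N m] no N that by force
    then have "norm (T y) \<le> (\<Sum>n\<in>?A. e)"
      unfolding T_def by (intro sum_norm_le) (simp add: norm_mult norm_power_int \<mu>)
    also have "\<dots> = (2 * real L + 1) * e" by simp
    also have "\<dots> = c / 4" by (simp add: e_def field_simps)
    finally show False using y(1) c by (simp add: V_def)
  qed
  show ?thesis
  \<comment> \<open>The factorial is a common multiple of all positive return times up to N +
    L.\<close>
  proof (rule that[OF Vo, of "fact (N + L)"])
    show "x \<in> V" using Tx by (simp add: V_def)
    fix y assume y: "y \<in> V" "y \<in> F"
    obtain n where n: "n \<noteq> 0" "\<bar>n\<bar> \<le> int (N + L)" "it n y = y" using per[OF y] by blast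
    then have yp: "y \<in> Per \<sigma>" by (auto simp: Per_iff)
    have "nat \<bar>n\<bar> dvd fact (N + L)" using n by (intro dvd_fact) auto
    then have "\<bar>n\<bar> dvd int (fact (N + L))" by (metis abs_ge_zero int_dvd_int_iff int_nat_eq)
    then have "n dvd int (fact (N + L))" by simp
    moreover have "int (period \<sigma> y) dvd n" using period_props(3)[OF yp] n by simp
    ultimately show "it (int (fact (N + L))) y = y"
      using period_props(3)[OF yp] dvd_trans by blast
  qed simp
qed

end

section \<open>Localisation at periodic points\<close>

context representation
begin

text \<open>The trigonometric polynomial in \<delta> with constant coefficients \<open>c n\<close>;
  its action depends on the operator of \<delta> alone.\<close>

definition sp :: "int set \<Rightarrow> (int \<Rightarrow> complex) \<Rightarrow> int \<Rightarrow> ('a \<Rightarrow>\<^sub>C complex)" where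
  "sp A c = l1_cut A (\<lambda>n. const_bcontfun (c n))"

lemma cut_finite_in: "finite A \<Longrightarrow> l1_cut A e \<in> l1"
  unfolding l1_iff l1_cut_def
  by (rule finite_nonzero_values_imp_summable_on) (erule rev_finite_subset, auto)

lemma sp_in [simp]: "finite A \<Longrightarrow> sp A c \<in> l1"
  unfolding sp_def by (rule cut_finite_in)

lemma cut_empty: "l1_cut {} e = fn 0"
  by (auto simp: l1_cut_def l1_mono_def)

lemma rho_fn_zero: "u \<in> vecs H \<Longrightarrow> \<rho> (fn 0) u = vzero H"
  using null_fn_zero by (simp add: null_fn_def)

lemma mono_const: "l1_mono (const_bcontfun c) n = l1_scale c (dl n)"
  by (intro ext bcontfun_eqI) (auto simp: l1_mono_def l1_scale_def apply_scale)

lemma mono_scale: "l1_mono (cf_scale c f) n = l1_scale c (l1_mono f n)"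
  by (intro ext bcontfun_eqI) (auto simp: l1_mono_def l1_scale_def apply_scale)

lemma inner_sp:
  assumes "finite A" "u \<in> vecs H" "v \<in> vecs H"
  shows "vinner H (\<rho> (sp A c) u) v = (\<Sum>k\<in>A. c k * vinner H (\<rho> (dl k) u) v)"
  using assms
proof (induction A rule: finite_induct)
  case empty
  then show ?case by (simp add: sp_def cut_empty rho_fn_zero inner_zero)
next
  case (insert n A)
  have "\<rho> (sp (insert n A) c) u = vadd H (\<rho> (sp A c) u) (vscale H (c n) (\<rho> (dl n) u))"
    unfolding sp_def cut_insert[OF insert(2)] mono_const[of "c n" n]
    using insert by (simp add: rho_add rho_scale cut_finite_in)
  then show ?case
    using insert by (simp add: inner_add_left inner_scale_left scale_closed add.commute)
qed

lemma star_dl: "star (dl n) = dl (- n)"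
  by (intro ext bcontfun_eqI) (auto simp: apply_star l1_mono_def)

lemma dl_dl: "mul (dl m) (dl n) = dl (m + n)"
  unfolding mul_mono_mono by (rule arg_cong2[where f = l1_mono], rule bcontfun_eqI) (simp_all add: apply_cf_mult)

text \<open>The inner product of \<rho>(\<delta>^k) u and \<rho>(\<delta>^l) u depends only on k -
  l. In particular the sequence is positive definite.\<close>

lemma norm_sp:
  assumes A: "finite A" and u: "u \<in> vecs H"
  shows "pd_form (\<lambda>n. vinner H (\<rho> (dl n) u) u) A c = of_real ((nrm (\<rho> (sp A c) u))\<^sup>2)"
proof -
  have e: "vinner H (\<rho> (dl k) u) (\<rho> (dl l) u) = vinner H (\<rho> (dl (k - l)) u) u" for k l
  proof -
    have "vinner H (\<rho> (dl k) u) (\<rho> (dl l) u) = vinner H (\<rho> (star (dl l)) (\<rho> (dl k) u)) u"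
      using u by (simp add: rho_star)
    also have "\<rho> (star (dl l)) (\<rho> (dl k) u) = \<rho> (mul (dl (- l)) (dl k)) u"
      using u by (simp add: star_dl rho_mul)
    finally show ?thesis by (simp add: dl_dl)
  qed
  have "of_real ((nrm (\<rho> (sp A c) u))\<^sup>2) = vinner H (\<rho> (sp A c) u) (\<rho> (sp A c) u)"
    using A u by (simp only: inner_self sp_in rho_closed)
  also have "\<dots> = (\<Sum>k\<in>A. c k * vinner H (\<rho> (dl k) u) (\<rho> (sp A c) u))"
    using A u by (simp add: inner_sp)
  also have "\<dots> = (\<Sum>k\<in>A. c k * (\<Sum>l\<in>A. cnj (c l) * vinner H (\<rho> (dl k) u) (\<rho> (dl l) u)))"
  proof (intro sum.cong refl arg_cong2[where f = times])
    fix k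
    have "vinner H (\<rho> (dl k) u) (\<rho> (sp A c) u) = cnj (vinner H (\<rho> (sp A c) u) (\<rho> (dl k) u))"
      using A u by (intro inner_commute) auto
    also have "\<dots> = (\<Sum>l\<in>A. cnj (c l) * cnj (vinner H (\<rho> (dl l) u) (\<rho> (dl k) u)))"
      using A u by (simp add: inner_sp)
    also have "\<dots> = (\<Sum>l\<in>A. cnj (c l) * vinner H (\<rho> (dl k) u) (\<rho> (dl l) u))"
      using u by (intro sum.cong refl arg_cong2[where f = times] inner_commute[symmetric]) auto
    finally show "vinner H (\<rho> (dl k) u) (\<rho> (sp A c) u) =
        (\<Sum>l\<in>A. cnj (c l) * vinner H (\<rho> (dl k) u) (\<rho> (dl l) u))" .
  qed
  also have "\<dots> = pd_form (\<lambda>n. vinner H (\<rho> (dl n) u) u) A c"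
    by (simp add: pd_form_def e sum_distrib_left mult.assoc)
  finally show ?thesis by simp
qed

lemma norm_sp_inequality:
  fixes L :: nat and \<alpha> :: "int \<Rightarrow> complex" and \<beta> :: "'b \<Rightarrow> int \<Rightarrow> complex"
  assumes u: "u \<in> vecs H" and E: "0 \<le> E"
    and le: "\<And>z. norm z = 1 \<Longrightarrow> (norm (\<Sum>k\<in>{- int L..int L}. \<alpha> k * z powi k))\<^sup>2 \<le>
      E + C * (\<Sum>b\<in>B. (norm (\<Sum>k\<in>{- int L..int L}. \<beta> b k * z powi k))\<^sup>2)"
  shows "(nrm (\<rho> (sp {- int L..int L} \<alpha>) u))\<^sup>2 \<le>
    E * (nrm u)\<^sup>2 + C * (\<Sum>b\<in>B. (nrm (\<rho> (sp {- int L..int L} (\<beta> b)) u))\<^sup>2)"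
proof -
  let ?\<phi> = "\<lambda>n. vinner H (\<rho> (dl n) u) u"
  have "Re (pd_form ?\<phi> {- int L..int L} \<alpha>) \<le>
      E * Re (?\<phi> 0) + C * (\<Sum>b\<in>B. Re (pd_form ?\<phi> {- int L..int L} (\<beta> b)))"
    by (rule pd_form_inequality[OF _ le]) (simp_all add: norm_sp[OF _ u])
  \<comment> \<open>The value at 0 is the squared norm of \<rho>(1) u, which may be smaller than
    that of \<open>u\<close>.\<close>
  moreover have "E * Re (?\<phi> 0) \<le> E * (nrm u)\<^sup>2"
    using rho_one_inner[OF u] E by (intro mult_left_mono) auto
  ultimately show ?thesis by (simp add: norm_sp[OF _ u])
qed

section \<open>Functions commuting with powers of \<delta> modulo the kernel\<close>

lemma invariant_multiple:
  assumes inv: "\<And>y. y \<in> F \<Longrightarrow> G (it q y) = G y" and y: "y \<in> F"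
  shows "G (it (q * k) y) = G y"
proof (induction k rule: int_induct[where k = 0])
  case (step1 i)
  then show ?case using inv[OF support_invariant[OF y, of "q * i"]] by (simp add: algebra_simps)
next
  case (step2 i)
  then show ?case using inv[OF support_invariant[OF y, of "q * (i - 1)"]] by (simp add: algebra_simps)
qed simp

text \<open>A function that is \<open>\<sigma>\<^sup>p\<close>-invariant on the support commutes with \<open>\<delta>\<^sup>n\<close> for \<open>p dvd n\<close>,
  modulo the kernel.\<close>

lemma rho_cut_commute:
  assumes \<kappa>: "\<And>y. y \<in> F \<Longrightarrow> apply_bcontfun \<kappa> (it (int p) y) = apply_bcontfun \<kappa> y"
    and A: "finite A" "\<And>n. n \<in> A \<Longrightarrow> c n \<noteq> 0 \<Longrightarrow> int p dvd n" and w: "w \<in> vecs H"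
  shows "\<rho> (\<lambda>n. if n - j \<in> A then cf_scale (c (n - j)) \<kappa> else 0) w = \<rho> (sp A c) (\<rho> (fn \<kappa>) (\<rho> (dl j) w))"
  using A
proof (induction A rule: finite_induct)
  case empty
  have "(\<lambda>n. 0) = fn 0" by (auto simp: l1_mono_def)
  then show ?case using w by (simp add: sp_def cut_empty rho_fn_zero)
next
  case (insert n A)
  let ?X = "\<lambda>A n. if n - j \<in> A then cf_scale (c (n - j)) \<kappa> else 0" and ?u = "\<rho> (fn \<kappa>) (\<rho> (dl j) w)"
  have X: "?X (insert n A) = l1_add (?X A) (l1_mono (cf_scale (c n) \<kappa>) (n + j))"
    using insert(2) by (auto simp: l1_add_def l1_mono_def fun_eq_iff)
  have XA: "?X A \<in> l1"
  proof -
    have "?X A = l1_cut ((\<lambda>n. n + j) ` A) (\<lambda>n. cf_scale (c (n - j)) \<kappa>)"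
      by (auto simp: l1_cut_def image_iff fun_eq_iff intro: exI[of _ "_ - j"])
    then show ?thesis using insert(1) by (simp add: cut_finite_in)
  qed
  have Y: "\<rho> (sp (insert n A) c) ?u = vadd H (\<rho> (sp A c) ?u) (vscale H (c n) (\<rho> (dl n) ?u))"
    unfolding sp_def cut_insert[OF insert(2)] mono_const[of "c n" n]
    using insert w by (simp add: rho_add rho_scale cut_finite_in)
  have "vscale H (c n) (\<rho> (l1_mono \<kappa> (n + j)) w) = vscale H (c n) (\<rho> (dl n) ?u)"
  proof (cases "c n = 0")
    case True
    then show ?thesis using w by (simp add: scale_zero)
  next
    case False
    then obtain k where k: "n = int p * k" using insert(4)[of n] by auto
    have "\<rho> (l1_mono \<kappa> (n + j)) w = \<rho> (fn \<kappa>) (\<rho> (dl n) (\<rho> (dl j) w))"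
      using w by (subst mono_split(1)) (simp add: rho_mul flip: dl_dl)
    also have "\<dots> = \<rho> (fn (al n \<kappa>)) (\<rho> (dl n) (\<rho> (dl j) w))"
      using invariant_multiple[where G = "apply_bcontfun \<kappa>" and q = "int p" and k = "- k", OF \<kappa>] w
      by (intro rho_fn_cong) (auto simp: k)
    also have "\<dots> = \<rho> (dl n) ?u"
      using w rho_mul[of "fn (al n \<kappa>)" "dl n" "\<rho> (dl j) w"] rho_mul[of "dl n" "fn \<kappa>" "\<rho> (dl j) w"]
      by (simp flip: mono_split)
    finally show ?thesis by simp
  qed
  moreover have "\<rho> (?X A) w = \<rho> (sp A c) ?u" by (rule insert(3)) (use insert(4) in auto)
  ultimately show ?case
    unfolding X Y using XA w by (simp add: rho_add mono_scale rho_scale)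
qed

text \<open>The shift n |-> n + j brings the indices congruent to \<open>j\<close> to the multiples
  of the period, at the cost of the factor \<mu>^(-j).\<close>

lemma residue_sum:
  assumes x: "x \<in> Per \<sigma>" and \<mu>: "norm \<mu> = 1"
  shows "(\<Sum>\<^sub>\<infinity>n. \<mu> powi n * (if int (period \<sigma> x) dvd n then apply_bcontfun (a (n + j)) x else 0)) =
    \<mu> powi (- j) * entry a x \<mu> (it (- j) x)"
proof -
  let ?p = "int (period \<sigma> x)"
  have "\<mu> \<noteq> 0" using \<mu> by auto
  have "entry a x \<mu> (it (- j) x) = (\<Sum>\<^sub>\<infinity>n\<in>{n. ?p dvd n - j}. \<mu> powi n * apply_bcontfun (a n) x)"
    using entry_Per[OF x, of a 0 \<mu> "- j"] by simp
  also have "\<dots> = (\<Sum>\<^sub>\<infinity>n. \<mu> powi n * (if ?p dvd n - j then apply_bcontfun (a n) x else 0))"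
    by (rule infsum_cong_neutral) auto
  finally have "\<mu> powi (- j) * entry a x \<mu> (it (- j) x) =
      (\<Sum>\<^sub>\<infinity>n. \<mu> powi (- j) * (\<mu> powi n * (if ?p dvd n - j then apply_bcontfun (a n) x else 0)))"
    by (simp only: infsum_cmult_right')
  also have "\<dots> = (\<Sum>\<^sub>\<infinity>n. \<mu> powi n * (if ?p dvd n then apply_bcontfun (a (n + j)) x else 0))"
    by (rule infsum_reindex_bij_witness[of _ "\<lambda>n. n + j" "\<lambda>n. n - j"])
       (use \<open>\<mu> \<noteq> 0\<close> in \<open>auto simp: power_int_diff power_int_minus field_simps\<close>)
  finally show ?thesis by simp
qed

text \<open>Some element of \<open>K\<close> has a nonzero sum over a residue class. A power of
  \<delta> moves this class to the multiples of the period, and a function that is 1 at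
  \<open>x\<close> and 0 on the rest of its orbit erases the other classes at
  \<open>x\<close>.\<close>

lemma pure_kernel_element:
  assumes x: "x \<in> Per \<sigma>" and \<mu>: "norm \<mu> = 1" and nz: "(x, \<mu>) \<notin> zero_set K"
  obtains b where "b \<in> K" "\<And>n. \<not> int (period \<sigma> x) dvd n \<Longrightarrow> apply_bcontfun (b n) x = 0"
    "(\<Sum>\<^sub>\<infinity>n. \<mu> powi n * apply_bcontfun (b n) x) \<noteq> 0"
proof -
  let ?p = "int (period \<sigma> x)"
  note p = period_props[OF x]
  obtain b0 where b0: "b0 \<in> K" "\<not> vanishes b0 x \<mu>"
    using nz \<mu> by (auto simp: zero_set_iff[OF K_ideal])
  then obtain i where "entry b0 x \<mu> (it i x) \<noteq> 0" using vanishes_Per[OF x, of b0 0 \<mu>] by auto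
  then have i: "entry b0 x \<mu> (it (- (- i)) x) \<noteq> 0" by simp
  define Y where "Y = (\<lambda>n. it (- n) x) ` {0..<?p} - {x}"
  have "finite Y" by (simp add: Y_def)
  then have Yo: "open (- Y)" by (intro open_Compl finite_imp_closed)
  have xY: "x \<in> - Y" by (simp add: Y_def)
  obtain g :: "'a \<Rightarrow>\<^sub>C complex" and g' where
    g: "\<And>y. apply_bcontfun g y = of_real (g' y)" "\<And>y. 0 \<le> g' y" "\<And>y. g' y \<le> 1"
    "g' x = 1" "\<And>y. y \<notin> - Y \<Longrightarrow> g' y = 0"
    by (rule urysohn_point[OF compact_X Yo xY]) (rule that)
  have gn: "apply_bcontfun g (it (- n) x) = (if ?p dvd n then 1 else 0)" for n
  proof (cases "?p dvd n")
    case True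
    then have "it (- n) x = x" using p(3)[of "- n"] by simp
    then show ?thesis using True g by simp
  next
    case False
    have "?p dvd (n mod ?p) - n" by (metis dvd_minus_mod dvd_minus_iff minus_diff_eq)
    then have "it (- n) x = it (- (n mod ?p)) x"
      using p(3)[of "(n mod ?p) - n"] it_eq_iff[of "- n" x "- (n mod ?p)"] by (simp add: algebra_simps)
    moreover have "it (- n) x \<noteq> x" using p(3)[of "- n"] False by simp
    ultimately have "it (- n) x \<in> Y" using p(1) by (auto simp: Y_def)
    then show ?thesis using False g by simp
  qed
  define b where "b = mul (mul b0 (dl i)) (fn g)"
  have bn: "apply_bcontfun (b n) x = (if ?p dvd n then apply_bcontfun (b0 (n + - i)) x else 0)" for n
    by (simp add: b_def mul_fn_right mul_dl apply_cf_mult gn)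
  have "(\<Sum>\<^sub>\<infinity>n. \<mu> powi n * apply_bcontfun (b n) x) = \<mu> powi i * entry b0 x \<mu> (it i x)"
    unfolding bn residue_sum[OF x \<mu>] by simp
  also have "\<dots> \<noteq> 0" using i \<mu> by auto
  finally have "(\<Sum>\<^sub>\<infinity>n. \<mu> powi n * apply_bcontfun (b n) x) \<noteq> 0" .
  moreover have "b \<in> K" unfolding b_def using b0 by (intro K_mul) auto
  ultimately show ?thesis using that[of b] bn by simp
qed

text \<open>The origin is cut out because negative powers occur.\<close>

lemma open_trig_poly:
  fixes c :: "int \<Rightarrow> complex"
  assumes "finite A"
  shows "open {\<mu>. \<mu> \<noteq> 0 \<and> r < norm (\<Sum>n\<in>A. c n * \<mu> powi n)}"
    "open {\<mu>. \<mu> \<noteq> 0 \<and> norm (\<Sum>n\<in>A. c n * \<mu> powi n) < r}"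
proof -
  have c: "continuous_on (- {0}) (\<lambda>\<mu>. norm (\<Sum>n\<in>A. c n * \<mu> powi n))"
    by (intro continuous_intros) auto
  have o: "open (- {0 :: complex})" by auto
  from continuous_open_preimage[OF c o, of "{r<..}"]
  show "open {\<mu>. \<mu> \<noteq> 0 \<and> r < norm (\<Sum>n\<in>A. c n * \<mu> powi n)}" by (simp add: vimage_def Int_def)
  from continuous_open_preimage[OF c o, of "{..<r}"]
  show "open {\<mu>. \<mu> \<noteq> 0 \<and> norm (\<Sum>n\<in>A. c n * \<mu> powi n) < r}" by (simp add: vimage_def Int_def)
qed

lemma trig_poly_truncation:
  fixes c :: "int \<Rightarrow> complex"
  assumes a: "a \<in> l1" and c: "\<And>n. norm (c n) \<le> norm (a n :: 'a \<Rightarrow>\<^sub>C complex)" and \<mu>: "norm \<mu> = 1" and L: "L0 \<le> L"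
  shows "norm ((\<Sum>n\<in>{- int L..int L}. c n * \<mu> powi n) - (\<Sum>n\<in>{- int L0..int L0}. c n * \<mu> powi n)) \<le>
    l1_norm (l1_cut (- {- int L0..int L0}) a)"
proof -
  let ?A = "{- int L..int L}" and ?B = "{- int L0..int L0}"
  have "(\<Sum>n\<in>?A. c n * \<mu> powi n) - (\<Sum>n\<in>?B. c n * \<mu> powi n) = (\<Sum>n\<in>?A - ?B. c n * \<mu> powi n)"
    using L by (subst sum_diff) auto
  also have "norm \<dots> \<le> (\<Sum>n\<in>?A - ?B. norm (l1_cut (- ?B) a n))"
    using c \<mu> by (intro sum_norm_le) (auto simp: norm_mult norm_power_int l1_cut_def)
  also have "\<dots> \<le> l1_norm (l1_cut (- ?B) a)" using a by (intro l1_sum_le_norm) auto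
  finally show ?thesis .
qed

text \<open>Near a phase in the fibre of the zero set the residue sums of \<open>a\<close> are
  small; near any other phase an element from \<open>pure_kernel_element\<close> is bounded below.
  Finitely many neighbourhoods cover the circle. Uniformity in \<open>L\<close> matters because the
  degree is chosen only after \<open>B\<close> and \<open>c\<close>.\<close>

lemma circle_alternative:
  assumes a: "a \<in> vanishing_ideal \<sigma> (zero_set K)" and x: "x \<in> Per \<sigma>" and e: "0 < e"
  defines "\<alpha> \<equiv> \<lambda>j n. if int (period \<sigma> x) dvd n then apply_bcontfun (a (n + j)) x else 0"
  obtains B c L0 where "finite B" "B \<subseteq> {b \<in> K. \<forall>n. \<not> int (period \<sigma> x) dvd n \<longrightarrow> apply_bcontfun (b n) x = 0}"
    "0 < c" "\<And>L \<mu>. L0 \<le> L \<Longrightarrow> norm \<mu> = 1 \<Longrightarrow>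
      (\<forall>j\<in>{0..<int (period \<sigma> x)}. norm (\<Sum>n\<in>{- int L..int L}. \<alpha> j n * \<mu> powi n) \<le> e) \<or>
      (\<exists>b\<in>B. c \<le> norm (\<Sum>n\<in>{- int L..int L}. apply_bcontfun (b n) x * \<mu> powi n))"
proof -
  let ?p = "int (period \<sigma> x)"
  define P where "P = {b \<in> K. \<forall>n. \<not> ?p dvd n \<longrightarrow> apply_bcontfun (b n) x = 0}"
  define Q where "Q U B c L0 \<longleftrightarrow> finite B \<and> B \<subseteq> P \<and> (0::real) < c \<and> (\<forall>L \<mu>. L0 \<le> L \<longrightarrow> norm \<mu> = 1 \<longrightarrow> \<mu> \<in> U \<longrightarrow>
      (\<forall>j\<in>{0..<?p}. norm (\<Sum>n\<in>{- int L..int L}. \<alpha> j n * \<mu> powi n) \<le> e) \<or>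
      (\<exists>b\<in>B. c \<le> norm (\<Sum>n\<in>{- int L..int L}. apply_bcontfun (b n) x * \<mu> powi n)))" for U B c and L0 :: nat
  have al: "a \<in> l1" and av: "\<And>\<mu>. (x, \<mu>) \<in> zero_set K \<Longrightarrow> vanishes a x \<mu>"
    using a by (auto simp: vanishing_ideal_iff[OF zero_set_circle])
  have aj: "(\<lambda>n. a (n + j)) \<in> l1" for j
    using mul_in[OF al l1_mono_in, of "const_bcontfun 1" "- j"] by (simp add: mul_dl)
  have \<alpha>b: "norm (\<alpha> j n) \<le> norm (a (n + j))" for j n by (simp add: \<alpha>_def norm_bounded)
  have "\<exists>U B c L0. open U \<and> \<mu> \<in> U \<and> Q U B c L0" if \<mu>: "norm \<mu> = 1" for \<mu>
  proof (cases "(x, \<mu>) \<in> zero_set K")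
    case True
    have "\<forall>j\<in>{0..<?p}. \<exists>N. \<forall>M\<ge>N. l1_norm (l1_cut (- {- int M..int M}) (\<lambda>n. a (n + j))) < e / 2"
      using l1_tail_small[OF aj, of "e / 2"] e by (metis half_gt_zero)
    then obtain N where N: "\<forall>j\<in>{0..<?p}. \<forall>M\<ge>N j. l1_norm (l1_cut (- {- int M..int M}) (\<lambda>n. a (n + j))) < e / 2"
      by metis
    define L0 where "L0 = Max (insert 0 (N ` {0..<?p}))"
    have L0: "l1_norm (l1_cut (- {- int L0..int L0}) (\<lambda>n. a (n + j))) < e / 2" if "j \<in> {0..<?p}" for j
      using N that by (auto simp: L0_def)
    define U where "U = (\<Inter>j\<in>{0..<?p}. {\<nu>. \<nu> \<noteq> 0 \<and> norm (\<Sum>n\<in>{- int L0..int L0}. \<alpha> j n * \<nu> powi n) < e / 2})"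
    have "open U" unfolding U_def by (intro open_INT ballI open_trig_poly) auto
    moreover have "\<mu> \<in> U"
      unfolding U_def
    proof (intro INT_I CollectI conjI)
      show "\<mu> \<noteq> 0" using \<mu> by auto
      fix j assume j: "j \<in> {0..<?p}"
      have "(\<Sum>\<^sub>\<infinity>n. \<mu> powi n * \<alpha> j n) = 0"
        unfolding \<alpha>_def residue_sum[OF x \<mu>] using av[OF True] by (simp add: vanishes_def)
      then show "norm (\<Sum>n\<in>{- int L0..int L0}. \<alpha> j n * \<mu> powi n) < e / 2"
        using infsum_truncate[OF aj \<alpha>b \<mu>, of j L0] L0[OF j] by simp
    qed
    \<comment> \<open>Only the first alternative occurs here; 1 is a dummy lower bound.\<close>
    moreover have "Q U {} 1 L0"
      unfolding Q_def
    proof (intro conjI allI impI disjI1 ballI)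
      fix L \<nu> j assume L: "L0 \<le> L" and \<nu>: "norm (\<nu> :: complex) = 1" "\<nu> \<in> U" and j: "j \<in> {0..<?p}"
      have "norm (\<Sum>n\<in>{- int L..int L}. \<alpha> j n * \<nu> powi n) \<le>
          norm (\<Sum>n\<in>{- int L0..int L0}. \<alpha> j n * \<nu> powi n) + l1_norm (l1_cut (- {- int L0..int L0}) (\<lambda>n. a (n + j)))"
        using trig_poly_truncation[OF aj \<alpha>b \<nu>(1) L, of j]
          norm_triangle_ineq2[of "\<Sum>n\<in>{- int L..int L}. \<alpha> j n * \<nu> powi n"
            "\<Sum>n\<in>{- int L0..int L0}. \<alpha> j n * \<nu> powi n"] by linarith
      also have "norm (\<Sum>n\<in>{- int L0..int L0}. \<alpha> j n * \<nu> powi n) < e / 2"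
        using \<nu>(2) j unfolding U_def by blast
      also note L0[OF j]
      finally show "norm (\<Sum>n\<in>{- int L..int L}. \<alpha> j n * \<nu> powi n) \<le> e" by simp
    qed auto
    ultimately show ?thesis by blast
  next
    case False
    obtain b where b: "b \<in> P" and nz: "(\<Sum>\<^sub>\<infinity>n. \<mu> powi n * apply_bcontfun (b n) x) \<noteq> 0"
      using pure_kernel_element[OF x \<mu> False] unfolding P_def by blast
    have bl: "b \<in> l1" using b K_l1 by (simp add: P_def)
    \<comment> \<open>A quarter of the full sum: truncation at \<open>L0\<close> leaves more than 2
      c at \<mu>, the neighbourhood \<open>U\<close> preserves this, and longer truncations change
      it by less than \<open>c\<close>.\<close>
    define c where "c = norm (\<Sum>\<^sub>\<infinity>n. \<mu> powi n * apply_bcontfun (b n) x) / 4"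
    have c: "0 < c" using nz by (simp add: c_def)
    obtain L0 where L0: "l1_norm (l1_cut (- {- int L0..int L0}) b) < c" using l1_tail_small[OF bl c] by blast
    define U where "U = {\<nu>. \<nu> \<noteq> 0 \<and> 2 * c < norm (\<Sum>n\<in>{- int L0..int L0}. apply_bcontfun (b n) x * \<nu> powi n)}"
    have "open U" unfolding U_def by (intro open_trig_poly) auto
    moreover have "\<mu> \<in> U"
    proof -
      have "norm ((\<Sum>\<^sub>\<infinity>n. \<mu> powi n * apply_bcontfun (b n) x) - (\<Sum>n\<in>{- int L0..int L0}. apply_bcontfun (b n) x * \<mu> powi n)) < c"
        using infsum_truncate[OF bl, of "\<lambda>n. apply_bcontfun (b n) x" \<mu> L0, OF norm_bounded \<mu>] L0 by simp
      moreover have "norm (\<Sum>\<^sub>\<infinity>n. \<mu> powi n * apply_bcontfun (b n) x) = 4 * c" by (simp add: c_def)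
      moreover note norm_triangle_ineq2[of "\<Sum>\<^sub>\<infinity>n. \<mu> powi n * apply_bcontfun (b n) x"
          "\<Sum>n\<in>{- int L0..int L0}. apply_bcontfun (b n) x * \<mu> powi n"]
      ultimately have "2 * c < norm (\<Sum>n\<in>{- int L0..int L0}. apply_bcontfun (b n) x * \<mu> powi n)"
        using c by linarith
      moreover have "\<mu> \<noteq> 0" using \<mu> by auto
      ultimately show ?thesis by (simp add: U_def)
    qed
    moreover have "Q U {b} c L0"
      unfolding Q_def
    proof (intro conjI allI impI disjI2)
      fix L \<nu> assume L: "L0 \<le> L" and \<nu>: "norm (\<nu> :: complex) = 1" "\<nu> \<in> U"
      have "norm ((\<Sum>n\<in>{- int L..int L}. apply_bcontfun (b n) x * \<nu> powi n) -
          (\<Sum>n\<in>{- int L0..int L0}. apply_bcontfun (b n) x * \<nu> powi n)) < c"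
        using trig_poly_truncation[OF bl, of "\<lambda>n. apply_bcontfun (b n) x" \<nu> L0 L, OF norm_bounded \<nu>(1) L] L0 by simp
      moreover have "2 * c < norm (\<Sum>n\<in>{- int L0..int L0}. apply_bcontfun (b n) x * \<nu> powi n)"
        using \<nu>(2) by (simp add: U_def)
      moreover note norm_triangle_ineq2[of "\<Sum>n\<in>{- int L0..int L0}. apply_bcontfun (b n) x * \<nu> powi n"
          "\<Sum>n\<in>{- int L..int L}. apply_bcontfun (b n) x * \<nu> powi n"]
      moreover note norm_minus_commute[of "\<Sum>n\<in>{- int L0..int L0}. apply_bcontfun (b n) x * \<nu> powi n"
          "\<Sum>n\<in>{- int L..int L}. apply_bcontfun (b n) x * \<nu> powi n"]
      ultimately have "c \<le> norm (\<Sum>n\<in>{- int L..int L}. apply_bcontfun (b n) x * \<nu> powi n)" by linarith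
      then show "\<exists>b\<in>{b}. c \<le> norm (\<Sum>n\<in>{- int L..int L}. apply_bcontfun (b n) x * \<nu> powi n)" by simp
    qed (use b c in auto)
    ultimately show ?thesis by blast
  qed
  then obtain U B c L0 where U: "\<And>\<mu>. norm \<mu> = 1 \<Longrightarrow> open (U \<mu>) \<and> \<mu> \<in> U \<mu> \<and> Q (U \<mu>) (B \<mu>) (c \<mu>) (L0 \<mu>)"
    by metis
  have "unit_circle \<subseteq> (\<Union>\<mu>\<in>unit_circle. U \<mu>)" using U by auto
  then obtain D where D: "D \<subseteq> unit_circle" "finite D" "unit_circle \<subseteq> (\<Union>\<mu>\<in>D. U \<mu>)"
    using compactE_image[of unit_circle unit_circle U] U by (metis compact_sphere dist_0_norm mem_sphere)
  have QD: "Q (U \<mu>) (B \<mu>) (c \<mu>) (L0 \<mu>)" if "\<mu> \<in> D" for \<mu> using U D(1) that by auto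
  define c0 where "c0 = Min (insert 1 (c ` D))"
  define L1 where "L1 = Max (insert 0 (L0 ` D))"
  show ?thesis
  proof (rule that[of "\<Union>\<mu>\<in>D. B \<mu>" c0 L1])
    show "finite (\<Union>\<mu>\<in>D. B \<mu>)" using D(2) QD by (auto simp: Q_def)
    show "(\<Union>\<mu>\<in>D. B \<mu>) \<subseteq> {b \<in> K. \<forall>n. \<not> ?p dvd n \<longrightarrow> apply_bcontfun (b n) x = 0}"
      using QD unfolding Q_def P_def by blast
    show "0 < c0" using D(2) QD by (auto simp: c0_def Q_def)
    fix L \<mu> assume L: "L1 \<le> L" and \<mu>: "norm (\<mu> :: complex) = 1"
    obtain \<nu> where \<nu>: "\<nu> \<in> D" "\<mu> \<in> U \<nu>" using D(3) \<mu> by auto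
    have "L0 \<nu> \<le> L1" "c0 \<le> c \<nu>" using \<nu>(1) D(2) by (auto simp: L1_def c0_def intro: Max_ge Min_le)
    moreover have "(\<forall>j\<in>{0..<?p}. norm (\<Sum>n\<in>{- int L..int L}. \<alpha> j n * \<mu> powi n) \<le> e) \<or>
      (\<exists>b\<in>B \<nu>. c \<nu> \<le> norm (\<Sum>n\<in>{- int L..int L}. apply_bcontfun (b n) x * \<mu> powi n))"
      using QD[OF \<nu>(1)] L \<mu> \<nu>(2) \<open>L0 \<nu> \<le> L1\<close> order_trans unfolding Q_def by blast
    ultimately show "(\<forall>j\<in>{0..<?p}. norm (\<Sum>n\<in>{- int L..int L}. \<alpha> j n * \<mu> powi n) \<le> e) \<or>
      (\<exists>b\<in>(\<Union>\<mu>\<in>D. B \<mu>). c0 \<le> norm (\<Sum>n\<in>{- int L..int L}. apply_bcontfun (b n) x * \<mu> powi n))"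
      using \<nu>(1) order_trans by blast
  qed
qed


lemma norm_rho_sub:
  assumes "a \<in> l1" "b \<in> l1" "u \<in> vecs H"
  shows "nrm (\<rho> (l1_sub a b) u) \<le> nrm (\<rho> a u) + nrm (\<rho> b u)"
  using norm_rho_add[of a "l1_scale (-1) b" u] assms
  by (simp add: l1_sub_eq rho_scale norm_scale)

lemma norm_rho_sum:
  assumes "finite J" "\<And>j. j \<in> J \<Longrightarrow> X j \<in> l1" "w \<in> vecs H"
  shows "(\<lambda>n. \<Sum>j\<in>J. X j n) \<in> l1 \<and> nrm (\<rho> (\<lambda>n. \<Sum>j\<in>J. X j n) w) \<le> (\<Sum>j\<in>J. nrm (\<rho> (X j) w))"
  using assms
proof (induction J rule: finite_induct)
  case empty
  have "(\<lambda>n. 0) = fn 0" by (auto simp: l1_mono_def)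
  then show ?case using empty norm_zero_iff[OF zero_closed] by (simp add: rho_fn_zero)
next
  case (insert i J)
  have IH: "(\<lambda>n. \<Sum>j\<in>J. X j n) \<in> l1" "nrm (\<rho> (\<lambda>n. \<Sum>j\<in>J. X j n) w) \<le> (\<Sum>j\<in>J. nrm (\<rho> (X j) w))"
    using insert by auto
  have "(\<lambda>n. \<Sum>j\<in>insert i J. X j n) = l1_add (X i) (\<lambda>n. \<Sum>j\<in>J. X j n)"
    using insert(1,2) by (simp add: l1_add_def)
  then show ?case using norm_rho_add[of "X i" "\<lambda>n. \<Sum>j\<in>J. X j n" w] IH insert by simp
qed

text \<open>The coefficients of \<open>d\<close> are frozen at their values at \<open>x\<close>. Up
  to degree \<open>S\<close> all are kept, beyond \<open>G\<close> none; in between either is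
  allowed, because truncating each residue class separately gives no common cut-off degree. Freezing
  costs \<eta> per degree up to \<open>G\<close>, dropping costs the tail beyond
  \<open>S\<close>.\<close>

lemma approximation_error:
  fixes S G :: nat
  assumes d: "d \<in> l1" and SG: "S \<le> G" and \<eta>: "0 \<le> \<eta>" and w: "w \<in> vecs H"
    and \<gamma>: "\<And>n. \<gamma> n = apply_bcontfun (d n) x \<or> \<gamma> n = 0" "\<And>n. \<bar>n\<bar> \<le> int S \<Longrightarrow> \<gamma> n = apply_bcontfun (d n) x"
      "\<And>n. int G < \<bar>n\<bar> \<Longrightarrow> \<gamma> n = 0"
    and f: "\<And>y n. y \<in> F \<Longrightarrow> apply_bcontfun f (it n y) = apply_bcontfun f y"
    and \<kappa>: "\<And>y. y \<in> F \<Longrightarrow> norm (apply_bcontfun \<kappa> y) \<le> norm (apply_bcontfun f y)"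
    and V: "\<And>y n. y \<in> F \<Longrightarrow> apply_bcontfun \<kappa> y \<noteq> 0 \<Longrightarrow> \<bar>n\<bar> \<le> int G \<Longrightarrow>
      norm (apply_bcontfun (d n) y - apply_bcontfun (d n) x) \<le> \<eta>"
  shows "(\<lambda>n. cf_mult \<kappa> (d n - const_bcontfun (\<gamma> n))) \<in> l1"
    "nrm (\<rho> (\<lambda>n. cf_mult \<kappa> (d n - const_bcontfun (\<gamma> n))) w) \<le>
      ((2 * real G + 1) * \<eta> + l1_norm (l1_cut (- {- int S..int S}) d)) * nrm (\<rho> (fn f) w)"
proof -
  let ?c = "\<lambda>n. cf_mult \<kappa> (d n - const_bcontfun (\<gamma> n))"
  let ?t1 = "\<lambda>n. if n \<in> {- int G..int G} then \<eta> else 0" and ?t2 = "\<lambda>n. norm (l1_cut (- {- int S..int S}) d n)"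
  have "?c = l1_sub (mul (fn \<kappa>) d) (mul (fn \<kappa>) (sp {- int G..int G} \<gamma>))"
    unfolding mul_fn_left l1_sub_def
  proof (intro ext bcontfun_eqI)
    fix n y
    show "apply_bcontfun (?c n) y = apply_bcontfun (cf_mult \<kappa> (d n) - cf_mult \<kappa> (sp {- int G..int G} \<gamma> n)) y"
      using \<gamma>(3)[of n] by (auto simp: apply_cf_mult sp_def l1_cut_def algebra_simps)
  qed
  then show c: "?c \<in> l1" using d by simp
  have h1: "(?t1 has_sum ((2 * real G + 1) * \<eta>)) UNIV"
    by (rule has_sum_finite_neutralI[of "{- int G..int G}"]) auto
  have h2: "(?t2 has_sum l1_norm (l1_cut (- {- int S..int S}) d)) UNIV"
    unfolding l1_norm_def using l1_cut_in[OF d] by (intro has_sum_infsum) (simp add: l1_iff)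
  note h = has_sum_add[OF h1 h2]
  have "nrm (\<rho> ?c w) \<le> infsum (\<lambda>n. ?t1 n + ?t2 n) UNIV * nrm (\<rho> (fn f) w)"
  proof (rule norm_rho_dominated[OF c has_sum_imp_summable[OF h] _ w f])
    show "0 \<le> ?t1 n + ?t2 n" for n using \<eta> by simp
    fix y n assume y: "y \<in> F"
    show "norm (apply_bcontfun (?c n) y) \<le> (?t1 n + ?t2 n) * norm (apply_bcontfun f y)"
    proof (cases "apply_bcontfun \<kappa> y = 0")
      case True
      then show ?thesis using \<eta> by (simp add: apply_cf_mult)
    next
      case False
      have "norm (apply_bcontfun (d n) y - \<gamma> n) \<le> ?t1 n + ?t2 n"
      proof (cases "\<gamma> n = apply_bcontfun (d n) x \<and> \<bar>n\<bar> \<le> int G")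
        case True
        then show ?thesis using V[OF y False, of n] by (auto simp: abs_le_iff intro: add_increasing2)
      next
        case nG: False
        then have "\<gamma> n = 0" using \<gamma>(1,3)[of n] by force
        moreover have "n \<notin> {- int S..int S}" using nG \<gamma>(2)[of n] SG by force
        ultimately show ?thesis using norm_bounded[of "d n" y] \<eta> by (simp add: l1_cut_def)
      qed
      then have "norm (apply_bcontfun \<kappa> y) * norm (apply_bcontfun (d n) y - \<gamma> n) \<le>
          norm (apply_bcontfun f y) * (?t1 n + ?t2 n)"
        using \<kappa>[OF y] by (intro mult_mono) auto
      then show ?thesis by (simp add: apply_cf_mult norm_mult mult.commute)
    qed
  qed
  also have "infsum (\<lambda>n. ?t1 n + ?t2 n) UNIV = (2 * real G + 1) * \<eta> + l1_norm (l1_cut (- {- int S..int S}) d)"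
    by (rule infsumI[OF h])
  finally show "nrm (\<rho> ?c w) \<le> ((2 * real G + 1) * \<eta> + l1_norm (l1_cut (- {- int S..int S}) d)) * nrm (\<rho> (fn f) w)" .
qed

text \<open>Near \<open>x\<close> the product \<kappa> a is close to a sum over residues
  \<open>j\<close> of polynomials in \<delta>^p, with constant coefficients, times \<kappa>
  \<delta>^j. Each polynomial is dominated through \<open>circle_alternative\<close> by a small
  constant and by polynomials frozen from elements of the kernel, which nearly annihilate the
  vectors in question.\<close>

lemma periodic_localisation:
  assumes a: "a \<in> vanishing_ideal \<sigma> (zero_set K)" and x: "x \<in> Per \<sigma>" and e: "0 < e"
  obtains V where "open V" "x \<in> V"
    "\<And>\<kappa> f w. \<lbrakk>\<And>y. y \<in> F \<Longrightarrow> apply_bcontfun \<kappa> (it (int (period \<sigma> x)) y) = apply_bcontfun \<kappa> y;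
      \<And>y n. y \<in> F \<Longrightarrow> apply_bcontfun f (it n y) = apply_bcontfun f y;
      \<And>y. y \<in> F \<Longrightarrow> norm (apply_bcontfun \<kappa> y) \<le> norm (apply_bcontfun f y);
      \<And>y. y \<in> F \<Longrightarrow> apply_bcontfun \<kappa> y \<noteq> 0 \<Longrightarrow> y \<in> V; w \<in> vecs H\<rbrakk>
      \<Longrightarrow> nrm (\<rho> (mul (fn \<kappa>) a) w) \<le> e * nrm (\<rho> (fn f) w)"
proof -
  define p where "p = period \<sigma> x"
  have p: "0 < p" using period_props(1)[OF x] by (simp add: p_def)
  define e1 where "e1 = e / (4 * real p)"
  have e1: "0 < e1" using e p by (simp add: e1_def)
  have al: "a \<in> l1" using a by (simp add: vanishing_ideal_def)
  define \<alpha> where "\<alpha> j n = (if int p dvd n then apply_bcontfun (a (n + j)) x else 0)" for j n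
  obtain B c L0 where B: "finite B" "B \<subseteq> {b \<in> K. \<forall>n. \<not> int p dvd n \<longrightarrow> apply_bcontfun (b n) x = 0}"
    and c: "0 < c" and alt: "\<And>L \<mu>. L0 \<le> L \<Longrightarrow> norm \<mu> = 1 \<Longrightarrow>
      (\<forall>j\<in>{0..<int p}. norm (\<Sum>n\<in>{- int L..int L}. \<alpha> j n * \<mu> powi n) \<le> e1) \<or>
      (\<exists>b\<in>B. c \<le> norm (\<Sum>n\<in>{- int L..int L}. apply_bcontfun (b n) x * \<mu> powi n))"
    by (rule circle_alternative[OF a x e1, folded p_def, folded \<alpha>_def]) (rule that)
  define Na where "Na = l1_norm a"
  have Na: "0 \<le> Na" by (simp add: Na_def)
  \<comment> \<open>If a polynomial from \<open>B\<close> has modulus at least \<open>c\<close>,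
    then \<open>C\<close> times its square reaches the square of the bound \<open>Na\<close> on the
    residue polynomials.\<close>
  define C where "C = (Na / c)\<^sup>2"
  have bound: "norm (\<Sum>n\<in>{- int L..int L}. \<alpha> j n * \<mu> powi n) \<le> Na" if \<mu>: "norm \<mu> = 1" for L j \<mu>
  proof -
    have aj: "mul a (dl (- j)) \<in> l1" using al by simp
    have "norm (\<Sum>n\<in>{- int L..int L}. \<alpha> j n * \<mu> powi n) \<le> (\<Sum>n\<in>{- int L..int L}. norm (mul a (dl (- j)) n))"
      by (intro sum_norm_le) (simp add: norm_mult norm_power_int \<mu> \<alpha>_def mul_dl norm_bounded)
    also have "\<dots> \<le> l1_norm (mul a (dl (- j)))" by (rule l1_sum_le_norm[OF aj]) simp
    also have "\<dots> \<le> l1_norm a * l1_norm (dl (- j) :: int \<Rightarrow> ('a \<Rightarrow>\<^sub>C complex))" using al by (intro l1_norm_mul) auto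
    also have "\<dots> \<le> Na * 1"
      unfolding Na_def using norm_const_le[where ?'a = 'a, of 1] by (intro mult_left_mono) auto
    finally show ?thesis by simp
  qed
  \<comment> \<open>Two demands: the freezing error of \<open>a\<close> may be at most e / 2, and
    the errors of all elements of \<open>B\<close> together, weighted by \<open>C\<close>, must stay
    below the square of \<open>e1\<close>, which is \<open>Ce\<close>.\<close>
  define e2 where "e2 = min (e / 2) (e1 / (Na / c * real (card B) + 1))"
  have D: "0 < Na / c * real (card B) + 1" using Na c by (simp add: add_nonneg_pos)
  have e2: "0 < e2" "e2 \<le> e / 2" "e2 \<le> e1 / (Na / c * real (card B) + 1)"
    unfolding e2_def by (rule min.cobounded1 min.cobounded2 | simp only: min_less_iff_conj, use e e1 D in simp)+
  have Ce: "C * (real (card B) * e2\<^sup>2) \<le> e1\<^sup>2"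
  proof -
    have "(Na / c * real (card B)) * e2 \<le> (Na / c * real (card B) + 1) * (e1 / (Na / c * real (card B) + 1))"
      using D Na c e1 e2 by (intro mult_mono) auto
    also have "\<dots> = e1" using D by simp
    finally have "((Na / c * real (card B)) * e2)\<^sup>2 \<le> e1\<^sup>2" using Na c e2 by (intro power_mono) auto
    moreover have "real (card B) \<le> (real (card B))\<^sup>2"
      by (cases "card B") (auto simp: power2_eq_square)
    then have "C * (real (card B) * e2\<^sup>2) \<le> C * ((real (card B))\<^sup>2 * e2\<^sup>2)"
      by (intro mult_left_mono mult_right_mono) (auto simp: C_def)
    moreover have "C * ((real (card B))\<^sup>2 * e2\<^sup>2) = ((Na / c * real (card B)) * e2)\<^sup>2"
      unfolding C_def by (simp only: power_mult_distrib mult.assoc)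
    ultimately show ?thesis by linarith
  qed
  have "\<forall>d\<in>insert a B. \<exists>N. \<forall>M\<ge>N. l1_norm (l1_cut (- {- int M..int M}) d) < e2 / 2"
  proof
    fix d assume "d \<in> insert a B"
    then have "d \<in> l1" using al B(2) K_l1 by auto
    then show "\<exists>N. \<forall>M\<ge>N. l1_norm (l1_cut (- {- int M..int M}) d) < e2 / 2"
      using l1_tail_small[of d "e2 / 2"] e2 by (metis half_gt_zero)
  qed
  then obtain N where N: "\<forall>d\<in>insert a B. \<forall>M\<ge>N d. l1_norm (l1_cut (- {- int M..int M}) d) < e2 / 2"
    by metis
  \<comment> \<open>Reducing an index to a multiple of \<open>p\<close> moves it by less than
    \<open>p\<close>; the tails are therefore controlled from \<open>L - p\<close> on, and nothing
    is kept beyond G = L + p.\<close>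
  define L where "L = max L0 (Max (N ` insert a B) + p)"
  have L: "L0 \<le> L" by (simp add: L_def)
  have tail: "l1_norm (l1_cut (- {- int (L - p)..int (L - p)}) d) < e2 / 2" if "d \<in> insert a B" for d
  proof -
    have "N d \<le> Max (N ` insert a B)" using B(1) that by (intro Max_ge) auto
    then have "N d \<le> L - p" by (simp add: L_def)
    then show ?thesis using N that by blast
  qed
  have pL: "p \<le> L" by (simp add: L_def)
  define A where "A = {- int L..int L}"
  have A: "finite A" by (simp add: A_def)
  define G where "G = L + p"
  define \<eta> where "\<eta> = e2 / (2 * (2 * real G + 1))"
  have \<eta>: "0 < \<eta>" using e2 by (simp add: \<eta>_def)
  have err: "(2 * real G + 1) * \<eta> + l1_norm (l1_cut (- {- int (L - p)..int (L - p)}) d) \<le> e2" if "d \<in> insert a B" for d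
  proof -
    have "(2 * real G + 1) * \<eta> = e2 / 2" by (simp add: \<eta>_def field_simps)
    then show ?thesis using tail[OF that] by simp
  qed
  define V where "V = (\<Inter>d\<in>insert a B. \<Inter>n\<in>{- int G..int G}. {y. norm (apply_bcontfun (d n) y - apply_bcontfun (d n) x) < \<eta>})"
  have "open V"
    unfolding V_def using B(1)
    by (intro open_INT ballI finite_insert[THEN iffD2] finite_atLeastAtMost_int open_Collect_less continuous_intros) simp_all
  moreover have "x \<in> V" using \<eta> by (simp add: V_def)
  moreover have "nrm (\<rho> (mul (fn \<kappa>) a) w) \<le> e * nrm (\<rho> (fn f) w)"
    if \<kappa>p: "\<And>y. y \<in> F \<Longrightarrow> apply_bcontfun \<kappa> (it (int p) y) = apply_bcontfun \<kappa> y"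
      and f: "\<And>y n. y \<in> F \<Longrightarrow> apply_bcontfun f (it n y) = apply_bcontfun f y"
      and \<kappa>f: "\<And>y. y \<in> F \<Longrightarrow> norm (apply_bcontfun \<kappa> y) \<le> norm (apply_bcontfun f y)"
      and \<kappa>V: "\<And>y. y \<in> F \<Longrightarrow> apply_bcontfun \<kappa> y \<noteq> 0 \<Longrightarrow> y \<in> V" and w: "w \<in> vecs H" for \<kappa> f w
  proof -
    define R where "R = nrm (\<rho> (fn f) w)"
    have R: "0 \<le> R" using norm_nonneg w by (simp add: R_def)
    have Vd: "norm (apply_bcontfun (d n) y - apply_bcontfun (d n) x) \<le> \<eta>"
      if "d \<in> insert a B" "y \<in> F" "apply_bcontfun \<kappa> y \<noteq> 0" "\<bar>n\<bar> \<le> int G" for d y n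
    proof -
      have "y \<in> V" using \<kappa>V that by blast
      moreover have "n \<in> {- int G..int G}" using that(4) by auto
      ultimately have "norm (apply_bcontfun (d n) y - apply_bcontfun (d n) x) < \<eta>"
        using that(1) unfolding V_def by blast
      then show ?thesis by simp
    qed
    have Rj: "nrm (\<rho> (fn f) (\<rho> (dl j) w)) \<le> R" for j
      unfolding R_def using f w by (intro norm_invariant_fn) auto
    have scale: "cf_mult \<kappa> d = cf_mult \<kappa> (d - const_bcontfun g) + cf_scale g \<kappa>" for d g
      by (rule bcontfun_eqI) (simp add: apply_cf_mult apply_scale algebra_simps)

    \<comment> \<open>Up to the freezing error this vector is \<rho>(\<kappa> b) applied to
      \<rho>(\<delta>^j) w, which is 0 because \<open>b\<close> is in the kernel.\<close>
    have kernel_part: "nrm (\<rho> (sp A (\<lambda>n. apply_bcontfun (b n) x)) (\<rho> (fn \<kappa>) (\<rho> (dl j) w))) \<le> e2 * R"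
      if b: "b \<in> B" for b j
    proof -
      let ?w = "\<rho> (dl j) w" and ?\<beta> = "\<lambda>n. apply_bcontfun (b n) x"
      let ?\<gamma> = "\<lambda>n. if n \<in> A then ?\<beta> n else 0"
      let ?err = "\<lambda>n. cf_mult \<kappa> (b n - const_bcontfun (?\<gamma> n))"
      have bK: "b \<in> K" and pure: "\<And>n. \<not> int p dvd n \<Longrightarrow> ?\<beta> n = 0" using B(2) b by auto
      have bl: "b \<in> l1" using K_l1[OF bK] .
      have w': "?w \<in> vecs H" using w by simp
      have AE: "?err \<in> l1" "nrm (\<rho> ?err ?w) \<le>
          ((2 * real G + 1) * \<eta> + l1_norm (l1_cut (- {- int (L - p)..int (L - p)}) b)) * nrm (\<rho> (fn f) ?w)"
      proof -
        have g2: "?\<gamma> n = ?\<beta> n" if "\<bar>n\<bar> \<le> int (L - p)" for n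
          using that pL by (auto simp: A_def of_nat_diff)
        have g3: "?\<gamma> n = 0" if "int G < \<bar>n\<bar>" for n using that by (auto simp: A_def G_def)
        have "L - p \<le> G" by (simp add: G_def)
        note ae = approximation_error[OF bl this less_imp_le[OF \<eta>] w' _ g2 g3 f \<kappa>f Vd[of b]]
        show "?err \<in> l1" by (rule ae(1)) (use b in auto)
        show "nrm (\<rho> ?err ?w) \<le>
          ((2 * real G + 1) * \<eta> + l1_norm (l1_cut (- {- int (L - p)..int (L - p)}) b)) * nrm (\<rho> (fn f) ?w)"
          by (rule ae(2)) (use b in auto)
      qed
      have "\<rho> (sp A ?\<beta>) (\<rho> (fn \<kappa>) ?w) = \<rho> (sp A ?\<beta>) (\<rho> (fn \<kappa>) (\<rho> (dl 0) ?w))"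
        using w by (simp flip: rho_mul add: dl_dl)
      also have "\<dots> = \<rho> (\<lambda>n. if n - 0 \<in> A then cf_scale (?\<beta> (n - 0)) \<kappa> else 0) ?w"
        by (rule rho_cut_commute[OF \<kappa>p A _ w', symmetric]) (use pure in auto)
      also have "(\<lambda>n. if n - 0 \<in> A then cf_scale (?\<beta> (n - 0)) \<kappa> else 0) = l1_sub (mul (fn \<kappa>) b) ?err"
        unfolding mul_fn_left l1_sub_def
        by (intro ext bcontfun_eqI) (auto simp: apply_cf_mult apply_scale algebra_simps)
      finally have "nrm (\<rho> (sp A ?\<beta>) (\<rho> (fn \<kappa>) ?w)) \<le> nrm (\<rho> (mul (fn \<kappa>) b) ?w) + nrm (\<rho> ?err ?w)"
        using norm_rho_sub[of "mul (fn \<kappa>) b" ?err ?w] AE(1) bl w' by simp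
      also have "\<rho> (mul (fn \<kappa>) b) ?w = vzero H" using K_zero[OF K_mul(1)[OF bK, of "fn \<kappa>"] w'] by simp
      also have "nrm (vzero H) = 0" using norm_zero_iff[OF zero_closed] by simp
      also have "nrm (\<rho> ?err ?w) \<le> e2 * R"
      proof -
        have "((2 * real G + 1) * \<eta> + l1_norm (l1_cut (- {- int (L - p)..int (L - p)}) b)) * nrm (\<rho> (fn f) ?w) \<le> e2 * R"
          using err[of b] b Rj[of j] e2(1) norm_nonneg[of "\<rho> (fn f) ?w"] w' by (intro mult_mono) auto
        then show ?thesis using AE(2) by linarith
      qed
      finally show ?thesis by simp
    qed

    define X where "X j n = (if n - j \<in> A then cf_scale (\<alpha> j (n - j)) \<kappa> else 0)" for j n
    have Xl: "X j \<in> l1" for j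
    proof -
      have "X j = l1_cut ((\<lambda>n. n + j) ` A) (\<lambda>n. cf_scale (\<alpha> j (n - j)) \<kappa>)"
        unfolding X_def by (auto simp: l1_cut_def image_iff fun_eq_iff intro: exI[of _ "_ - j"])
      then show ?thesis using A by (simp add: cut_finite_in)
    qed
    have residue_part: "nrm (\<rho> (X j) w) \<le> e / (2 * real p) * R" if j: "j \<in> {0..<int p}" for j
    proof -
      let ?u = "\<rho> (fn \<kappa>) (\<rho> (dl j) w)"
      have u: "?u \<in> vecs H" using w by simp
      have uR: "nrm ?u \<le> R"
        using norm_fn_mono[of \<kappa> f "\<rho> (dl j) w"] \<kappa>f w Rj[of j] by force
      have Xeq: "\<rho> (X j) w = \<rho> (sp A (\<alpha> j)) ?u"
        unfolding X_def by (rule rho_cut_commute[OF \<kappa>p A _ w]) (auto simp: \<alpha>_def split: if_splits)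
      have "(nrm (\<rho> (sp A (\<alpha> j)) ?u))\<^sup>2 \<le> e1\<^sup>2 * (nrm ?u)\<^sup>2 +
          C * (\<Sum>b\<in>B. (nrm (\<rho> (sp A (\<lambda>n. apply_bcontfun (b n) x)) ?u))\<^sup>2)"
        unfolding A_def
      proof (rule norm_sp_inequality[OF u])
        fix z :: complex assume z: "norm z = 1"
        let ?h = "norm (\<Sum>k\<in>{- int L..int L}. \<alpha> j k * z powi k)"
        let ?S = "\<Sum>b\<in>B. (norm (\<Sum>k\<in>{- int L..int L}. apply_bcontfun (b k) x * z powi k))\<^sup>2"
        have S0: "0 \<le> C * ?S" by (simp add: C_def sum_nonneg)
        show "?h\<^sup>2 \<le> e1\<^sup>2 + C * ?S"
        proof (cases "?h \<le> e1")
          case True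
          then have "?h\<^sup>2 \<le> e1\<^sup>2" by (intro power_mono) auto
          then show ?thesis using S0 by linarith
        next
          case False
          then obtain b where b: "b \<in> B" "c \<le> norm (\<Sum>k\<in>{- int L..int L}. apply_bcontfun (b k) x * z powi k)"
            using alt[OF L z] j by auto
          have "?h\<^sup>2 \<le> Na\<^sup>2" using bound[OF z] by (intro power_mono) auto
          also have "\<dots> = C * c\<^sup>2" using c by (simp add: C_def power_divide)
          also have "c\<^sup>2 \<le> (norm (\<Sum>k\<in>{- int L..int L}. apply_bcontfun (b k) x * z powi k))\<^sup>2"
            using b c by (intro power_mono) auto
          also have "\<dots> \<le> ?S" using b(1) B(1) by (intro member_le_sum) auto
          finally show ?thesis using S0 by (simp add: C_def mult_left_mono add_increasing)
        qed
      qed simp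
      moreover have "(\<Sum>b\<in>B. (nrm (\<rho> (sp A (\<lambda>n. apply_bcontfun (b n) x)) ?u))\<^sup>2) \<le> (\<Sum>b\<in>B. (e2 * R)\<^sup>2)"
        using kernel_part u A by (intro sum_mono power_mono norm_nonneg) auto
      then have "C * (\<Sum>b\<in>B. (nrm (\<rho> (sp A (\<lambda>n. apply_bcontfun (b n) x)) ?u))\<^sup>2) \<le> C * (\<Sum>b\<in>B. (e2 * R)\<^sup>2)"
        by (intro mult_left_mono) (auto simp: C_def)
      moreover have "C * (\<Sum>b\<in>B. (e2 * R)\<^sup>2) \<le> e1\<^sup>2 * R\<^sup>2"
        using mult_right_mono[OF Ce, of "R\<^sup>2"] by (simp add: power_mult_distrib mult_ac)
      moreover have "e1\<^sup>2 * (nrm ?u)\<^sup>2 \<le> e1\<^sup>2 * R\<^sup>2"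
        using uR norm_nonneg[OF u] by (intro mult_left_mono power_mono) auto
      ultimately have "(nrm (\<rho> (X j) w))\<^sup>2 \<le> 2 * (e1\<^sup>2 * R\<^sup>2)" unfolding Xeq by linarith
      \<comment> \<open>Rounded up to the perfect square of 2 e1 R, where 2 e1 = e / (2 p).\<close>
      also have "\<dots> \<le> 4 * (e1\<^sup>2 * R\<^sup>2)" by simp
      also have "\<dots> = (e / (2 * real p) * R)\<^sup>2" by (simp add: e1_def power2_eq_square field_simps)
      finally show ?thesis by (rule power2_le_imp_le) (use e R in simp)
    qed

    \<comment> \<open>Exactly the coefficients that the parts \<open>X j\<close> collect: index
      \<open>n\<close> belongs to the residue n mod p and is kept when n - n mod p lies in the
      window \<open>A\<close>.\<close>
    define \<gamma> where "\<gamma> n = (if n - n mod int p \<in> A then apply_bcontfun (a n) x else 0)" for n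
    let ?err = "\<lambda>n. cf_mult \<kappa> (a n - const_bcontfun (\<gamma> n))"
    have md: "0 \<le> n mod int p" "n mod int p < int p" for n using p by simp_all
    have AE: "?err \<in> l1" "nrm (\<rho> ?err w) \<le>
        ((2 * real G + 1) * \<eta> + l1_norm (l1_cut (- {- int (L - p)..int (L - p)}) a)) * nrm (\<rho> (fn f) w)"
    proof -
      have g2: "\<gamma> n = apply_bcontfun (a n) x" if "\<bar>n\<bar> \<le> int (L - p)" for n
        using that md[of n] pL by (auto simp: \<gamma>_def A_def of_nat_diff)
      have g3: "\<gamma> n = 0" if "int G < \<bar>n\<bar>" for n
        using that md[of n] by (auto simp: \<gamma>_def A_def G_def)
      have "L - p \<le> G" by (simp add: G_def)
      note ae = approximation_error[OF al this less_imp_le[OF \<eta>] w _ g2 g3 f \<kappa>f Vd[of a]]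
      show "?err \<in> l1" by (rule ae(1)) (auto simp: \<gamma>_def)
      show "nrm (\<rho> ?err w) \<le>
        ((2 * real G + 1) * \<eta> + l1_norm (l1_cut (- {- int (L - p)..int (L - p)}) a)) * nrm (\<rho> (fn f) w)"
        by (rule ae(2)) (auto simp: \<gamma>_def)
    qed
    have sumX: "(\<Sum>j\<in>{0..<int p}. X j n) = cf_scale (\<gamma> n) \<kappa>" for n
    proof -
      have z: "cf_scale 0 \<kappa> = 0" by (rule bcontfun_eqI) (simp add: apply_scale)
      have "X j n = (if j = n mod int p then cf_scale (\<gamma> n) \<kappa> else 0)" if j: "j \<in> {0..<int p}" for j
      proof -
        have "int p dvd n - j \<longleftrightarrow> j = n mod int p"
          using j by (auto simp: mod_eq_dvd_iff[symmetric])
        then show ?thesis by (auto simp: X_def \<alpha>_def \<gamma>_def z)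
      qed
      then have "(\<Sum>j\<in>{0..<int p}. X j n) = (\<Sum>j\<in>{0..<int p}. if j = n mod int p then cf_scale (\<gamma> n) \<kappa> else 0)"
        by (rule sum.cong[OF refl])
      also have "\<dots> = cf_scale (\<gamma> n) \<kappa>" using md[of n] by simp
      finally show ?thesis .
    qed
    have dec: "mul (fn \<kappa>) a = l1_add ?err (\<lambda>n. \<Sum>j\<in>{0..<int p}. X j n)"
      unfolding mul_fn_left l1_add_def sumX by (intro ext scale)
    have SX: "(\<lambda>n. \<Sum>j\<in>{0..<int p}. X j n) \<in> l1"
      "nrm (\<rho> (\<lambda>n. \<Sum>j\<in>{0..<int p}. X j n) w) \<le> (\<Sum>j\<in>{0..<int p}. nrm (\<rho> (X j) w))"
      using norm_rho_sum[of "{0..<int p}" X w] Xl w by auto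
    have "nrm (\<rho> (mul (fn \<kappa>) a) w) \<le> nrm (\<rho> ?err w) + nrm (\<rho> (\<lambda>n. \<Sum>j\<in>{0..<int p}. X j n) w)"
      unfolding dec using AE SX w by (intro norm_rho_add) auto
    also have "nrm (\<rho> ?err w) \<le> e / 2 * R"
    proof -
      have "((2 * real G + 1) * \<eta> + l1_norm (l1_cut (- {- int (L - p)..int (L - p)}) a)) * R \<le> e / 2 * R"
        using err[of a] e2(2) R by (intro mult_right_mono) auto
      then show ?thesis using AE(2) by (simp add: R_def)
    qed
    also have "nrm (\<rho> (\<lambda>n. \<Sum>j\<in>{0..<int p}. X j n) w) \<le> e / 2 * R"
    proof -
      have "(\<Sum>j\<in>{0..<int p}. nrm (\<rho> (X j) w)) \<le> (\<Sum>j\<in>{0..<int p}. e / (2 * real p) * R)"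
        by (intro sum_mono residue_part)
      also have "\<dots> = e / 2 * R" using p by simp
      finally show ?thesis using SX(2) by linarith
    qed
    finally show ?thesis by (simp add: R_def field_simps)
  qed
  ultimately show ?thesis unfolding p_def by (rule that)
qed


section \<open>From local estimates to a global one\<close>

lemma norm_fn_sum:
  assumes "finite J" "u \<in> vecs H"
  shows "nrm (\<rho> (fn (\<Sum>j\<in>J. h j)) u) \<le> (\<Sum>j\<in>J. nrm (\<rho> (fn (h j)) u))"
  using assms
proof (induction J rule: finite_induct)
  case empty
  then show ?case using norm_zero_iff[OF zero_closed] by (simp add: rho_fn_zero)
next
  case (insert i J)
  then show ?case
    using norm_rho_add[of "fn (h i)" "fn (\<Sum>j\<in>J. h j)" u] by (simp add: fn_add)
qed

text \<open>A bump function at \<open>x\<close>, summed along \<open>m\<close> iterates, becomes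
  invariant on \<open>F\<close> when \<open>m\<close> is a return time near \<open>x\<close>. Since
  the period \<open>p\<close> divides \<open>m\<close>, the sum splits into \<open>p\<close> parts
  by the residue of the time; each is invariant under the p-th iterate and lives near one orbit
  point, so \<open>periodic_localisation\<close> applies with e / p.\<close>

lemma orbit_sum_localisation:
  assumes a: "a \<in> vanishing_ideal \<sigma> (zero_set K)" and x: "x \<in> F" "x \<in> Per \<sigma>"
    and \<mu>: "norm \<mu> = 1" "(x, \<mu>) \<notin> zero_set K" and e: "0 < e"
  obtains g :: "'a \<Rightarrow>\<^sub>C complex" and g' :: "'a \<Rightarrow> real" where
    "\<And>y. apply_bcontfun g y = of_real (g' y)" "\<And>y. 0 \<le> g' y" "1 \<le> g' x"
    "\<And>y n. y \<in> F \<Longrightarrow> g' (it n y) = g' y"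
    "\<And>\<theta> w. \<lbrakk>\<And>y n. y \<in> F \<Longrightarrow> apply_bcontfun \<theta> (it n y) = apply_bcontfun \<theta> y; w \<in> vecs H\<rbrakk>
      \<Longrightarrow> nrm (\<rho> (mul (fn (cf_mult \<theta> g)) a) w) \<le> e * nrm (\<rho> (fn (cf_mult \<theta> g)) w)"
proof -
  define p where "p = period \<sigma> x"
  note pp = period_props[OF x(2), folded p_def]
  obtain V1 and m :: nat where V1: "open V1" "x \<in> V1" "0 < m" "\<And>y. y \<in> V1 \<Longrightarrow> y \<in> F \<Longrightarrow> it (int m) y = y"
    by (rule locally_periodic[OF x(1) \<mu>]) (rule that)
  have "int p dvd int m" using V1(4)[OF V1(2) x(1)] pp(3) by simp
  then obtain q where q: "m = p * q" by auto
  have e': "0 < e / real p" using e pp(1) by simp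
  define good where "good V \<longleftrightarrow> (\<forall>\<kappa> f w.
      (\<forall>y\<in>F. apply_bcontfun \<kappa> (it (int p) y) = apply_bcontfun \<kappa> y) \<longrightarrow>
      (\<forall>y\<in>F. \<forall>n. apply_bcontfun f (it n y) = apply_bcontfun f y) \<longrightarrow>
      (\<forall>y\<in>F. norm (apply_bcontfun \<kappa> y) \<le> norm (apply_bcontfun f y)) \<longrightarrow>
      (\<forall>y\<in>F. apply_bcontfun \<kappa> y \<noteq> 0 \<longrightarrow> y \<in> V) \<longrightarrow> w \<in> vecs H \<longrightarrow>
      nrm (\<rho> (mul (fn \<kappa>) a) w) \<le> e / real p * nrm (\<rho> (fn f) w))" for V
  have "\<exists>V. open V \<and> it (- int j) x \<in> V \<and> good V" for j :: nat
  proof -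
    have xj: "it (- int j) x \<in> Per \<sigma>" "period \<sigma> (it (- int j) x) = p"
      using period_it[OF x(2)] by (simp_all add: p_def)
    show ?thesis
    proof (rule periodic_localisation[OF a xj(1) e', unfolded xj(2)])
      fix V assume V: "open V" "it (- int j) x \<in> V" and l: "\<And>\<kappa> f w.
      \<lbrakk>\<And>y. y \<in> F \<Longrightarrow> apply_bcontfun \<kappa> (it (int p) y) = apply_bcontfun \<kappa> y;
      \<And>y n. y \<in> F \<Longrightarrow> apply_bcontfun f (it n y) = apply_bcontfun f y;
      \<And>y. y \<in> F \<Longrightarrow> norm (apply_bcontfun \<kappa> y) \<le> norm (apply_bcontfun f y);
      \<And>y. y \<in> F \<Longrightarrow> apply_bcontfun \<kappa> y \<noteq> 0 \<Longrightarrow> y \<in> V; w \<in> vecs H\<rbrakk>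
      \<Longrightarrow> nrm (\<rho> (mul (fn \<kappa>) a) w) \<le> e / real p * nrm (\<rho> (fn f) w)"
      have "good V" unfolding good_def by (intro allI impI l; simp)
      with V show ?thesis by blast
    qed
  qed
  then obtain V where V: "\<And>j :: nat. open (V j)" "\<And>j :: nat. it (- int j) x \<in> V j" "\<And>j :: nat. good (V j)"
    by metis
  \<comment> \<open>For each of the \<open>m\<close> times in the sum, going back from
    \<open>W\<close> must end in the neighbourhood attached to the residue of the time.\<close>
  define W where "W = V1 \<inter> (\<Inter>k<m. it (- int k) -` V (k mod p))"
  have "open (it (- int k) -` V (k mod p))" for k
    using continuous_it[of UNIV "- int k"] V(1) by (simp add: continuous_on_open_vimage)
  then have Wo: "open W" unfolding W_def using V1(1) by (intro open_Int open_INT) auto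
  have "it (- int k) x \<in> V (k mod p)" for k
  proof -
    have "int p dvd - int k - - int (k mod p)"
      by (metis dvd_minus_mod diff_minus_eq_add dvd_minus_iff minus_diff_eq uminus_add_conv_diff of_nat_mod)
    then have "it (- int k) x = it (- int (k mod p)) x" using pp(3) it_eq_iff by blast
    then show ?thesis using V(2)[of "k mod p"] by (simp only:)
  qed
  then have xW: "x \<in> W" using V1(2) by (simp add: W_def)
  obtain d0 :: "'a \<Rightarrow>\<^sub>C complex" and d where
    d: "\<And>y. apply_bcontfun d0 y = of_real (d y)" "\<And>y. 0 \<le> d y" "\<And>y. d y \<le> 1"
    "d x = 1" "\<And>y. y \<notin> W \<Longrightarrow> d y = 0"
    by (rule urysohn_point[OF compact_X Wo xW]) (rule that)
  \<comment> \<open>If one of the two points is in \<open>V1\<close>, they coincide; otherwise both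
    values are 0.\<close>
  have dm: "d (it (int m) z) = d z" if z: "z \<in> F" for z
  proof (cases "z \<in> V1 \<or> it (int m) z \<in> V1")
    case True
    then have "it (int m) z = z"
    proof
      assume "it (int m) z \<in> V1"
      then have "it (int m) (it (int m) z) = it (int m) z" using V1(4) support_invariant[OF z] by blast
      then show ?thesis by (simp only: it_inj)
    qed (use V1(4) z in blast)
    then show ?thesis by simp
  next
    case False
    then show ?thesis using d(5) by (simp add: W_def)
  qed
  define \<kappa> where "\<kappa> j = (\<Sum>i<q. al (- int (j + i * p)) d0)" for j
  define k' where "k' j y = (\<Sum>i<q. d (it (int (j + i * p)) y))" for j y
  have \<kappa>: "apply_bcontfun (\<kappa> j) y = of_real (k' j y)" for j y
    by (simp add: \<kappa>_def k'_def apply_sum_bcontfun d(1) add.commute)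
  have k0: "0 \<le> k' j y" for j y by (simp add: k'_def sum_nonneg d(2))
  define g where "g = (\<Sum>j<p. \<kappa> j)"
  define g' where "g' y = (\<Sum>j<p. k' j y)" for y
  have g: "apply_bcontfun g y = of_real (g' y)" for y
    by (simp add: g_def g'_def apply_sum_bcontfun \<kappa>)
  have g'_eq: "g' y = (\<Sum>k<m. d (it (int k) y))" for y
  proof -
    have b: "sum h {i * p..<i * p + p} = (\<Sum>j<p. h (j + i * p))" for h :: "nat \<Rightarrow> real" and i
      using sum.shift_bounds_nat_ivl[of h 0 "i * p" p] by (simp add: add.commute lessThan_atLeast0)
    have "(\<Sum>k<q * p. d (it (int k) y)) = (\<Sum>i<q. \<Sum>j<p. d (it (int (j + i * p)) y))"
      unfolding sum.nat_group[symmetric] by (rule sum.cong[OF refl]) (rule b)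
    then show ?thesis unfolding g'_def k'_def q by (subst sum.swap) (simp only: mult.commute)
  qed
  \<comment> \<open>The two sums differ only by the terms at times \<open>m\<close> and 0, which
    agree by \<open>dm\<close>.\<close>
  have g1: "g' (it 1 y) = g' y" if y: "y \<in> F" for y
  proof -
    have "g' (it 1 y) + d y = (\<Sum>k<Suc m. d (it (int k) y))"
      unfolding g'_eq sum.lessThan_Suc_shift by (simp add: add.commute)
    also have "\<dots> = g' y + d y" using dm[OF y] by (simp add: g'_eq)
    finally show ?thesis by simp
  qed
  have ginv: "g' (it n y) = g' y" if y: "y \<in> F" for y n
    using invariant_multiple[where G = g' and q = 1 and k = n, OF g1 y] by simp
  have kp: "k' j (it (int p) y) = k' j y" if y: "y \<in> F" for j y
  proof -
    have "k' j (it (int p) y) + d (it (int j) y) = (\<Sum>i<Suc q. d (it (int (j + i * p)) y))"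
      unfolding k'_def sum.lessThan_Suc_shift by (simp add: algebra_simps)
    also have "\<dots> = k' j y + d (it (int j) y)"
      using dm[OF support_invariant[OF y, of "int j"]] by (simp add: k'_def q algebra_simps)
    finally show ?thesis by simp
  qed
  have kV: "y \<in> V j" if jp: "j < p" and kn: "k' j y \<noteq> 0" for j y
  proof -
    obtain i where i: "i < q" "d (it (int (j + i * p)) y) \<noteq> 0"
      using kn unfolding k'_def by (metis (no_types, lifting) lessThan_iff sum.neutral)
    have "j + i * p < m"
    proof -
      have "j + i * p < p + i * p" using jp by simp
      also have "\<dots> = (i + 1) * p" by simp
      also have "\<dots> \<le> q * p" using i(1) by (intro mult_right_mono) auto
      finally show ?thesis by (simp add: q mult.commute)
    qed
    moreover have "it (int (j + i * p)) y \<in> W" using d(5) i(2) by blast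
    ultimately have "it (- int (j + i * p)) (it (int (j + i * p)) y) \<in> V ((j + i * p) mod p)"
      unfolding W_def by blast
    then show ?thesis using jp by simp
  qed
  have kg: "k' j y \<le> g' y" if "j < p" for j y
    unfolding g'_def using that k0 by (intro member_le_sum) auto
  have g0: "0 \<le> g' y" for y by (simp add: g'_def sum_nonneg k0)
  show ?thesis
  proof (rule that[OF g g0 _ ginv])
    have "d (it (int 0) x) \<le> (\<Sum>k<m. d (it (int k) x))"
      using V1(3) d(2) by (intro member_le_sum) auto
    then show "1 \<le> g' x" using d(4) by (simp add: g'_eq)
    fix \<theta> :: "'a \<Rightarrow>\<^sub>C complex" and w assume \<theta>: "\<And>y n. y \<in> F \<Longrightarrow> apply_bcontfun \<theta> (it n y) = apply_bcontfun \<theta> y" and w: "w \<in> vecs H"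
    let ?f = "cf_mult \<theta> g"
    have al: "a \<in> l1" using a by (simp add: vanishing_ideal_def)
    have one: "nrm (\<rho> (mul (fn (cf_mult \<theta> (\<kappa> j))) a) w) \<le> e / real p * nrm (\<rho> (fn ?f) w)" if j: "j < p" for j
    proof -
      have "\<forall>y\<in>F. apply_bcontfun (cf_mult \<theta> (\<kappa> j)) (it (int p) y) = apply_bcontfun (cf_mult \<theta> (\<kappa> j)) y"
        using kp \<theta> by (simp add: apply_cf_mult \<kappa>)
      moreover have "\<forall>y\<in>F. \<forall>n. apply_bcontfun ?f (it n y) = apply_bcontfun ?f y"
        using ginv \<theta> by (simp add: apply_cf_mult g)
      moreover have "\<forall>y\<in>F. norm (apply_bcontfun (cf_mult \<theta> (\<kappa> j)) y) \<le> norm (apply_bcontfun ?f y)"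
        using kg[OF j] k0 g0 by (auto simp: apply_cf_mult \<kappa> g norm_mult intro!: mult_left_mono)
      moreover have "\<forall>y\<in>F. apply_bcontfun (cf_mult \<theta> (\<kappa> j)) y \<noteq> 0 \<longrightarrow> y \<in> V j"
        using kV[OF j] by (auto simp: apply_cf_mult \<kappa>)
      ultimately show ?thesis using V(3)[of j] w unfolding good_def by blast
    qed
    have "?f = (\<Sum>j<p. cf_mult \<theta> (\<kappa> j))"
      by (rule bcontfun_eqI) (simp add: apply_cf_mult apply_sum_bcontfun g_def sum_distrib_left)
    then have "nrm (\<rho> (mul (fn ?f) a) w) = nrm (\<rho> (fn (\<Sum>j<p. cf_mult \<theta> (\<kappa> j))) (\<rho> a w))"
      using al w by (simp add: rho_mul)
    also have "\<dots> \<le> (\<Sum>j<p. nrm (\<rho> (fn (cf_mult \<theta> (\<kappa> j))) (\<rho> a w)))"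
      using al w by (intro norm_fn_sum) auto
    also have "\<dots> = (\<Sum>j<p. nrm (\<rho> (mul (fn (cf_mult \<theta> (\<kappa> j))) a) w))"
      using al w by (simp add: rho_mul)
    also have "\<dots> \<le> (\<Sum>j<p. e / real p * nrm (\<rho> (fn ?f) w))" by (intro sum_mono one) simp
    also have "\<dots> = e * nrm (\<rho> (fn ?f) w)" using pp(1) by simp
    finally show "nrm (\<rho> (mul (fn ?f) a) w) \<le> e * nrm (\<rho> (fn ?f) w)" .
  qed
qed

lemma inner_fn_sum:
  assumes "finite J" "u \<in> vecs H"
  shows "vinner H (\<rho> (fn (\<Sum>j\<in>J. h j)) u) u = (\<Sum>j\<in>J. vinner H (\<rho> (fn (h j)) u) u)"
  using assms
  by (induction J rule: finite_induct) (simp_all add: rho_fn_zero inner_zero fn_add rho_add inner_add_left)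

lemma support_closed: "closed F"
proof -
  have "F = (\<Inter>f\<in>Collect null_fn. {x. apply_bcontfun f x = 0})" by (auto simp: F_def)
  moreover have "closed {x. apply_bcontfun f x = 0}" for f :: "'a \<Rightarrow>\<^sub>C complex"
    by (intro closed_Collect_eq continuous_intros) simp_all
  ultimately show ?thesis by (simp add: closed_INT)
qed

text \<open>The squares of functions \<open>f x\<close>, invariant on \<open>F\<close>, and a
  remainder \<tau> add up to 1, which splits the squared norm of \<rho>(a) w. The \<open>f x\<close>
  obey the local estimates, while \<tau> vanishes at the points of \<open>F\<close> where a leading
  coefficient of \<open>a\<close> is not small, so that \<tau> a is small.\<close>

lemma vanishing_rep_small:
  assumes a: "a \<in> vanishing_ideal \<sigma> (zero_set K)" and w: "w \<in> vecs H" and e: "0 < e"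
  shows "(nrm (\<rho> a w))\<^sup>2 \<le> (2 * e * l1_norm a + e\<^sup>2) * (nrm w)\<^sup>2"
proof -
  have al: "a \<in> l1" using a by (simp add: vanishing_ideal_def)
  obtain M where M: "l1_norm (l1_cut (- {- int M..int M}) a) < e" using l1_tail_small[OF al e] by blast
  let ?A = "{- int M..int M}"
  \<comment> \<open>At points of \<open>F\<close> outside \<open>X\<close> the 2 M + 1 leading
    coefficients then add up to at most \<open>e\<close>.\<close>
  define \<eta> where "\<eta> = e / (2 * real M + 1)"
  have \<eta>: "0 < \<eta>" using e by (simp add: \<eta>_def)
  define X where "X = F \<inter> (\<Union>n\<in>?A. {y. \<eta> \<le> norm (apply_bcontfun (a n) y)})"
  have "closed {y. \<eta> \<le> norm (apply_bcontfun (a n) y)}" for n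
    by (intro closed_Collect_le continuous_intros) simp_all
  then have "closed X" unfolding X_def by (intro closed_Int support_closed closed_UN) auto
  then have X: "compact X" using compact_X by (metis compact_Int_closed inf_top_left)
  define P where "P x g g' \<longleftrightarrow> (\<forall>y. apply_bcontfun g y = of_real (g' y)) \<and> (\<forall>y. 0 \<le> g' y) \<and> 1 \<le> g' x \<and>
    (\<forall>y\<in>F. \<forall>n. g' (it n y) = g' y) \<and>
    (\<forall>\<theta> w. (\<forall>y\<in>F. \<forall>n. apply_bcontfun \<theta> (it n y) = apply_bcontfun \<theta> y) \<longrightarrow> w \<in> vecs H \<longrightarrow>
      nrm (\<rho> (mul (fn (cf_mult \<theta> g)) a) w) \<le> e * nrm (\<rho> (fn (cf_mult \<theta> g)) w))"
    for x :: 'a and g and g' :: "'a \<Rightarrow> real"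
  have "\<exists>g g'. P x g g'" if x: "x \<in> X" for x
  proof -
    obtain n where xF: "x \<in> F" and n: "\<eta> \<le> norm (apply_bcontfun (a n) x)"
      using x unfolding X_def by blast
    have nz: "apply_bcontfun (a n) x \<noteq> 0" using n \<eta> by auto
    obtain \<mu> where "x \<in> Per \<sigma>" "norm \<mu> = 1" "(x, \<mu>) \<notin> zero_set K" using nonvanishing_point[OF a xF nz] by blast
    then show ?thesis
    proof (rule orbit_sum_localisation[OF a xF _ _ _ e])
      fix g :: "'a \<Rightarrow>\<^sub>C complex" and g' :: "'a \<Rightarrow> real" assume g: "\<And>y. apply_bcontfun g y = of_real (g' y)" "\<And>y. 0 \<le> g' y" "1 \<le> g' x"
      "\<And>y n. y \<in> F \<Longrightarrow> g' (it n y) = g' y"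
      and l: "\<And>\<theta> w. \<lbrakk>\<And>y n. y \<in> F \<Longrightarrow> apply_bcontfun \<theta> (it n y) = apply_bcontfun \<theta> y; w \<in> vecs H\<rbrakk>
        \<Longrightarrow> nrm (\<rho> (mul (fn (cf_mult \<theta> g)) a) w) \<le> e * nrm (\<rho> (fn (cf_mult \<theta> g)) w)"
      have "P x g g'" unfolding P_def by (intro conjI allI impI ballI g l; simp)
      then show ?thesis by blast
    qed
  qed
  then obtain g g' where P: "\<And>x. x \<in> X \<Longrightarrow> P x (g x) (g' x)" by metis
  have gc: "continuous_on UNIV (g' x)" if "x \<in> X" for x
  proof -
    have "g' x = (\<lambda>y. Re (apply_bcontfun (g x) y))" using P[OF that] by (simp add: P_def)
    then show ?thesis by (simp add: continuous_on_Re)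
  qed
  have "open {y. 1/2 < g' x y}" if "x \<in> X" for x
    using gc[OF that] by (intro open_Collect_less continuous_intros)
  moreover have "X \<subseteq> (\<Union>x\<in>X. {y. 1/2 < g' x y})"
  proof
    fix x assume "x \<in> X"
    moreover have "1 \<le> g' x x" using P[OF \<open>x \<in> X\<close>] by (simp add: P_def)
    ultimately show "x \<in> (\<Union>x\<in>X. {y. 1/2 < g' x y})" by force
  qed
  ultimately obtain D where D: "D \<subseteq> X" "finite D" "X \<subseteq> (\<Union>x\<in>D. {y. 1/2 < g' x y})"
    using compactE_image[OF X, of X "\<lambda>x. {y. 1/2 < g' x y}"] by metis
  \<comment> \<open>The factor 2 turns the bound 1/2 on the cover into 1, so that \<open>G\<close>
    is at least 1 on \<open>X\<close>.\<close>
  define G where "G y = (\<Sum>x\<in>D. (2 * g' x y)\<^sup>2)" for y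
  have G0: "0 \<le> G y" for y by (simp add: G_def sum_nonneg)
  have GX: "1 \<le> G y" if yX: "y \<in> X" for y
  proof -
    obtain x where x: "x \<in> D" "1/2 < g' x y" using D(3) yX by blast
    have "1\<^sup>2 \<le> (2 * g' x y)\<^sup>2" using x(2) by (intro power_mono) auto
    also have "\<dots> \<le> G y" unfolding G_def using x(1) D(2) by (intro member_le_sum) auto
    finally show ?thesis by simp
  qed
  have Gc: "continuous_on UNIV G" unfolding G_def using gc D(1) by (intro continuous_intros) auto
  \<comment> \<open>The maximum with 1 keeps the normalisation continuous where \<open>G\<close> is
    small. The squares of the \<open>f x\<close> sum to G / max(G, 1), which is 1 on
    \<open>X\<close> and at most 1 everywhere.\<close>
  define s where "s y = 2 / sqrt (max (G y) 1)" for y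
  have sq: "0 < sqrt (max (G y) 1)" for y by simp
  have sc: "continuous_on UNIV s"
    unfolding s_def using Gc sq by (intro continuous_intros) (auto simp: less_imp_neq[symmetric])
  define \<theta> :: "'a \<Rightarrow>\<^sub>C complex" where "\<theta> = Bcontfun (\<lambda>y. of_real (s y))"
  have \<theta>: "apply_bcontfun \<theta> y = of_real (s y)" for y
    unfolding \<theta>_def by (subst apply_Bcontfun[OF compact_X]) (use sc in \<open>auto intro!: continuous_intros\<close>)
  have Ginv: "G (it n y) = G y" if "y \<in> F" for n y
    unfolding G_def using P D(1) that by (intro sum.cong refl) (auto simp: P_def)
  have \<theta>inv: "apply_bcontfun \<theta> (it n y) = apply_bcontfun \<theta> y" if "y \<in> F" for n y
    using Ginv[OF that] by (simp add: \<theta> s_def)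
  define f where "f x = cf_mult \<theta> (g x)" for x
  define f' where "f' x y = s y * g' x y" for x y
  have f: "apply_bcontfun (f x) y = of_real (f' x y)" if "x \<in> D" for x y
    using P[of x] D(1) that by (auto simp: f_def f'_def apply_cf_mult \<theta> P_def)
  have fsum: "(\<Sum>x\<in>D. (f' x y)\<^sup>2) = G y / max (G y) 1" for y
  proof -
    have "(\<Sum>x\<in>D. (f' x y)\<^sup>2) = (\<Sum>x\<in>D. (2 * g' x y)\<^sup>2 / max (G y) 1)"
      using G0[of y] by (intro sum.cong refl) (simp add: f'_def s_def power_mult_distrib power_divide)
    then show ?thesis by (simp add: G_def sum_divide_distrib)
  qed
  define \<tau> where "\<tau> = const_bcontfun 1 - (\<Sum>x\<in>D. cf_mult (f x) (f x))"
  define c' where "c' y = 1 - G y / max (G y) 1" for y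
  have \<tau>: "apply_bcontfun \<tau> y = of_real (c' y)" for y
  proof -
    have "(\<Sum>x\<in>D. apply_bcontfun (f x) y * apply_bcontfun (f x) y) = of_real (\<Sum>x\<in>D. (f' x y)\<^sup>2)"
      by (simp add: f power2_eq_square)
    then show ?thesis by (simp add: \<tau>_def c'_def apply_sum_bcontfun apply_cf_mult flip: fsum)
  qed
  have c': "0 \<le> c' y" "c' y \<le> 1" for y
    using G0[of y] by (auto simp: c'_def divide_le_eq_1 max_def)
  have cX: "c' y = 0" if "y \<in> X" for y using GX[OF that] by (simp add: c'_def max_def)
  have sa: "vinner H (\<rho> (fn (cf_mult (f x) (f x))) u) u = of_real ((nrm (\<rho> (fn (f x)) u))\<^sup>2)"
    if "x \<in> D" "u \<in> vecs H" for x u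
  proof -
    have "cf_cnj (f x) = f x" by (rule bcontfun_eqI) (simp add: apply_cf_cnj f that)
    then show ?thesis using rho_norm_sq[of "fn (f x)" u] that by (simp add: star_fn fn_mult)
  qed
  have split: "vinner H (\<rho> l1_one u) u =
      vinner H (\<rho> (fn \<tau>) u) u + of_real (\<Sum>x\<in>D. (nrm (\<rho> (fn (f x)) u))\<^sup>2)" if u: "u \<in> vecs H" for u
  proof -
    have "const_bcontfun 1 = \<tau> + (\<Sum>x\<in>D. cf_mult (f x) (f x))" by (simp add: \<tau>_def)
    then have "l1_one = l1_add (fn \<tau>) (fn (\<Sum>x\<in>D. cf_mult (f x) (f x)))" by (simp only: fn_add)
    then have "vinner H (\<rho> l1_one u) u = vinner H (\<rho> (fn \<tau>) u) u + vinner H (\<rho> (fn (\<Sum>x\<in>D. cf_mult (f x) (f x))) u) u"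
      using u by (simp add: rho_add inner_add_left)
    then show ?thesis using u D(2) by (simp add: inner_fn_sum sa)
  qed
  let ?v = "\<rho> a w" and ?S = "\<lambda>u. \<Sum>x\<in>D. (nrm (\<rho> (fn (f x)) u))\<^sup>2"
  have v: "?v \<in> vecs H" using al w by simp
  have "?S w \<le> (nrm w)\<^sup>2"
  proof -
    have "0 \<le> Re (vinner H (\<rho> (fn \<tau>) w) w)" by (rule inner_fn_nonneg[OF _ w]) (use \<tau> c' in auto)
    then show ?thesis using split[OF w] rho_one_inner[OF w] by simp
  qed
  \<comment> \<open>The number of pieces does not enter, since each is bounded relative to its own
    \<open>\<rho> (fn (f x)) w\<close>.\<close>
  moreover have "?S ?v \<le> e\<^sup>2 * ?S w"
  proof -
    have "nrm (\<rho> (fn (f x)) ?v) \<le> e * nrm (\<rho> (fn (f x)) w)" if "x \<in> D" for x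
    proof -
      have "nrm (\<rho> (mul (fn (f x)) a) w) \<le> e * nrm (\<rho> (fn (f x)) w)"
        using P[of x] D(1) that \<theta>inv w unfolding P_def f_def by blast
      then show ?thesis using al w by (simp add: rho_mul)
    qed
    then have "(nrm (\<rho> (fn (f x)) ?v))\<^sup>2 \<le> e\<^sup>2 * (nrm (\<rho> (fn (f x)) w))\<^sup>2" if "x \<in> D" for x
      using that norm_nonneg[of "\<rho> (fn (f x)) ?v"] v by (simp add: power_mono flip: power_mult_distrib)
    then show ?thesis unfolding sum_distrib_left by (rule sum_mono)
  qed
  moreover have "Re (vinner H (\<rho> (fn \<tau>) ?v) ?v) \<le> 2 * e * nrm w * (l1_norm a * nrm w)"
  proof -
    let ?c = "mul (fn \<tau>) a"
    let ?t1 = "\<lambda>n. if n \<in> ?A then \<eta> else 0" and ?t2 = "\<lambda>n. norm (l1_cut (- ?A) a n)"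
    have cl: "?c \<in> l1" using al by simp
    have h1: "(?t1 has_sum ((2 * real M + 1) * \<eta>)) UNIV"
      by (rule has_sum_finite_neutralI[of ?A]) auto
    have h2: "(?t2 has_sum l1_norm (l1_cut (- ?A) a)) UNIV"
      unfolding l1_norm_def using l1_cut_in[OF al] by (intro has_sum_infsum) (simp add: l1_iff)
    note h = has_sum_add[OF h1 h2]
    have "nrm (\<rho> ?c w) \<le> infsum (\<lambda>n. ?t1 n + ?t2 n) UNIV * nrm (\<rho> l1_one w)"
    proof (rule norm_rho_dominated[OF cl has_sum_imp_summable[OF h] _ w])
      show "0 \<le> ?t1 n + ?t2 n" for n using \<eta> by simp
      fix y n assume y: "y \<in> F"
      have "c' y * norm (apply_bcontfun (a n) y) \<le> ?t1 n + ?t2 n"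
      proof (cases "n \<in> ?A")
        case True
        show ?thesis
        proof (cases "y \<in> X")
          case False
          then have "\<not> \<eta> \<le> norm (apply_bcontfun (a n) y)" using y True unfolding X_def by blast
          then have "norm (apply_bcontfun (a n) y) \<le> \<eta>" by simp
          then have "c' y * norm (apply_bcontfun (a n) y) \<le> 1 * \<eta>" using c' by (intro mult_mono) auto
          then show ?thesis using True by (simp add: l1_cut_def)
        qed (use cX \<eta> in simp)
      next
        case False
        have "c' y * norm (apply_bcontfun (a n) y) \<le> 1 * norm (a n)" using c' by (intro mult_mono norm_bounded) auto
        then show ?thesis using False by (auto simp: l1_cut_def)
      qed
      then show "norm (apply_bcontfun (?c n) y) \<le> (?t1 n + ?t2 n) * norm (apply_bcontfun (const_bcontfun 1) y :: complex)"
        using c'(1)[of y] by (simp add: mul_fn_left apply_cf_mult norm_mult \<tau>)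
    qed simp
    also have "infsum (\<lambda>n. ?t1 n + ?t2 n) UNIV = (2 * real M + 1) * \<eta> + l1_norm (l1_cut (- ?A) a)"
      by (rule infsumI[OF h])
    also have "\<dots> * nrm (\<rho> l1_one w) \<le> (2 * e) * nrm w"
    proof (rule mult_mono)
      have "(2 * real M + 1) * \<eta> = e" by (simp add: \<eta>_def)
      then show "(2 * real M + 1) * \<eta> + l1_norm (l1_cut (- ?A) a) \<le> 2 * e" using M by simp
      show "nrm (\<rho> l1_one w) \<le> nrm w" by (rule norm_delta[OF w])
    qed (use e norm_nonneg w in auto)
    finally have cw: "nrm (\<rho> (fn \<tau>) ?v) \<le> 2 * e * nrm w" using al w by (simp add: rho_mul)
    have "Re (vinner H (\<rho> (fn \<tau>) ?v) ?v) \<le> nrm (\<rho> (fn \<tau>) ?v) * nrm ?v"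
      using cauchy_schwarz[of "\<rho> (fn \<tau>) ?v" ?v] v complex_Re_le_cmod order_trans by (meson l1_mono_in rho_closed)
    also have "\<dots> \<le> (2 * e * nrm w) * (l1_norm a * nrm w)"
      using cw norm_rho_le[OF al w] e norm_nonneg[OF w] norm_nonneg[OF v] by (intro mult_mono) auto
    finally show ?thesis .
  qed
  moreover have "(nrm ?v)\<^sup>2 = Re (vinner H (\<rho> (fn \<tau>) ?v) ?v) + ?S ?v"
  proof -
    \<comment> \<open>\<open>?v\<close> is in the range of \<open>\<rho> a\<close>, on which
      \<rho>(1) is the identity.\<close>
    have "\<rho> l1_one ?v = ?v" using al w by (metis l1_mono_in mul_one_left rho_mul)
    then show ?thesis using split[OF v] v by (simp add: norm_sq)
  qed
  moreover have "e\<^sup>2 * ?S w \<le> e\<^sup>2 * (nrm w)\<^sup>2" using calculation(1) by (intro mult_left_mono) auto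
  ultimately have "(nrm ?v)\<^sup>2 \<le> 2 * e * nrm w * (l1_norm a * nrm w) + e\<^sup>2 * (nrm w)\<^sup>2" by linarith
  also have "\<dots> = (2 * e * l1_norm a + e\<^sup>2) * (nrm w)\<^sup>2" by (simp add: power2_eq_square algebra_simps)
  finally show ?thesis .
qed

text \<open>The bound of \<open>vanishing_rep_small\<close> holds for every positive
  \<open>e\<close> and tends to 0 with it.\<close>

theorem kernel_synthesis: "vanishing_ideal \<sigma> (zero_set K) = K"
proof
  show "vanishing_ideal \<sigma> (zero_set K) \<subseteq> K"
  proof
    fix a assume a: "a \<in> vanishing_ideal \<sigma> (zero_set K)"
    then have al: "a \<in> l1" by (simp add: vanishing_ideal_def)
    have "\<rho> a w = vzero H" if w: "w \<in> vecs H" for w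
    proof -
      have "((\<lambda>e. (2 * e * l1_norm a + e\<^sup>2) * (nrm w)\<^sup>2) \<longlongrightarrow> (2 * 0 * l1_norm a + 0\<^sup>2) * (nrm w)\<^sup>2) (at_right 0)"
        by (intro tendsto_intros)
      then have "(nrm (\<rho> a w))\<^sup>2 \<le> (2 * 0 * l1_norm a + 0\<^sup>2) * (nrm w)\<^sup>2"
        by (rule tendsto_lowerbound)
           (auto intro!: eventually_at_rightI[of 0 1] vanishing_rep_small[OF a w])
      then have "nrm (\<rho> a w) = 0" by simp
      then show ?thesis using norm_zero_iff al w by simp
    qed
    then show "a \<in> K" using al by (simp add: K_def rep_kernel_def)
  qed
qed (rule ideal_subset_vanishing[OF K_ideal])

text \<open>By \<open>norm_rho_le\<close>, a vector not annihilated by \<open>a\<close> is not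
  annihilated by elements near \<open>a\<close> either.\<close>

lemma kernel_closed: "l1_closed K"
proof -
  interpret M: Metric_space l1 "l1_dist :: (int \<Rightarrow> ('a \<Rightarrow>\<^sub>C complex)) \<Rightarrow> _" by (rule l1_metric) simp
  show ?thesis
    unfolding l1_closed_def M.closedin_metric
  proof (intro conjI allI impI)
    show "K \<subseteq> l1" using K_l1 by blast
    fix a assume a: "a \<in> l1 - K"
    then obtain u where u: "u \<in> vecs H" "\<rho> a u \<noteq> vzero H" by (auto simp: K_def rep_kernel_def)
    have au: "0 < nrm (\<rho> a u)" using a u norm_zero_iff[of "\<rho> a u"] norm_nonneg[of "\<rho> a u"] by simp
    define r where "r = nrm (\<rho> a u) / (nrm u + 1)"
    have r: "0 < r" using au norm_nonneg[OF u(1)] by (simp add: r_def)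
    have "l1_dist a b \<ge> r" if b: "b \<in> K" for b
    proof (rule ccontr)
      assume lt: "\<not> r \<le> l1_dist a b"
      have bl: "b \<in> l1" using K_l1[OF b] .
      have "a = l1_add (l1_sub a b) b" by (simp add: l1_add_def l1_sub_def)
      then have "nrm (\<rho> a u) \<le> nrm (\<rho> (l1_sub a b) u) + nrm (\<rho> b u)"
        using norm_rho_add[of "l1_sub a b" b u] a bl u by simp
      also have "nrm (\<rho> b u) = 0" using K_zero[OF b u(1)] norm_zero_iff[OF zero_closed] by simp
      also have "nrm (\<rho> (l1_sub a b) u) \<le> l1_dist a b * nrm u"
        using norm_rho_le[of "l1_sub a b" u] a bl u by (simp add: l1_dist_eq)
      also have "\<dots> \<le> r * nrm u" using lt norm_nonneg[OF u(1)] by (intro mult_right_mono) auto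
      also have "\<dots> < nrm (\<rho> a u)" using au norm_nonneg[OF u(1)] by (simp add: r_def field_simps)
      finally show False by simp
    qed
    then have "disjnt K (M.mball a r)" unfolding disjnt_iff by force
    then show "\<exists>r>0. disjnt K (M.mball a r)" using r by blast
  qed
qed

end

section \<open>The equivalences\<close>

text \<open>Functions of pairs are stored as functions of triples supported at last coordinate 0, in
  the summand of the universe that is present for every \<open>'h\<close>.\<close>

definition index_copy :: "('a \<times> complex \<Rightarrow> complex) \<Rightarrow> ('a, 'h) hilbert_universe" where
  "index_copy \<xi> = Inr (\<lambda>(x, \<mu>, k). if k = 0 then \<xi> (x, \<mu>) else 0)"

lemma inj_index_copy: "inj index_copy"
proof (rule injI)
  fix \<xi> \<eta> :: "'a \<times> complex \<Rightarrow> complex"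
  assume "(index_copy \<xi> :: ('a, 'h) hilbert_universe) = index_copy \<eta>"
  then have "(\<lambda>(x, \<mu>, k :: int). if k = 0 then \<xi> (x, \<mu>) else 0) = (\<lambda>(x, \<mu>, k). if k = 0 then \<eta> (x, \<mu>) else 0)"
    by (simp add: index_copy_def)
  then have "\<xi> (x, \<mu>) = \<eta> (x, \<mu>)" for x \<mu> by (drule_tac x = "(x, \<mu>, 0)" in fun_cong) simp
  then show "\<xi> = \<eta>" by auto
qed

context dynamics
begin

lemma invariant_set_zero_set: "l1_ideal \<sigma> I \<Longrightarrow> invariant_set \<sigma> (zero_set I)"
  by unfold_locales (use zero_set_circle zero_set_invariant in auto)

lemma vanishing_ideal_representation:
  assumes "l1_ideal \<sigma> I"
  obtains H :: "('a, 'h) hilbert_universe inner_space" and \<rho> where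
    "involutive_representation \<sigma> H \<rho>" "rep_kernel H \<rho> = vanishing_ideal \<sigma> (zero_set I)"
proof -
  interpret invariant_set \<sigma> "zero_set I" by (rule invariant_set_zero_set[OF assms])
  show ?thesis
    using that hcopy_representation[OF inj_index_copy orep_representation ell2_metric] orep_kernel by metis
qed

text \<open>These properties come from being the kernel of \<open>orep\<close> over the invariant
  zero set; the definition of \<open>vanishing_ideal\<close> speaks only of right multiplication by
  functions.\<close>

lemma vanishing_ideal_ideal:
  assumes "l1_ideal \<sigma> I"
  shows "l1_ideal \<sigma> (vanishing_ideal \<sigma> (zero_set I))"
    "l1_self_adjoint \<sigma> (vanishing_ideal \<sigma> (zero_set I))"
    "l1_closed (vanishing_ideal \<sigma> (zero_set I))"
proof -
  interpret invariant_set \<sigma> "zero_set I" by (rule invariant_set_zero_set[OF assms])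
  interpret representation \<sigma> E orep by unfold_locales (rule orep_representation)
  show "l1_ideal \<sigma> (vanishing_ideal \<sigma> (zero_set I))" "l1_self_adjoint \<sigma> (vanishing_ideal \<sigma> (zero_set I))"
    using rep_kernel_ideal[OF orep_representation] by (simp_all add: orep_kernel)
  show "l1_closed (vanishing_ideal \<sigma> (zero_set I))" using kernel_closed by (simp add: K_def orep_kernel)
qed

text \<open>For the converse the condition is tested on the vanishing ideal of the zero set, an
  ideal by \<open>vanishing_ideal_ideal\<close> whose own zero set contains that of
  \<open>I\<close>.\<close>

lemma vanishing_iff_galois:
  assumes I: "l1_ideal \<sigma> I"
  shows "vanishing_ideal \<sigma> (zero_set I) = I \<longleftrightarrow>
    (\<forall>I'. l1_ideal \<sigma> I' \<longrightarrow> (I' \<subseteq> I \<longleftrightarrow> zero_set I' \<supseteq> zero_set I))"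
proof
  assume eq: "vanishing_ideal \<sigma> (zero_set I) = I"
  have "I' \<subseteq> I" if "l1_ideal \<sigma> I'" "zero_set I' \<supseteq> zero_set I" for I'
  proof -
    have "I' \<subseteq> vanishing_ideal \<sigma> (zero_set I')" by (rule ideal_subset_vanishing[OF that(1)])
    also have "\<dots> \<subseteq> vanishing_ideal \<sigma> (zero_set I)" using that(2) by (auto simp: vanishing_ideal_def)
    finally show ?thesis using eq by simp
  qed
  then show "\<forall>I'. l1_ideal \<sigma> I' \<longrightarrow> (I' \<subseteq> I \<longleftrightarrow> zero_set I' \<supseteq> zero_set I)"
    by (auto simp: zero_set_def)
next
  assume galois: "\<forall>I'. l1_ideal \<sigma> I' \<longrightarrow> (I' \<subseteq> I \<longleftrightarrow> zero_set I' \<supseteq> zero_set I)"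
  have "zero_set (vanishing_ideal \<sigma> (zero_set I)) \<supseteq> zero_set I"
  proof
    fix z assume z: "z \<in> zero_set I"
    have "transform a z = 0" if "a \<in> vanishing_ideal \<sigma> (zero_set I)" for a
    proof -
      have "transform (mul a (l1_embed (const_bcontfun 1))) z = 0" using that z by (simp add: vanishing_ideal_def)
      then show ?thesis by (simp add: l1_embed_eq mul_one_right)
    qed
    then show "z \<in> zero_set (vanishing_ideal \<sigma> (zero_set I))" using z by (auto simp: zero_set_def)
  qed
  then have "vanishing_ideal \<sigma> (zero_set I) \<subseteq> I" using galois vanishing_ideal_ideal(1)[OF I] by blast
  then show "vanishing_ideal \<sigma> (zero_set I) = I" using ideal_subset_vanishing[OF I] by blast
qed

end

theorem theorem4p16:
  fixes \<sigma> :: "'a::t2_space \<Rightarrow> 'a"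
    and I :: "(int \<Rightarrow> ('a \<Rightarrow>\<^sub>C complex)) set"
  assumes compact_X: "compact (UNIV :: 'a set)"
    and homeo: "homeomorphism UNIV UNIV \<sigma> (inv \<sigma>)"
    and ideal: "l1_ideal \<sigma> I"
  shows
    "(vanishing_ideal \<sigma> (zero_set I) = I \<longleftrightarrow>
       (\<exists>Sap Sp T. Sap \<subseteq> Aper \<sigma> \<and> Sp \<subseteq> Per \<sigma> \<and> (\<forall>x\<in>Sp. T x \<subseteq> unit_circle) \<and>
         I = l1 \<inter> (\<Inter>x\<in>Sap. aper_ideal \<sigma> x) \<inter> (\<Inter>x\<in>Sp. \<Inter>\<mu>\<in>T x. per_ideal \<sigma> x \<mu>)))
     \<and>
     (vanishing_ideal \<sigma> (zero_set I) = I \<longleftrightarrow>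
       (\<exists>(H :: ('a, 'h) hilbert_universe inner_space) \<rho>.
         involutive_representation \<sigma> H \<rho> \<and> I = rep_kernel H \<rho>))
     \<and>
     (vanishing_ideal \<sigma> (zero_set I) = I \<longleftrightarrow>
       (\<forall>I'. l1_ideal \<sigma> I' \<longrightarrow> (I' \<subseteq> I \<longleftrightarrow> zero_set I' \<supseteq> zero_set I)))
     \<and>
     (vanishing_ideal \<sigma> (zero_set I) = I \<longrightarrow>
       l1_self_adjoint \<sigma> I \<and> l1_closed I \<and>
       (\<forall>Sap Sp T. Sap \<subseteq> Aper \<sigma> \<and> Sp \<subseteq> Per \<sigma> \<and> (\<forall>x\<in>Sap \<union> Sp. T x \<subseteq> unit_circle) \<and>
         (\<forall>x\<in>Sap. T x \<noteq> {}) \<and>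
         zero_set I = (\<Union>x\<in>Sap. \<Union>\<mu>\<in>T x. orbit_of \<sigma> x \<times> {\<mu>}) \<union>
                      (\<Union>x\<in>Sp. \<Union>\<mu>\<in>T x. orbit_of \<sigma> x \<times> {\<mu>})
         \<longrightarrow>
         (\<forall>x\<in>Sp. \<forall>\<mu>\<in>T x. \<mu> ^ period \<sigma> x \<in> unit_circle) \<and>
         I = l1 \<inter> (\<Inter>x\<in>Sap. aper_ideal \<sigma> x) \<inter>
               (\<Inter>x\<in>Sp. \<Inter>\<mu>\<in>T x. per_ideal \<sigma> x (\<mu> ^ period \<sigma> x))))"
proof -
  interpret dynamics \<sigma> by unfold_locales (rule compact_X homeo)+
  have rep: "vanishing_ideal \<sigma> (zero_set I) = I \<longleftrightarrow>
      (\<exists>(H :: ('a, 'h) hilbert_universe inner_space) \<rho>. involutive_representation \<sigma> H \<rho> \<and> I = rep_kernel H \<rho>)"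
  proof
    assume eq: "vanishing_ideal \<sigma> (zero_set I) = I"
    obtain H :: "('a, 'h) hilbert_universe inner_space" and \<rho> where
      "involutive_representation \<sigma> H \<rho>" "rep_kernel H \<rho> = vanishing_ideal \<sigma> (zero_set I)"
      by (rule vanishing_ideal_representation[OF ideal]) (rule that)
    then show "\<exists>(H :: ('a, 'h) hilbert_universe inner_space) \<rho>. involutive_representation \<sigma> H \<rho> \<and> I = rep_kernel H \<rho>"
      using eq by metis
  next
    assume "\<exists>(H :: ('a, 'h) hilbert_universe inner_space) \<rho>. involutive_representation \<sigma> H \<rho> \<and> I = rep_kernel H \<rho>"
    then obtain H :: "('a, 'h) hilbert_universe inner_space" and \<rho> where
      H: "involutive_representation \<sigma> H \<rho>" "I = rep_kernel H \<rho>" by blast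
    interpret representation \<sigma> H \<rho> by unfold_locales (rule H(1))
    show "vanishing_ideal \<sigma> (zero_set I) = I" using kernel_synthesis by (simp add: K_def H(2))
  qed
  have expl: "(\<forall>x\<in>Sp. \<forall>\<mu>\<in>T x. \<mu> ^ period \<sigma> x \<in> unit_circle) \<and>
      I = l1 \<inter> (\<Inter>x\<in>Sap. aper_ideal \<sigma> x) \<inter> (\<Inter>x\<in>Sp. \<Inter>\<mu>\<in>T x. per_ideal \<sigma> x (\<mu> ^ period \<sigma> x))"
    if eq: "vanishing_ideal \<sigma> (zero_set I) = I"
      and T: "Sap \<subseteq> Aper \<sigma>" "Sp \<subseteq> Per \<sigma>" "\<forall>x\<in>Sap \<union> Sp. T x \<subseteq> unit_circle" "\<forall>x\<in>Sap. T x \<noteq> {}"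
      and z: "zero_set I = (\<Union>x\<in>Sap. \<Union>\<mu>\<in>T x. orbit_of \<sigma> x \<times> {\<mu>}) \<union> (\<Union>x\<in>Sp. \<Union>\<mu>\<in>T x. orbit_of \<sigma> x \<times> {\<mu>})"
    for Sap Sp T
  proof
    show "\<forall>x\<in>Sp. \<forall>\<mu>\<in>T x. \<mu> ^ period \<sigma> x \<in> unit_circle"
    proof (intro ballI)
      fix x \<mu> assume "x \<in> Sp" "\<mu> \<in> T x"
      then have "\<mu> \<in> unit_circle" using T(3) by blast
      then show "\<mu> ^ period \<sigma> x \<in> unit_circle" by (simp add: norm_power)
    qed
    show "I = l1 \<inter> (\<Inter>x\<in>Sap. aper_ideal \<sigma> x) \<inter> (\<Inter>x\<in>Sp. \<Inter>\<mu>\<in>T x. per_ideal \<sigma> x (\<mu> ^ period \<sigma> x))"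
      using vanishing_eq_Inter[of Sap T Sp] T eq unfolding z by simp
  qed
  show ?thesis
    using vanishing_iff_Inter[OF ideal] rep vanishing_iff_galois[OF ideal]
      vanishing_ideal_ideal(2,3)[OF ideal] expl by (intro conjI impI allI) auto
qed

end
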